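(* Let $m\ge1$ be an integer, $s>3/2$ and $\sigma_0>0$, and let $\{\mathcal T_h\}_{h\le h_0}$ be a family of interface-fitted curved meshes as in the context. (i) There exists a constant $C>0$, independent of $h$, such that $$|a_h(w,v)|\le C\,|||w|||_{h,\beta}\,|||v|||_{h,\beta},\qquad w,v\in H^s(\mathcal T_h).$$ (ii) Suppose, in addition, that the parameterizations of $\Gamma_b$ and $\Gamma_i$ are of class $C^3$ and that $h\le h_0$, and let $C_{\rm it}>0$ be a constant, independent of $h$ and $\sigma_0$, such that $$\sum_{e\in\mathcal E_h}\Big\|\Big(\frac{h_e}{\sigma_0\gamma_e}\Big)^{1/2}\{\!\{\beta\partial_{\mathbf n_e}v_h\}\!\}_e\Big\|_{0,e}^2\le\frac{C_{\rm it}}{\sigma_0}\sum_{K\in\mathcal T_h}\|\beta^{1/2}\nabla v_h\|_{0,K}^2,\qquad v_h\in S_h^m(\mathcal T_h).$$ Then $$|a_h(w,v_h)|\le C\Big(1+\frac{C_{\rm it}}{\sigma_0}\Big)^{1/2}|||w|||_{h,\beta}\,\|v_h\|_{h,\beta},\qquad w\in H^s(\mathcal T_h),\ v_h\in S_h^m(\mathcal T_h).$$ (iii) Furthermore, under the assumptions of (ii), if $\sigma_0\ge\sigma_*:=4C_{\rm it}$, then $$a_h(v_h,v_h)\ge\tfrac12\|v_h\|_{h,\beta}^2,\qquad v_h\in S_h^m(\mathcal T_h).$$ Consequently, the discrete problem of finding $u_h\in S_h^m(\mathcal T_h)$ with $a_h(u_h,v_h)=L_h(v_h)$ for all $v_h\in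 S_h^m(\mathcal T_h)$ admits a unique solution.
   Context: Geometry. $\Omega\subset\mathbb R^2$ is a bounded domain with smooth boundary $\Gamma_b$; $\Gamma_i\subset\Omega$ is a smooth curve separating $\Omega$ into disjoint open subdomains $\Omega^\pm$, $\Omega=\Omega^-\cup\Gamma_i\cup\Omega^+$. Each $\Gamma\in\{\Gamma_b,\Gamma_i\}$ has a regular parameterization $\mathbf g:[\xi_s,\xi_e]\to\mathbb R^2$ (depending on $\Gamma$) of class at least $C^2$. Put $\boldsymbol\tau=\mathbf g'/\|\mathbf g'\|$, $\mathbf n=Q\boldsymbol\tau$ with $Q=\begin{bmatrix}0&1\\-1&0\end{bmatrix}$, $\kappa=(\mathbf g')^TQ\mathbf g''/\|\mathbf g'\|^3$. The Frenet transformation is $P_\Gamma(\eta,\xi)=\mathbf g(\xi)+\eta\,\mathbf n(\xi)$, and $N_\Gamma(\epsilon)=P_\Gamma([-\epsilon,\epsilon]\times[\xi_s,\xi_e])$. Let $\epsilon_0>0$ be such that for $0<\epsilon\le\epsilon_0$ and both curves: $P_\Gamma$ is a bijection onto $N_\Gamma(\epsilon)$ with inverse $R_\Gamma(x,y)=(\eta(x,y),\xi(x,y))$ (for a closed curve, modulo identification of $\xi_s$ and $\xi_e$, $\xi$ being taken as a continuous branch on each element); $\tfrac12\le1+\eta\kappa(\xi)\le2$; $|\det DP_\Gamma|,|\det DR_\Gamma|$ lie between positive constants and $\|DP_\Gamma\|,\|DR_\Gamma\|$ are bounded; and $N_{\Gamma_b}(\epsilon)\cap N_{\Gamma_i}(\epsilon)=\emptyset$.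 Meshes. Start from shape-regular straight-sided triangulations $\overline{\mathcal T}_h$ associated with $\Omega$. An edge fits a curve if both its endpoints lie on the curve. The mesh is interface-fitted: no element is cut by $\Gamma_i$ without having an edge fitted to $\Gamma_i$. Elements with a designated edge fitted to $\Gamma_b$ or $\Gamma_i$ are replaced by curved triangles $K$ in which that straight edge is replaced by the corresponding arc of the curve; these curved triangles form $\mathcal T_h^c$. The remaining straight triangles form $\mathcal T_h^r$, and $\mathcal T_h=\mathcal T_h^c\cup\mathcal T_h^r$. With $h_K=\operatorname{diam}K$, $h=\max_Kh_K$, and $\rho_K$ the supremum of radii of balls contained in $K$, we assume $h_K/\rho_K\le C_{\mathrm{sh}}$ uniformly. The curve $\Gamma$ associated with $K\in\mathcal T_h^c$ is the one to which its curved edge belongs; $h_0>0$ is sufficiently small that, for some fixed $\epsilon\in(0,\epsilon_0]$ and all $h\le h_0$, each $K\in\mathcal T_h^c$ lies in $N_\Gamma(\epsilon)$ of its associated curve. Spaces. $\mathbb P_m$ denotes polynomials of total degree at most $m$. For $K\in\mathcal T_h^c$, $S_h^m(K)=\{(\widehat v\circ R_\Gamma)|_K:\widehat v\in\mathbb P_m\text{ in }(\eta,\xi)\}$; for $K\in\mathcal T_h^r$, $S_h^m(K)=\mathbb P_m(K)$; $S_h^m(\mathcal T_h)=\{v\in L^2(\Omega):v|_K\in S_h^m(K)\ \forall K\in\mathcal T_h\}$. $H^s(\mathcal T_h)=\{v\in L^2(\Omega):v|_K\in H^s(K)\ \forall K\}$. Coefficient and data. $\beta|_{\Omega^\pm}=\beta^\pm\in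 W^{1,\infty}(\Omega^\pm)$, $0<\underline\beta\le\beta^\pm\le\overline\beta<\infty$ a.e. in $\Omega^\pm$. $f\in L^2(\Omega)$, $g\in L^2(\Gamma_b)$ are given. Edges. $\mathcal E_h$ is the set of mesh edges, $\mathcal E_h^b$ those contained in $\Gamma_b$. Each edge has a fixed unit normal $\mathbf n_e$ (pointwise on curved edges), outward on boundary edges; for $e=\partial K_1\cap\partial K_2$ with $\mathbf n_e$ pointing from $K_1$ to $K_2$, $[\![v]\!]_e=v_1-v_2$ and $\{\!\{v\}\!\}_e=\frac12(v_1+v_2)$; on boundary edges both denote the one-sided trace. $h_e=|e|$, $\beta_K=\operatorname{ess\,sup}_K\beta$, $\beta_e=\max_{K:e\subset\partial K}\beta_K$, $\gamma_e=m(m+1)\beta_e$, $\sigma_0>0$ is the penalty parameter. Forms. $$a_h(w,v)=\sum_{K}(\beta\nabla w,\nabla v)_K-\sum_{e\in\mathcal E_h}\langle\{\!\{\beta\partial_{\mathbf n_e}w\}\!\}_e,[\![v]\!]_e\rangle_e-\sum_{e\in\mathcal E_h}\langle\{\!\{\beta\partial_{\mathbf n_e}v\}\!\}_e,[\![w]\!]_e\rangle_e+\sum_{e\in\mathcal E_h}\frac{\sigma_0\gamma_e}{h_e}\langle[\![w]\!]_e,[\![v]\!]_e\rangle_e,$$ $$L_h(v)=(f,v)_\Omega+\sum_{e\in\mathcal E_h^b}\Big\langle g,-\beta\partial_{\mathbf n_e}v+\frac{\sigma_0\gamma_e}{h_e}v\Big\rangle_e.$$ Norms. $$\|v\|_{h,\beta}^2=\sum_K\|\beta^{1/2}\nabla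 v\|_{0,K}^2+\sum_{e\in\mathcal E_h}\Big\|\Big(\frac{\sigma_0\gamma_e}{h_e}\Big)^{1/2}[\![v]\!]_e\Big\|_{0,e}^2,\quad |||v|||_{h,\beta}^2=\|v\|_{h,\beta}^2+\sum_{e\in\mathcal E_h}\Big\|\Big(\frac{h_e}{\sigma_0\gamma_e}\Big)^{1/2}\{\!\{\beta\partial_{\mathbf n_e}v\}\!\}_e\Big\|_{0,e}^2.$$ $C$ denotes generic constants independent of $h$ that may depend on $m$, $\sigma_0$, the coefficient bounds and the mesh and geometric regularity constants. *)

theory Defs
  imports "HOL-Analysis.Analysis" "HOL-Probability.Essential_Supremum"
begin

type_synonym point = "real^2"


section \<open>Sobolev spaces on open subsets of the plane\<close>

definition L2 :: "('a::euclidean_space) set \<Rightarrow> ('a \<Rightarrow> real) \<Rightarrow> bool" where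
  "L2 U v \<longleftrightarrow> v \<in> borel_measurable (lebesgue_on U) \<and> integrable (lebesgue_on U) (\<lambda>x. (v x)\<^sup>2)"

definition Linf :: "point set \<Rightarrow> (point \<Rightarrow> real) \<Rightarrow> bool" where
  "Linf U v \<longleftrightarrow> v \<in> borel_measurable (lebesgue_on U) \<and> (\<exists>B. AE x in lebesgue_on U. \<bar>v x\<bar> \<le> B)"

definition pd :: "2 \<Rightarrow> (point \<Rightarrow> real) \<Rightarrow> point \<Rightarrow> real" where
  "pd i \<phi> x = frechet_derivative \<phi> (at x) (axis i 1)"

primrec Ck :: "nat \<Rightarrow> (point \<Rightarrow> real) \<Rightarrow> bool" where
  "Ck 0 \<phi> \<longleftrightarrow> continuous_on UNIV \<phi>"
| "Ck (Suc k) \<phi> \<longleftrightarrow> (\<forall>x. \<phi> differentiable (at x)) \<and> (\<forall>i. Ck k (pd i \<phi>))"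

definition test_fun :: "point set \<Rightarrow> (point \<Rightarrow> real) \<Rightarrow> bool" where
  "test_fun U \<phi> \<longleftrightarrow> (\<forall>k. Ck k \<phi>) \<and>
     compact (closure {x. \<phi> x \<noteq> 0}) \<and> closure {x. \<phi> x \<noteq> 0} \<subseteq> U"

text \<open>\<open>w\<close> is a square integrable weak partial derivative of the square integrable function \<open>v\<close>.\<close>

definition has_weak_partial :: "point set \<Rightarrow> 2 \<Rightarrow> (point \<Rightarrow> real) \<Rightarrow> (point \<Rightarrow> real) \<Rightarrow> bool" where
  "has_weak_partial U i v w \<longleftrightarrow> L2 U v \<and> L2 U w \<and>
     (\<forall>\<phi>. test_fun U \<phi> \<longrightarrow>
        (LINT x|lebesgue_on U. v x * pd i \<phi> x) = - (LINT x|lebesgue_on U. w x * \<phi> x))"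

text \<open>Determined up to null sets when a weak gradient exists; a component that does not exist
  is set to zero.\<close>

definition wgrad :: "point set \<Rightarrow> (point \<Rightarrow> real) \<Rightarrow> point \<Rightarrow> point" where
  "wgrad U v x = (\<chi> i. if \<exists>w. has_weak_partial U i v w
                        then (SOME w. has_weak_partial U i v w) x else 0)"

text \<open>Squared Sobolev--Slobodeckij seminorm in dimension 2.\<close>

definition slobodeckij :: "real \<Rightarrow> point set \<Rightarrow> (point \<Rightarrow> real) \<Rightarrow> ennreal" where
  "slobodeckij \<theta> U v =
     (\<integral>\<^sup>+x. (\<integral>\<^sup>+y. ennreal ((v x - v y)\<^sup>2 / norm (x - y) powr (2 + 2 * \<theta>)) \<partial>lebesgue_on U)
        \<partial>lebesgue_on U)"

primrec sobolev_aux :: "nat \<Rightarrow> real \<Rightarrow> point set \<Rightarrow> (point \<Rightarrow> real) set" where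
  "sobolev_aux 0 \<theta> U = {v. L2 U v \<and> (\<theta> > 0 \<longrightarrow> slobodeckij \<theta> U v < \<infinity>)}"
| "sobolev_aux (Suc k) \<theta> U =
     {v. L2 U v \<and> (\<forall>i. \<exists>w\<in>sobolev_aux k \<theta> U. has_weak_partial U i v w)}"

text \<open>\<open>H\<^sup>s(U)\<close> for real \<open>s \<ge> 0\<close>: weak derivatives of order up to the integer part of \<open>s\<close> are in
  \<open>L\<^sup>2\<close>, those of top order have finite Slobodeckij seminorm for the fractional part.\<close>

definition Hs :: "real \<Rightarrow> point set \<Rightarrow> (point \<Rightarrow> real) set" where
  "Hs s U = sobolev_aux (nat \<lfloor>s\<rfloor>) (frac s) U"

text \<open>For bounded \<open>U\<close>, where bounded functions are square integrable.\<close>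

definition W1inf :: "point set \<Rightarrow> (point \<Rightarrow> real) \<Rightarrow> bool" where
  "W1inf U v \<longleftrightarrow> Linf U v \<and> (\<forall>i. \<exists>w. has_weak_partial U i v w \<and> Linf U w)"

text \<open>Functions on an edge are written as functions of the parameter of a path
  \<open>p\<close> on \<open>[0,1]\<close>. The trace from \<open>K\<close> is characterised by its Lebesgue values, i.e. the
  limits of means over the part in \<open>K\<close> of shrinking balls (Evans and Gariepy, Section 5.3).
  It is unique almost everywhere; if no square integrable trace exists, \<open>trc\<close> is zero.\<close>

definition has_trace :: "point set \<Rightarrow> (real \<Rightarrow> point) \<Rightarrow> (point \<Rightarrow> real) \<Rightarrow> (real \<Rightarrow> real) \<Rightarrow> bool" where
  "has_trace K p v \<tau> \<longleftrightarrow> L2 {0..1} \<tau> \<and>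
     (AE t in lebesgue_on {0..1}.
        ((\<lambda>r. (LINT x|lebesgue_on (K \<inter> ball (p t) r). \<bar>v x - \<tau> t\<bar>)
               / measure lebesgue (K \<inter> ball (p t) r)) \<longlongrightarrow> 0) (at_right 0))"

definition trc :: "point set \<Rightarrow> (real \<Rightarrow> point) \<Rightarrow> (point \<Rightarrow> real) \<Rightarrow> real \<Rightarrow> real" where
  "trc K p v = (if \<exists>\<tau>. has_trace K p v \<tau> then (SOME \<tau>. has_trace K p v \<tau>) else (\<lambda>t. 0))"


section \<open>Curves and the Frenet transformation\<close>

definition Qm :: "real^2^2" where
  "Qm = vector [vector [0, 1], vector [-1, 0]]"

definition vd :: "(real \<Rightarrow> point) \<Rightarrow> real \<Rightarrow> point" where
  "vd p t = vector_derivative p (at t)"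

definition nrml :: "(real \<Rightarrow> point) \<Rightarrow> real \<Rightarrow> point" where
  "nrml p t = Qm *v ((1 / norm (vd p t)) *\<^sub>R vd p t)"

definition Ck_path :: "nat \<Rightarrow> (real \<Rightarrow> point) \<Rightarrow> bool" where
  "Ck_path k p \<longleftrightarrow> (\<forall>j<k. \<forall>t. ((vd ^^ j) p) differentiable (at t)) \<and>
                  (\<forall>j\<le>k. continuous_on UNIV ((vd ^^ j) p))"

record curve =
  par :: "real \<Rightarrow> point"
  lo :: real
  hi :: real

abbreviation period :: "curve \<Rightarrow> real" where
  "period c \<equiv> hi c - lo c"

definition curve_set :: "curve \<Rightarrow> point set" where
  "curve_set c = par c ` {lo c..hi c}"

text \<open>The boundary curve and the interface of a bounded plane domain are closed curves; their
  parameterization on \<open>[lo,hi]\<close> is extended periodically. This makes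
  continuous branches of the inverse Frenet map across the seam available.\<close>

definition closed_curve :: "nat \<Rightarrow> curve \<Rightarrow> bool" where
  "closed_curve k c \<longleftrightarrow> lo c < hi c \<and> Ck_path k (par c) \<and>
     (\<forall>t. par c (t + period c) = par c t) \<and> inj_on (par c) {lo c..<hi c} \<and>
     (\<forall>t. vd (par c) t \<noteq> 0)"

definition curvature :: "curve \<Rightarrow> real \<Rightarrow> real" where
  "curvature c \<xi> =
     (vd (par c) \<xi> \<bullet> (Qm *v vd (vd (par c)) \<xi>)) / norm (vd (par c) \<xi>) ^ 3"

text \<open>Coordinates are \<open>y $ 1 = \<eta>\<close> and \<open>y $ 2 = \<xi>\<close>.\<close>

definition frenet :: "curve \<Rightarrow> point \<Rightarrow> point" where
  "frenet c y = par c (y $ 2) + (y $ 1) *\<^sub>R nrml (par c) (y $ 2)"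

definition tube :: "curve \<Rightarrow> real \<Rightarrow> point set" where
  "tube c \<epsilon> = frenet c ` {y. y $ 1 \<in> {-\<epsilon>..\<epsilon>} \<and> y $ 2 \<in> {lo c..hi c}}"

definition frenet_jac :: "curve \<Rightarrow> point \<Rightarrow> real^2^2" where
  "frenet_jac c y = matrix (frechet_derivative (frenet c) (at y))"

text \<open>The Jacobian of the (local) inverse at \<open>frenet c y\<close> is \<open>matrix_inv (frenet_jac c y)\<close>.\<close>

definition frenet_regular :: "curve \<Rightarrow> real \<Rightarrow> bool" where
  "frenet_regular c \<epsilon> \<longleftrightarrow>
     inj_on (frenet c) {y. y $ 1 \<in> {-\<epsilon>..\<epsilon>} \<and> y $ 2 \<in> {lo c..<hi c}} \<and>
     (\<forall>\<eta>\<in>{-\<epsilon>..\<epsilon>}. \<forall>\<xi>\<in>{lo c..hi c}.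
        1/2 \<le> 1 + \<eta> * curvature c \<xi> \<and> 1 + \<eta> * curvature c \<xi> \<le> 2) \<and>
     (\<exists>c1>0. \<exists>c2. \<forall>y. y $ 1 \<in> {-\<epsilon>..\<epsilon>} \<and> y $ 2 \<in> {lo c..hi c} \<longrightarrow>
        (let J = frenet_jac c y; J' = matrix_inv J in
           c1 \<le> \<bar>det J\<bar> \<and> \<bar>det J\<bar> \<le> c2 \<and> c1 \<le> \<bar>det J'\<bar> \<and> \<bar>det J'\<bar> \<le> c2 \<and>
           onorm ((*v) J) \<le> c2 \<and> onorm ((*v) J') \<le> c2))"

record geometry =
  Om :: "point set"
  OmM :: "point set"
  OmP :: "point set"
  cb :: curve
  ci :: curve

definition geometry_ok :: "geometry \<Rightarrow> real \<Rightarrow> bool" where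
  "geometry_ok G \<epsilon>0 \<longleftrightarrow>
     open (Om G) \<and> connected (Om G) \<and> bounded (Om G) \<and> Om G \<noteq> {} \<and>
     closed_curve 2 (cb G) \<and> closed_curve 2 (ci G) \<and>
     frontier (Om G) = curve_set (cb G) \<and> curve_set (ci G) \<subseteq> Om G \<and>
     open (OmM G) \<and> connected (OmM G) \<and> OmM G \<noteq> {} \<and>
     open (OmP G) \<and> connected (OmP G) \<and> OmP G \<noteq> {} \<and>
     OmM G \<inter> OmP G = {} \<and> curve_set (ci G) \<inter> (OmM G \<union> OmP G) = {} \<and>
     Om G = OmM G \<union> curve_set (ci G) \<union> OmP G \<and>
     \<epsilon>0 > 0 \<and>
     (\<forall>\<epsilon>. 0 < \<epsilon> \<and> \<epsilon> \<le> \<epsilon>0 \<longrightarrow> frenet_regular (cb G) \<epsilon> \<and> frenet_regular (ci G) \<epsilon> \<and>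
        tube (cb G) \<epsilon> \<inter> tube (ci G) \<epsilon> = {})"

definition coefficient_ok :: "geometry \<Rightarrow> real \<Rightarrow> real \<Rightarrow> (point \<Rightarrow> real) \<Rightarrow> bool" where
  "coefficient_ok G blo bhi \<beta> \<longleftrightarrow> W1inf (OmM G) \<beta> \<and> W1inf (OmP G) \<beta> \<and>
     (AE x in lebesgue_on (OmM G \<union> OmP G). blo \<le> \<beta> x \<and> \<beta> x \<le> bhi)"


section \<open>Curved meshes\<close>

text \<open>\<open>tris\<close> is the straight-sided triangulation. The edges of the curved mesh are paths \<open>p\<close> on
  \<open>[0,1]\<close>, each replacing the straight edge \<open>chord p\<close>; \<open>bedges\<close> and \<open>iedges\<close> are the designated
  edges, which follow the boundary curve and the interface. The orientation of \<open>p\<close> encodes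
  the fixed unit normal \<open>nrml p\<close>, which points from \<open>el1 p\<close> to \<open>el2 p\<close> (on a boundary edge, out of
  \<open>el1 p\<close>, and \<open>el2 p\<close> is irrelevant). \<open>branch T\<close> is the continuous branch of the inverse Frenet map
  on a curved element. Elements are indexed by the straight triangles they replace.\<close>

record mesh =
  tris :: "point set set"
  edges :: "(real \<Rightarrow> point) set"
  bedges :: "(real \<Rightarrow> point) set"
  iedges :: "(real \<Rightarrow> point) set"
  el1 :: "(real \<Rightarrow> point) \<Rightarrow> point set"
  el2 :: "(real \<Rightarrow> point) \<Rightarrow> point set"
  branch :: "point set \<Rightarrow> point \<Rightarrow> point"

definition chord :: "(real \<Rightarrow> point) \<Rightarrow> point set" where
  "chord p = closed_segment (p 0) (p 1)"

definition edges_of :: "mesh \<Rightarrow> point set \<Rightarrow> (real \<Rightarrow> point) set" where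
  "edges_of M T = {p \<in> edges M. chord p facet_of T}"

text \<open>The open element: the region enclosed by the three possibly curved edges
  (\<open>inside\<close> is the union of the bounded components of the complement).\<close>

definition elem :: "mesh \<Rightarrow> point set \<Rightarrow> point set" where
  "elem M T = inside (\<Union>p\<in>edges_of M T. path_image p)"

definition curved :: "mesh \<Rightarrow> point set \<Rightarrow> bool" where
  "curved M T \<longleftrightarrow> edges_of M T \<inter> (bedges M \<union> iedges M) \<noteq> {}"

definition assoc_curve :: "geometry \<Rightarrow> mesh \<Rightarrow> point set \<Rightarrow> curve" where
  "assoc_curve G M T = (if edges_of M T \<inter> bedges M \<noteq> {} then cb G else ci G)"

definition boundary_edges :: "geometry \<Rightarrow> mesh \<Rightarrow> (real \<Rightarrow> point) set" where
  "boundary_edges G M = {p \<in> edges M. path_image p \<subseteq> curve_set (cb G)}"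

definition arc_of :: "curve \<Rightarrow> (real \<Rightarrow> point) \<Rightarrow> bool" where
  "arc_of c p \<longleftrightarrow>
     (\<exists>a b. a \<noteq> b \<and> \<bar>b - a\<bar> < period c \<and> p = (\<lambda>t. par c (a + t * (b - a))))"

definition fitted :: "(real \<Rightarrow> point) \<Rightarrow> curve \<Rightarrow> bool" where
  "fitted p c \<longleftrightarrow> p 0 \<in> curve_set c \<and> p 1 \<in> curve_set c"

definition inradius :: "point set \<Rightarrow> real" where
  "inradius K = Sup {r. \<exists>x. ball x r \<subseteq> K}"

definition meshsize :: "mesh \<Rightarrow> real" where
  "meshsize M = Max ((\<lambda>T. diameter (elem M T)) ` tris M)"

definition curved_mesh :: "geometry \<Rightarrow> real \<Rightarrow> real \<Rightarrow> mesh \<Rightarrow> bool" where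
  "curved_mesh G \<epsilon> Csh M \<longleftrightarrow>
     triangulation (tris M) \<and> (\<forall>T\<in>tris M. 2 simplex T) \<and>
     bij_betw chord (edges M) {F. \<exists>T\<in>tris M. F facet_of T} \<and>
     \<comment> \<open>straight and designated edges\<close>
     bedges M \<subseteq> edges M \<and> iedges M \<subseteq> edges M \<and> bedges M \<inter> iedges M = {} \<and>
     (\<forall>p\<in>edges M - (bedges M \<union> iedges M). p = linepath (p 0) (p 1)) \<and>
     (\<forall>p\<in>bedges M. arc_of (cb G) p) \<and> (\<forall>p\<in>iedges M. arc_of (ci G) p) \<and>
     (\<forall>T\<in>tris M. card (edges_of M T \<inter> (bedges M \<union> iedges M)) \<le> 1) \<and>
     \<comment> \<open>the curved mesh is conforming and partitions the domain\<close>
     (\<forall>p\<in>edges M. \<forall>q\<in>edges M. p \<noteq> q \<longrightarrow>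
        path_image p \<inter> path_image q \<subseteq> {p 0, p 1} \<inter> {q 0, q 1}) \<and>
     (\<forall>T\<in>tris M. \<forall>T'\<in>tris M. T \<noteq> T' \<longrightarrow> elem M T \<inter> elem M T' = {}) \<and>
     (\<Union>T\<in>tris M. closure (elem M T)) = closure (Om G) \<and>
     \<comment> \<open>both curves are resolved, and no straight triangle is cut by the interface unless it has
         an edge fitted to it\<close>
     (\<Union>p\<in>bedges M. path_image p) = curve_set (cb G) \<and>
     (\<Union>p\<in>iedges M. path_image p) = curve_set (ci G) \<and>
     (\<forall>T\<in>tris M. interior T \<inter> curve_set (ci G) \<noteq> {} \<longrightarrow> (\<exists>p\<in>edges_of M T. fitted p (ci G))) \<and>
     \<comment> \<open>adjacent elements and normals\<close>
     (\<forall>p\<in>boundary_edges G M. {T\<in>tris M. p \<in> edges_of M T} = {el1 M p}) \<and>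
     (\<forall>p\<in>edges M - boundary_edges G M. el1 M p \<noteq> el2 M p \<and>
        {T\<in>tris M. p \<in> edges_of M T} = {el1 M p, el2 M p}) \<and>
     (\<forall>p\<in>edges M. \<forall>t\<in>{0<..<1}.
        (\<forall>\<^sub>F d in at_right 0. p t - d *\<^sub>R nrml p t \<in> elem M (el1 M p)) \<and>
        (p \<notin> boundary_edges G M \<longrightarrow>
           (\<forall>\<^sub>F d in at_right 0. p t + d *\<^sub>R nrml p t \<in> elem M (el2 M p)))) \<and>
     \<comment> \<open>shape regularity of the straight and of the curved elements\<close>
     (\<forall>T\<in>tris M. diameter T / inradius T \<le> Csh \<and>
        diameter (elem M T) / inradius (elem M T) \<le> Csh) \<and>
     \<comment> \<open>curved elements lie in the Frenet neighbourhood\<close>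
     (\<forall>T\<in>tris M. curved M T \<longrightarrow>
        closure (elem M T) \<subseteq> tube (assoc_curve G M T) \<epsilon> \<and>
        continuous_on (closure (elem M T)) (branch M T) \<and>
        (\<forall>x\<in>closure (elem M T). \<bar>branch M T x $ 1\<bar> \<le> \<epsilon> \<and>
           frenet (assoc_curve G M T) (branch M T x) = x))"

text \<open>A family of meshes indexed by the mesh sizes \<open>h\<close> that occur in it.\<close>

definition mesh_family :: "geometry \<Rightarrow> real \<Rightarrow> real \<Rightarrow> real \<Rightarrow> real set \<Rightarrow> (real \<Rightarrow> mesh) \<Rightarrow> bool" where
  "mesh_family G \<epsilon> Csh h0 H \<T> \<longleftrightarrow> H \<subseteq> {0<..h0} \<and>
     (\<forall>h\<in>H. curved_mesh G \<epsilon> Csh (\<T> h) \<and> meshsize (\<T> h) = h)"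


section \<open>Discrete and broken spaces\<close>

definition poly2 :: "nat \<Rightarrow> (point \<Rightarrow> real) set" where
  "poly2 m = {q. \<exists>a :: nat \<Rightarrow> nat \<Rightarrow> real. q =
     (\<lambda>y. \<Sum>(i, j)\<in>{(i, j). i + j \<le> m}. a i j * (y $ 1) ^ i * (y $ 2) ^ j)}"

text \<open>The local space does not depend on the branch, since branches differ by
  a multiple of the period in \<open>\<xi>\<close> and polynomials of degree at most \<open>m\<close> are shift invariant.\<close>

definition Sloc :: "nat \<Rightarrow> mesh \<Rightarrow> point set \<Rightarrow> (point \<Rightarrow> real) set" where
  "Sloc m M T = {v. \<exists>q\<in>poly2 m. AE x in lebesgue_on (elem M T).
                     v x = q (if curved M T then branch M T x else x)}"

definition Sh :: "geometry \<Rightarrow> nat \<Rightarrow> mesh \<Rightarrow> (point \<Rightarrow> real) set" where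
  "Sh G m M = {v. L2 (Om G) v \<and> (\<forall>T\<in>tris M. v \<in> Sloc m M T)}"

definition Hs_broken :: "geometry \<Rightarrow> real \<Rightarrow> mesh \<Rightarrow> (point \<Rightarrow> real) set" where
  "Hs_broken G s M = {v. L2 (Om G) v \<and> (\<forall>T\<in>tris M. v \<in> Hs s (elem M T))}"

definition L2_curve :: "curve \<Rightarrow> (point \<Rightarrow> real) \<Rightarrow> bool" where
  "L2_curve c g \<longleftrightarrow> L2 {lo c..hi c} (\<lambda>t. g (par c t))"


section \<open>Edge quantities, forms and norms\<close>

definition edge_int :: "(real \<Rightarrow> point) \<Rightarrow> (real \<Rightarrow> real) \<Rightarrow> real" where
  "edge_int p F = (LINT t|lebesgue_on {0..1}. F t * norm (vd p t))"

definition edge_len :: "(real \<Rightarrow> point) \<Rightarrow> real" where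
  "edge_len p = edge_int p (\<lambda>t. 1)"

definition beta_elem :: "mesh \<Rightarrow> (point \<Rightarrow> real) \<Rightarrow> point set \<Rightarrow> real" where
  "beta_elem M \<beta> T = real_of_ereal (esssup (lebesgue_on (elem M T)) (\<lambda>x. ereal (\<beta> x)))"

definition beta_edge :: "mesh \<Rightarrow> (point \<Rightarrow> real) \<Rightarrow> (real \<Rightarrow> point) \<Rightarrow> real" where
  "beta_edge M \<beta> p = Max (beta_elem M \<beta> ` {T\<in>tris M. p \<in> edges_of M T})"

text \<open>The penalty weight \<open>\<sigma>\<^sub>0 \<gamma>\<^sub>e / h\<^sub>e\<close>.\<close>

definition pen :: "mesh \<Rightarrow> nat \<Rightarrow> real \<Rightarrow> (point \<Rightarrow> real) \<Rightarrow> (real \<Rightarrow> point) \<Rightarrow> real" where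
  "pen M m \<sigma> \<beta> p = \<sigma> * (real m * (real m + 1) * beta_edge M \<beta> p) / edge_len p"

definition jump :: "geometry \<Rightarrow> mesh \<Rightarrow> (point \<Rightarrow> real) \<Rightarrow> (real \<Rightarrow> point) \<Rightarrow> real \<Rightarrow> real" where
  "jump G M v p t =
     (if p \<in> boundary_edges G M then trc (elem M (el1 M p)) p v t
      else trc (elem M (el1 M p)) p v t - trc (elem M (el2 M p)) p v t)"

definition flux :: "mesh \<Rightarrow> (point \<Rightarrow> real) \<Rightarrow> (point \<Rightarrow> real) \<Rightarrow> point set \<Rightarrow> (real \<Rightarrow> point) \<Rightarrow> real \<Rightarrow> real" where
  "flux M \<beta> v T p t = trc (elem M T) p \<beta> t *
     ((\<chi> i. trc (elem M T) p (\<lambda>x. wgrad (elem M T) v x $ i) t) \<bullet> nrml p t)"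

definition avg_flux :: "geometry \<Rightarrow> mesh \<Rightarrow> (point \<Rightarrow> real) \<Rightarrow> (point \<Rightarrow> real) \<Rightarrow> (real \<Rightarrow> point) \<Rightarrow> real \<Rightarrow> real" where
  "avg_flux G M \<beta> v p t =
     (if p \<in> boundary_edges G M then flux M \<beta> v (el1 M p) p t
      else (flux M \<beta> v (el1 M p) p t + flux M \<beta> v (el2 M p) p t) / 2)"

definition a_h :: "geometry \<Rightarrow> mesh \<Rightarrow> nat \<Rightarrow> real \<Rightarrow> (point \<Rightarrow> real) \<Rightarrow>
    (point \<Rightarrow> real) \<Rightarrow> (point \<Rightarrow> real) \<Rightarrow> real" where
  "a_h G M m \<sigma> \<beta> w v =
     (\<Sum>T\<in>tris M. LINT x|lebesgue_on (elem M T).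
         (\<beta> x *\<^sub>R wgrad (elem M T) w x) \<bullet> wgrad (elem M T) v x)
     - (\<Sum>p\<in>edges M. edge_int p (\<lambda>t. avg_flux G M \<beta> w p t * jump G M v p t))
     - (\<Sum>p\<in>edges M. edge_int p (\<lambda>t. avg_flux G M \<beta> v p t * jump G M w p t))
     + (\<Sum>p\<in>edges M. pen M m \<sigma> \<beta> p * edge_int p (\<lambda>t. jump G M w p t * jump G M v p t))"

definition L_h :: "geometry \<Rightarrow> mesh \<Rightarrow> nat \<Rightarrow> real \<Rightarrow> (point \<Rightarrow> real) \<Rightarrow>
    (point \<Rightarrow> real) \<Rightarrow> (point \<Rightarrow> real) \<Rightarrow> (point \<Rightarrow> real) \<Rightarrow> real" where
  "L_h G M m \<sigma> \<beta> f g v =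
     (LINT x|lebesgue_on (Om G). f x * v x)
     + (\<Sum>p\<in>boundary_edges G M. edge_int p (\<lambda>t. g (p t) *
          (- flux M \<beta> v (el1 M p) p t + pen M m \<sigma> \<beta> p * trc (elem M (el1 M p)) p v t)))"

definition energy_sq :: "mesh \<Rightarrow> (point \<Rightarrow> real) \<Rightarrow> (point \<Rightarrow> real) \<Rightarrow> real" where
  "energy_sq M \<beta> v = (\<Sum>T\<in>tris M. LINT x|lebesgue_on (elem M T).
     (norm (sqrt (\<beta> x) *\<^sub>R wgrad (elem M T) v x))\<^sup>2)"

definition jump_sq :: "geometry \<Rightarrow> mesh \<Rightarrow> nat \<Rightarrow> real \<Rightarrow> (point \<Rightarrow> real) \<Rightarrow> (point \<Rightarrow> real) \<Rightarrow> real" where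
  "jump_sq G M m \<sigma> \<beta> v =
     (\<Sum>p\<in>edges M. edge_int p (\<lambda>t. (sqrt (pen M m \<sigma> \<beta> p) * jump G M v p t)\<^sup>2))"

definition flux_sq :: "geometry \<Rightarrow> mesh \<Rightarrow> nat \<Rightarrow> real \<Rightarrow> (point \<Rightarrow> real) \<Rightarrow> (point \<Rightarrow> real) \<Rightarrow> real" where
  "flux_sq G M m \<sigma> \<beta> v =
     (\<Sum>p\<in>edges M. edge_int p (\<lambda>t. (sqrt (1 / pen M m \<sigma> \<beta> p) * avg_flux G M \<beta> v p t)\<^sup>2))"

definition hnorm :: "geometry \<Rightarrow> mesh \<Rightarrow> nat \<Rightarrow> real \<Rightarrow> (point \<Rightarrow> real) \<Rightarrow> (point \<Rightarrow> real) \<Rightarrow> real" where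
  "hnorm G M m \<sigma> \<beta> v = sqrt (energy_sq M \<beta> v + jump_sq G M m \<sigma> \<beta> v)"

definition hnorm3 :: "geometry \<Rightarrow> mesh \<Rightarrow> nat \<Rightarrow> real \<Rightarrow> (point \<Rightarrow> real) \<Rightarrow> (point \<Rightarrow> real) \<Rightarrow> real" where
  "hnorm3 G M m \<sigma> \<beta> v = sqrt ((hnorm G M m \<sigma> \<beta> v)\<^sup>2 + flux_sq G M m \<sigma> \<beta> v)"

end

theory Submission
  imports Defs
begin

text \<open>Weak gradients and traces are square integrable by construction, and the trace of \<open>\<beta>\<close> is
  essentially bounded because a Lebesgue value lies between the essential bounds. Hence all
  integrals in \<open>a_h\<close> converge, and continuity and coercivity follow from the Cauchy--Schwarz
  inequality for the energy, flux and jump parts separately, with the absolute constant 4.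

  Solvability needs that the forms are linear on the discrete space. On each element a discrete
  function is a polynomial composed with the inverse Frenet map, which is \<open>C\<^sup>1\<close> up to the
  boundary by the inverse function rule. Its weak gradient is therefore the classical one
  (integrals of directional derivatives of compactly supported functions vanish by translation
  invariance, and weak derivatives are unique), and its traces are its continuous boundary values.
  If the energy norm vanishes, then the polynomial is constant on the open image of each element;
  these constants agree across edges and vanish on the boundary, and all elements are reached,
  since the domain minus the finitely many vertices is connected and closed elements meet there
  only in common edges.\<close>

section \<open>Square integrable functions\<close>

text \<open>Two obstacles shape the proof. First, \<open>wgrad\<close> and \<open>trc\<close> are
  picked by \<open>SOME\<close>, with zero as default, so \<open>a_h\<close> is not visibly
  bilinear. The estimates get around this by applying Cauchy-Schwarz to the chosen gradients, traces
  and fluxes themselves, in the form of a discriminant criterion whose quadratics are integrated and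
  summed before the criterion is used. Bilinearity is established only where a continuous
  representative pins the choice down almost everywhere. Second, discrete functions are genuine
  functions, not classes modulo null sets, so the discrete space is infinite-dimensional as a set of
  functions and coercivity makes \<open>a_h\<close> only semidefinite on it. Existence therefore
  rests on a finite family that spans up to null sets, on a Gram-Schmidt induction that tolerates
  directions of zero energy, and on the invariance of both forms under changes on null sets.
  Uniqueness likewise holds up to null sets.\<close>

lemma L2_mult_integrable:
  assumes "L2 U u" "L2 U v"
  shows "integrable (lebesgue_on U) (\<lambda>x. u x * v x)"
proof (rule Bochner_Integration.integrable_bound)
  show "integrable (lebesgue_on U) (\<lambda>x. (u x)\<^sup>2 + (v x)\<^sup>2)"
    using assms unfolding L2_def by auto
  show "(\<lambda>x. u x * v x) \<in> borel_measurable (lebesgue_on U)"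
    using assms unfolding L2_def by auto
  have "norm (u x * v x) \<le> norm ((u x)\<^sup>2 + (v x)\<^sup>2)" for x
  proof -
    have "2 * \<bar>u x\<bar> * \<bar>v x\<bar> \<le> (u x)\<^sup>2 + (v x)\<^sup>2"
      using sum_squares_bound[of "\<bar>u x\<bar>" "\<bar>v x\<bar>"] by simp
    moreover have "0 \<le> \<bar>u x\<bar> * \<bar>v x\<bar>" by simp
    ultimately show ?thesis unfolding real_norm_def abs_mult by linarith
  qed
  then show "AE x in lebesgue_on U. norm (u x * v x) \<le> norm ((u x)\<^sup>2 + (v x)\<^sup>2)" by simp
qed

text \<open>Sums, differences and multiples are all instances of this shape, with c = 1, c = -1 or
  the zero function for \<open>u\<close>. Linearity is stated in the same shape throughout.\<close>

lemma L2_lincomb: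
  assumes "L2 U u" "L2 U v"
  shows "L2 U (\<lambda>x. u x + c * v x)"
proof -
  have eq: "(u x + c * v x)\<^sup>2 = (u x)\<^sup>2 + (2 * c) * (u x * v x) + c\<^sup>2 * (v x)\<^sup>2" for x
    by (simp add: power2_eq_square algebra_simps)
  show ?thesis
    using assms L2_mult_integrable[OF assms] unfolding L2_def eq by auto
qed

lemma L2_bounded_mult:
  assumes "L2 U v" "b \<in> borel_measurable (lebesgue_on U)" "AE x in lebesgue_on U. \<bar>b x\<bar> \<le> B"
  shows "L2 U (\<lambda>x. b x * v x)"
proof -
  have "integrable (lebesgue_on U) (\<lambda>x. (b x * v x)\<^sup>2)"
  proof (rule Bochner_Integration.integrable_bound)
    show "integrable (lebesgue_on U) (\<lambda>x. B\<^sup>2 * (v x)\<^sup>2)"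
      using assms unfolding L2_def by auto
    show "(\<lambda>x. (b x * v x)\<^sup>2) \<in> borel_measurable (lebesgue_on U)"
      using assms unfolding L2_def by auto
    show "AE x in lebesgue_on U. norm ((b x * v x)\<^sup>2) \<le> norm (B\<^sup>2 * (v x)\<^sup>2)"
      using assms(3)
    proof eventually_elim
      case (elim x)
      have "(b x)\<^sup>2 \<le> B\<^sup>2" using elim by (rule power2_le_iff_abs_le[THEN iffD2, rotated]) (use elim in auto)
      then show ?case by (simp add: power_mult_distrib mult_right_mono)
    qed
  qed
  then show ?thesis using assms unfolding L2_def by auto
qed

lemma L2_bounded:
  assumes "U \<in> lmeasurable" "v \<in> borel_measurable (lebesgue_on U)"
    "AE x in lebesgue_on U. \<bar>v x\<bar> \<le> B"
  shows "L2 U v"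
proof -
  interpret finite_measure "lebesgue_on U" by (rule finite_measure_lebesgue_on) fact
  have "L2 U (\<lambda>x. 1)" by (simp add: L2_def)
  from L2_bounded_mult[OF this assms(2,3)] show ?thesis by simp
qed

lemma L2_integrable:
  assumes "U \<in> lmeasurable" "L2 U v"
  shows "integrable (lebesgue_on U) v"
proof -
  have "L2 U (\<lambda>x. 1)" using assms(1) by (rule L2_bounded) auto
  from L2_mult_integrable[OF this assms(2)] show ?thesis by simp
qed

lemma L2_zero [simp]: "L2 U (\<lambda>x. 0)"
  by (simp add: L2_def)

lemma L2_minus: "L2 U v \<Longrightarrow> L2 U (\<lambda>x. - v x)"
  by (simp add: L2_def)

lemma AE_lebesgue_on_iff:
  "S \<in> sets lebesgue \<Longrightarrow> (AE x in lebesgue_on S. P x) \<longleftrightarrow> (AE x in lebesgue. x \<in> S \<longrightarrow> P x)"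
  by (subst AE_restrict_space_iff) auto

lemma integrable_lebesgue_on_subset:
  fixes f :: "'a::euclidean_space \<Rightarrow> real"
  assumes "integrable (lebesgue_on U) f" "S \<in> sets lebesgue" "U \<in> sets lebesgue" "S \<subseteq> U"
  shows "integrable (lebesgue_on S) f"
proof -
  have "set_integrable lebesgue U f" using assms by (simp add: integrable_restrict_space set_integrable_def)
  then have "set_integrable lebesgue S f" using assms by (auto intro: set_integrable_subset)
  then show ?thesis using assms by (simp add: integrable_restrict_space set_integrable_def)
qed

lemma L2_subset:
  assumes "L2 U v" "S \<in> sets lebesgue" "U \<in> sets lebesgue" "S \<subseteq> U"
  shows "L2 S v"
  using assms integrable_lebesgue_on_subset[OF _ assms(2-4)] measurable_restrict_mono[OF _ assms(4)]
  unfolding L2_def by blast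

text \<open>Completeness of Lebesgue measure is the reason; extension by zero moves the question
  from \<open>U\<close> to the whole space, where completeness applies directly.\<close>

lemma borel_measurable_lebesgue_on_AE:
  fixes v w :: "'a::euclidean_space \<Rightarrow> real"
  assumes "v \<in> borel_measurable (lebesgue_on U)" "AE x in lebesgue_on U. v x = w x"
    "U \<in> sets lebesgue"
  shows "w \<in> borel_measurable (lebesgue_on U)"
proof -
  have "(\<lambda>x. if x \<in> U then v x else 0) \<in> borel_measurable lebesgue"
    using assms by (simp add: borel_measurable_if_I)
  then have "(\<lambda>x. if x \<in> U then w x else 0) \<in> borel_measurable lebesgue"
    by (rule borel_measurable_AE) (use assms in \<open>auto simp: AE_lebesgue_on_iff\<close>)
  then show ?thesis by (rule borel_measurable_if_D)
qed

lemma L2_cong_AE: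
  assumes "L2 U v" "AE x in lebesgue_on U. v x = w x" "U \<in> sets lebesgue"
  shows "L2 U w"
proof -
  have m: "w \<in> borel_measurable (lebesgue_on U)"
    using assms borel_measurable_lebesgue_on_AE unfolding L2_def by blast
  have "integrable (lebesgue_on U) (\<lambda>x. (w x)\<^sup>2)"
    using assms m unfolding L2_def by (subst integrable_cong_AE[where g="\<lambda>x. (v x)\<^sup>2"]) auto
  with m show ?thesis unfolding L2_def by simp
qed

text \<open>A quadratic that never becomes negative has nonpositive discriminant: this is
  Cauchy-Schwarz detached from any inner product. The sign of \<open>c\<close> is part of what is
  derived, and the degenerate case c = 0 is the one that semidefinite forms call for.\<close>

lemma quad_nonneg_imp_sq_le:
  fixes a b c :: real
  assumes "\<And>t. 0 \<le> a + 2 * t * b + t\<^sup>2 * c"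
  shows "\<bar>b\<bar> \<le> sqrt a * sqrt c"
proof -
  have a: "0 \<le> a" using assms[of 0] by simp
  have "b\<^sup>2 \<le> a * c"
  proof (cases "c = 0")
    case True
    have "b = 0"
    proof (rule ccontr)
      assume "b \<noteq> 0"
      \<comment> \<open>At this argument the affine function a + 2tb takes the value -1.\<close>
      then show False using assms[of "- (a + 1) / (2 * b)"] True by (simp add: field_simps)
    qed
    then show ?thesis using True by simp
  next
    case False
    have "0 \<le> c"
    proof (rule ccontr)
      assume "\<not> 0 \<le> c"
      then have c: "c < 0" by simp
      \<comment> \<open>Chosen so that t is at least 1 and t (-c) exceeds 2|b| + a + 1; the
        quadratic then falls to c - 1 or below.\<close>
      define t where "t = (2 * \<bar>b\<bar> + a + 1) / (- c) + 1"
      have t: "t \<ge> 1" using c a divide_nonneg_neg[of "- (2 * \<bar>b\<bar> + a + 1)" c] divide_nonneg_pos[of "2 * \<bar>b\<bar> + a + 1" "-c"] by (simp add: t_def)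
      have "t * (-c) = 2 * \<bar>b\<bar> + a + 1 + (-c)" using c by (simp add: t_def field_simps)
      moreover have "t\<^sup>2 * c = - t * (t * (- c))" by (simp add: power2_eq_square)
      ultimately have "t\<^sup>2 * c = - t * (2 * \<bar>b\<bar> + a + 1 - c)" by simp
      moreover have "2 * t * b \<le> t * (2 * \<bar>b\<bar>)" using t by (simp add: mult_left_mono)
      ultimately have "a + 2 * t * b + t\<^sup>2 * c \<le> a - t * (a + 1 - c)" by (simp add: algebra_simps)
      also have "\<dots> \<le> a - 1 * (a + 1 - c)" using t a c by (intro diff_left_mono mult_right_mono) auto
      finally show False using assms[of t] c by simp
    qed
    then have c: "c > 0" using False by simp
    have "0 \<le> (a + 2 * (- b / c) * b + (- b / c)\<^sup>2 * c) * c"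
      using assms[of "- b / c"] c by (intro mult_nonneg_nonneg) auto
    also have "\<dots> = a * c - b\<^sup>2" using c by (simp add: field_simps power2_eq_square)
    finally show ?thesis by simp
  qed
  then have "sqrt (b\<^sup>2) \<le> sqrt (a * c)" by (rule real_sqrt_le_mono)
  then show ?thesis by (simp add: real_sqrt_mult)
qed

lemma integral_quad:
  assumes "integrable M A" "integrable M B" "integrable M C"
    and "AE x in M. 0 \<le> A x + 2 * t * B x + t\<^sup>2 * C x"
  shows "0 \<le> (LINT x|M. A x) + 2 * t * (LINT x|M. B x) + t\<^sup>2 * (LINT x|M. C x :: real)"
proof -
  have "0 \<le> (LINT x|M. A x + 2 * t * B x + t\<^sup>2 * C x)"
    using assms(4) by (rule integral_nonneg_AE)
  also have "\<dots> = (LINT x|M. A x) + 2 * t * (LINT x|M. B x) + t\<^sup>2 * (LINT x|M. C x)"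
    using assms(1-3) by simp
  finally show ?thesis .
qed

section \<open>The fundamental lemma of the calculus of variations\<close>

lemma has_weak_partialD:
  assumes "has_weak_partial U i v w"
  shows "L2 U v" "L2 U w"
    "test_fun U \<phi> \<Longrightarrow> (LINT x|lebesgue_on U. v x * pd i \<phi> x) = - (LINT x|lebesgue_on U. w x * \<phi> x)"
  using assms unfolding has_weak_partial_def by auto

lemma L2_wgrad: "L2 U (\<lambda>x. wgrad U v x $ i)"
proof (cases "\<exists>w. has_weak_partial U i v w")
  case True
  then have "has_weak_partial U i v (SOME w. has_weak_partial U i v w)" by (rule someI_ex)
  then show ?thesis using True by (simp add: wgrad_def has_weak_partialD(2))
next
  case False
  then have "(\<lambda>x. wgrad U v x $ i) = (\<lambda>x. 0)"
    by (simp only: wgrad_def if_not_P[OF False] if_False vec_lambda_beta)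
  then show ?thesis by simp
qed

lemma L2_trc: "L2 {0..1} (trc K p v)"
proof (cases "\<exists>\<tau>. has_trace K p v \<tau>")
  case True
  then have "has_trace K p v (SOME \<tau>. has_trace K p v \<tau>)" by (rule someI_ex)
  then have "L2 {0..1} (SOME \<tau>. has_trace K p v \<tau>)" unfolding has_trace_def[of _ _ _ "Eps _"] by blast
  then show ?thesis using True by (simp only: trc_def if_True)
qed (simp add: trc_def)

text \<open>The standard smooth function exp (-c/t), extended by zero. The polynomial in 1/t makes
  the class closed under differentiation, and \<open>c\<close> is a sharpness that tends to zero
  when bumps approximate indicators.\<close>

definition expinv :: "real poly \<Rightarrow> real \<Rightarrow> real \<Rightarrow> real" where
  "expinv P c t = (if t > 0 then poly P (1 / t) * exp (- c / t) else 0)"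

text \<open>With s = 1/t this says that the exponential beats every power at infinity, monomial by
  monomial.\<close>

lemma expinv_tendsto_0:
  fixes c :: real
  assumes "c > 0"
  shows "((\<lambda>t. poly P (1 / t) * exp (- c / t)) \<longlongrightarrow> 0) (at_right 0)"
proof -
  have mon: "((\<lambda>s. s ^ k * exp (- (c * s))) \<longlongrightarrow> 0) at_top" for k :: nat
  proof -
    have "((\<lambda>s. (c * s) ^ k / exp (c * s)) \<longlongrightarrow> 0) at_top"
      by (rule filterlim_compose[where g="\<lambda>x::real. x ^ k / exp x" and f="\<lambda>s. c * s", OF tendsto_power_div_exp_0])
         (use assms in \<open>auto intro!: filterlim_tendsto_pos_mult_at_top filterlim_ident tendsto_const\<close>)
    then have "((\<lambda>s. (1 / c ^ k) * ((c * s) ^ k / exp (c * s))) \<longlongrightarrow> (1 / c ^ k) * 0) at_top"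
      by (intro tendsto_intros)
    then show ?thesis using assms by (simp add: power_mult_distrib exp_minus field_simps)
  qed
  have "((\<lambda>s. \<Sum>k\<le>degree P. coeff P k * (s ^ k * exp (- (c * s)))) \<longlongrightarrow> (\<Sum>k\<le>degree P. coeff P k * 0)) at_top"
    by (intro tendsto_intros mon)
  then have "((\<lambda>s. poly P s * exp (- (c * s))) \<longlongrightarrow> 0) at_top"
    by (simp add: poly_altdef sum_distrib_right mult.assoc)
  then have "((\<lambda>t. poly P (inverse t) * exp (- (c * inverse t))) \<longlongrightarrow> 0) (at_right 0)"
    by (rule filterlim_compose) (rule filterlim_inverse_at_top_right)
  then show ?thesis by (simp add: divide_inverse)
qed

text \<open>Since \<open>(1/t)\<close> has derivative \<open>-(1/t)\<^sup>2\<close>, differentiation acts on the polynomial factor as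
  \<open>P(s) \<mapsto> s\<^sup>2 (c P(s) - P'(s))\<close>; the class is closed under derivatives.\<close>

definition expinv_deriv :: "real \<Rightarrow> real poly \<Rightarrow> real poly" where
  "expinv_deriv c P = [:0, 0, 1:] * (smult c P - pderiv P)"

lemma DERIV_expinv:
  assumes "c > 0"
  shows "(expinv P c has_real_derivative expinv (expinv_deriv c P) c t) (at t)"
proof -
  consider "t > 0" | "t < 0" | "t = 0" by linarith
  then show ?thesis
  proof cases
    case 1
    have "((\<lambda>t. poly P (1 / t) * exp (- c / t)) has_real_derivative expinv (expinv_deriv c P) c t) (at t)"
      using 1 by (auto intro!: derivative_eq_intros
        simp: expinv_def expinv_deriv_def power2_eq_square field_simps)
    then show ?thesis
      by (rule has_field_derivative_transform_within_open[where S="{0<..}"])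
        (use 1 in \<open>auto simp: expinv_def\<close>)
  next
    case 2
    have "((\<lambda>t. 0) has_real_derivative expinv (expinv_deriv c P) c t) (at t)"
      using 2 by (auto simp: expinv_def)
    then show ?thesis
      by (rule has_field_derivative_transform_within_open[where S="{..<0}"])
        (use 2 in \<open>auto simp: expinv_def\<close>)
  next
    case 3
    \<comment> \<open>Division by h multiplies the polynomial in 1/h by its variable, so the
      difference quotient at 0 is again covered by the limit above.\<close>
    have "((\<lambda>h. expinv P c h / h) \<longlongrightarrow> 0) (at_right 0)"
      using expinv_tendsto_0[OF assms, of "[:0, 1:] * P"]
      by (rule Lim_transform_eventually) (auto simp: eventually_at_right_field expinv_def intro!: exI[of _ 1])
    moreover have "((\<lambda>h. expinv P c h / h) \<longlongrightarrow> 0) (at_left 0)"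
      by (rule Lim_transform_eventually[OF tendsto_const])
        (auto simp: eventually_at_left_field expinv_def intro!: exI[of _ "-1"])
    ultimately have "((\<lambda>h. expinv P c h / h) \<longlongrightarrow> 0) (at 0)"
      by (simp add: filterlim_split_at)
    then show ?thesis using 3 by (simp add: DERIV_def expinv_def)
  qed
qed

text \<open>The class is closed under partial derivatives: a generator differentiates to a scaled
  generator, and the product rule stays inside. Smoothness of every order then follows by one
  induction, without a formula for higher derivatives.\<close>

inductive_set expinv_alg :: "(point \<Rightarrow> real) set" where
  base: "c > 0 \<Longrightarrow> (\<lambda>x. expinv P c (u \<bullet> x + b)) \<in> expinv_alg"
| scale: "f \<in> expinv_alg \<Longrightarrow> (\<lambda>x. k * f x) \<in> expinv_alg"
| add: "f \<in> expinv_alg \<Longrightarrow> g \<in> expinv_alg \<Longrightarrow> (\<lambda>x. f x + g x) \<in> expinv_alg"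
| mult: "f \<in> expinv_alg \<Longrightarrow> g \<in> expinv_alg \<Longrightarrow> (\<lambda>x. f x * g x) \<in> expinv_alg"

lemma expinv_alg_derivative:
  assumes "f \<in> expinv_alg"
  shows "\<exists>D. (\<forall>x. (f has_derivative D x) (at x)) \<and> (\<forall>i. (\<lambda>x. D x (axis i 1)) \<in> expinv_alg)"
  using assms
proof induction
  case (base c P u b)
  let ?D = "\<lambda>x h. (u \<bullet> h) * expinv (expinv_deriv c P) c (u \<bullet> x + b)"
  have "((\<lambda>x. expinv P c (u \<bullet> x + b)) has_derivative ?D x) (at x)" for x
    by (rule DERIV_compose_FDERIV[OF DERIV_expinv[OF base]]) (auto intro!: derivative_eq_intros)
  moreover have "(\<lambda>x. ?D x (axis i 1)) \<in> expinv_alg" for i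
    using base by (intro expinv_alg.intros)
  ultimately show ?case by (intro exI[of _ ?D]) auto
next
  case (scale f k)
  then obtain D where D: "\<And>x. (f has_derivative D x) (at x)" "\<And>i. (\<lambda>x. D x (axis i 1)) \<in> expinv_alg" by blast
  then show ?case by (intro exI[of _ "\<lambda>x h. k * D x h"]) (auto intro!: derivative_eq_intros expinv_alg.intros D)
next
  case (add f g)
  then obtain D E where "\<And>x. (f has_derivative D x) (at x)" "\<And>i. (\<lambda>x. D x (axis i 1)) \<in> expinv_alg"
    "\<And>x. (g has_derivative E x) (at x)" "\<And>i. (\<lambda>x. E x (axis i 1)) \<in> expinv_alg" by blast
  then show ?case by (intro exI[of _ "\<lambda>x h. D x h + E x h"]) (auto intro!: derivative_eq_intros expinv_alg.intros)
next
  case (mult f g)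
  then obtain D E where "\<And>x. (f has_derivative D x) (at x)" "\<And>i. (\<lambda>x. D x (axis i 1)) \<in> expinv_alg"
    "\<And>x. (g has_derivative E x) (at x)" "\<And>i. (\<lambda>x. E x (axis i 1)) \<in> expinv_alg" by blast
  with mult show ?case by (intro exI[of _ "\<lambda>x h. f x * E x h + D x h * g x"]) (auto intro!: derivative_eq_intros expinv_alg.intros)
qed

lemma expinv_alg_Ck: "f \<in> expinv_alg \<Longrightarrow> Ck k f"
proof (induction k arbitrary: f)
  case 0
  then obtain D where "\<And>x. (f has_derivative D x) (at x)" using expinv_alg_derivative by blast
  then show ?case by (auto simp: continuous_on_eq_continuous_at intro: has_derivative_continuous)
next
  case (Suc k)
  then obtain D where D: "\<And>x. (f has_derivative D x) (at x)" "\<And>i. (\<lambda>x. D x (axis i 1)) \<in> expinv_alg"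
    using expinv_alg_derivative by blast
  have "frechet_derivative f (at x) = D x" for x
    using D(1) frechet_derivative_at by metis
  then have "pd i f = (\<lambda>x. D x (axis i 1))" for i by (auto simp: pd_def)
  then show ?case using Suc.IH D by (auto simp: differentiable_def)
qed

section \<open>Test functions supported in boxes\<close>

definition box_bump :: "real \<Rightarrow> point \<Rightarrow> point \<Rightarrow> point \<Rightarrow> real" where
  "box_bump c a b x = expinv 1 c (x $ 1 - a $ 1) * expinv 1 c (b $ 1 - x $ 1)
                    * (expinv 1 c (x $ 2 - a $ 2) * expinv 1 c (b $ 2 - x $ 2))"

lemma box_bump_alg:
  assumes "c > 0" shows "box_bump c a b \<in> expinv_alg"
proof -
  have 1: "(\<lambda>x. expinv 1 c (x $ i - s)) \<in> expinv_alg" for i :: 2 and s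
    using base[OF assms, of 1 "axis i 1" "-s"] by (simp add: inner_axis')
  have 2: "(\<lambda>x. expinv 1 c (s - x $ i)) \<in> expinv_alg" for i :: 2 and s
    using base[OF assms, of 1 "- axis i 1" "s"] by (simp add: inner_axis')
  show ?thesis unfolding box_bump_def[abs_def] by (intro mult 1 2)
qed

lemma expinv_bounds: "c > 0 \<Longrightarrow> 0 \<le> expinv 1 c t \<and> expinv 1 c t \<le> 1" and
  expinv_eq_0_iff: "c > 0 \<Longrightarrow> expinv 1 c t = 0 \<longleftrightarrow> t \<le> 0"
  by (auto simp: expinv_def)

lemma mem_box_point: "(x::point) \<in> box a b \<longleftrightarrow> a $ 1 < x $ 1 \<and> x $ 1 < b $ 1 \<and> a $ 2 < x $ 2 \<and> x $ 2 < b $ 2"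
  by (auto simp: mem_box_cart forall_2)

lemma box_bump_bounds:
  assumes "c > 0" shows "0 \<le> box_bump c a b x" "box_bump c a b x \<le> 1"
  using expinv_bounds[OF assms] unfolding box_bump_def
  by (auto intro!: mult_nonneg_nonneg mult_le_one)

lemma box_bump_eq_0_iff: "c > 0 \<Longrightarrow> box_bump c a b x = 0 \<longleftrightarrow> x \<notin> box a b"
  by (auto simp: box_bump_def expinv_eq_0_iff mem_box_point not_less)

lemma test_fun_box_bump:
  assumes "c > 0" "cbox a b \<subseteq> U"
  shows "test_fun U (box_bump c a b)"
proof -
  have eq: "{x. box_bump c a b x \<noteq> 0} = box a b"
    using box_bump_eq_0_iff[OF assms(1)] by auto
  have "closure (box a b) \<subseteq> cbox a b" by (intro closure_minimal box_subset_cbox closed_cbox)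
  then show ?thesis
    unfolding test_fun_def eq
    using assms box_bump_alg expinv_alg_Ck by (auto simp: compact_closure bounded_box)
qed

text \<open>Inside the box all four factors exp (-c/t) tend to 1 as c tends to 0; outside it one of
  them is identically 0.\<close>

lemma box_bump_tendsto:
  "(\<lambda>n. box_bump (1 / real (Suc n)) a b x) \<longlonglongrightarrow> indicator (box a b) x"
proof (cases "x \<in> box a b")
  case True
  have "(\<lambda>n. expinv 1 (1 / real (Suc n)) t) \<longlonglongrightarrow> 1" if "t > 0" for t
  proof -
    have "(\<lambda>n. exp (- (1 / real (Suc n)) / t)) \<longlonglongrightarrow> exp (- 0 / t)"
      by (intro tendsto_intros LIMSEQ_Suc lim_1_over_n) (use that in auto)
    then show ?thesis using that by (simp add: expinv_def)
  qed
  then have "(\<lambda>n. box_bump (1 / real (Suc n)) a b x) \<longlonglongrightarrow> 1 * 1 * (1 * 1)"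
    unfolding box_bump_def using True by (intro tendsto_intros) (auto simp: mem_box_point)
  with True show ?thesis by simp
next
  case False
  then have "box_bump (1 / real (Suc n)) a b x = 0" for n by (subst box_bump_eq_0_iff) auto
  with False show ?thesis by simp
qed

text \<open>The sets over which the restriction of \<open>w\<close> to the box has zero integral
  form a Dynkin system containing the intersection-stable family of open boxes, hence all Borel
  sets. Lebesgue sets differ from these by null sets, and a function whose integral over every
  measurable set is zero vanishes almost everywhere.\<close>

lemma AE_zero_if_box_integrals_zero:
  fixes w :: "'a::euclidean_space \<Rightarrow> real"
  assumes int: "set_integrable lebesgue (box a b) w"
    and z: "\<And>c d. box c d \<subseteq> box a b \<Longrightarrow> (LINT x:box c d|lebesgue. w x) = 0"
  shows "AE x in lebesgue. x \<in> box a b \<longrightarrow> w x = 0"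
proof -
  let ?f = "\<lambda>x. indicator (box a b) x * w x"
  have intf: "integrable lebesgue ?f" using int by (simp add: set_integrable_def)
  then have mf: "?f \<in> borel_measurable lebesgue" by simp
  have B: "(LINT x:X|lebesgue. ?f x) = 0" if "X \<in> sigma_sets UNIV (range (\<lambda>(a, b). box a b))" for X :: "'a set"
  proof -
    have G: "Int_stable (range (\<lambda>(a, b). box a b :: 'a set))" by (auto simp: Int_stable_def box_Int_box)
    have leb: "A \<in> sets lebesgue" if "A \<in> sigma_sets UNIV (range (\<lambda>(a, b). box a b :: 'a set))" for A
      using that by (metis borel_eq_box sets_completionI_sets sets_lborel sets_measure_of top_greatest Pow_UNIV)
    have P: "range (\<lambda>(a, b). box a b :: 'a set) \<subseteq> Pow UNIV" by auto
    show ?thesis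
    using G P that
  proof (induction rule: sigma_sets_induct_disjoint)
    case (basic A)
    then obtain c d where A: "A = box c d" by auto
    obtain c' d' where cd: "box c d \<inter> box a b = box c' d'" unfolding box_Int_box by blast
    have "(LINT x:A|lebesgue. ?f x) = (LINT x:box c' d'|lebesgue. w x)"
      unfolding set_lebesgue_integral_def A cd[symmetric]
      by (intro Bochner_Integration.integral_cong) (auto simp: indicator_def)
    also have "\<dots> = 0" using cd by (intro z) auto
    finally show ?case .
  next
    case empty show ?case by (simp add: set_lebesgue_integral_def)
  next
    case (compl A)
    then have A: "A \<in> sets lebesgue" by (intro leb)
    have "(LINT x:UNIV - A|lebesgue. ?f x) = (LINT x|lebesgue. ?f x - indicator A x * ?f x)"
      unfolding set_lebesgue_integral_def
      by (intro Bochner_Integration.integral_cong) (auto simp: indicator_def)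
    also have "\<dots> = (LINT x|lebesgue. ?f x) - (LINT x|lebesgue. indicator A x * ?f x)"
      using intf A integrable_mult_indicator[OF A intf] by (intro Bochner_Integration.integral_diff) auto
    \<comment> \<open>The total integral is the one over the whole box \<open>box a b\<close>,
      itself an instance of the hypothesis.\<close>
    also have "\<dots> = 0" using compl z[of a b] by (simp add: set_lebesgue_integral_def)
    finally show ?case .
  next
    case (union A)
    have "A i \<in> sets lebesgue" for i
      using union by (intro leb) auto
    then have "(LINT x:(\<Union>i. A i)|lebesgue. ?f x) = (\<Sum>i. (LINT x:A i|lebesgue. ?f x))"
      using union intf by (intro lebesgue_integral_countable_add)
        (auto simp: disjoint_family_on_def set_integrable_def intro!: integrable_mult_indicator[where 'b=real, simplified])
    with union show ?case by simp
  qed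
  qed
  have "(LINT x:X|lebesgue. ?f x) = 0" if X: "X \<in> sets lebesgue" for X
  proof -
    obtain S N N' where S: "S \<in> sets lborel" "N' \<in> null_sets lborel" "N \<subseteq> N'" "X = S \<union> N"
      using sets_completionE[OF X] by metis
    have "S \<in> sigma_sets UNIV (range (\<lambda>(a, b). box a b))"
      using S(1) by (simp add: borel_eq_box)
    have "AE x in lebesgue. x \<notin> N'" using S(2) by (intro AE_completion AE_not_in)
    have "(LINT x:X|lebesgue. ?f x) = (LINT x:S|lebesgue. ?f x)"
      unfolding set_lebesgue_integral_def
    proof (rule integral_cong_AE)
      show "(\<lambda>x. indicat_real X x *\<^sub>R ?f x) \<in> borel_measurable lebesgue"
        using mf X by (intro borel_measurable_scaleR borel_measurable_indicator)
      show "(\<lambda>x. indicat_real S x *\<^sub>R ?f x) \<in> borel_measurable lebesgue"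
        using mf S(1) by (intro borel_measurable_scaleR borel_measurable_indicator) auto
      show "AE x in lebesgue. indicat_real X x *\<^sub>R ?f x = indicat_real S x *\<^sub>R ?f x"
        using \<open>AE x in lebesgue. x \<notin> N'\<close> by eventually_elim (use S in \<open>auto simp: indicator_def\<close>)
    qed
    also have "\<dots> = 0" by (rule B) fact
    finally show ?thesis .
  qed
  then have "AE x in lebesgue. ?f x = 0"
    using intf by (intro density_unique_real) (auto simp: set_lebesgue_integral_def)
  then show ?thesis by eventually_elim auto
qed

text \<open>Bumps converge boundedly to indicators of boxes, so dominated convergence makes all
  integrals over small boxes vanish. Countably many closed boxes fill \<open>U\<close>, and their
  faces are null.\<close>

lemma AE_zero_if_test_integrals_zero:
  assumes U: "open U" and w: "L2 U w"
    and z: "\<And>\<phi>. test_fun U \<phi> \<Longrightarrow> (LINT x|lebesgue_on U. w x * \<phi> x) = 0"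
  shows "AE x in lebesgue_on U. w x = 0"
proof -
  have Us: "U \<in> sets lebesgue" using U by auto
  have box: "AE x in lebesgue. x \<in> box a b \<longrightarrow> w x = 0" if ab: "cbox a b \<subseteq> U" for a b
  proof (rule AE_zero_if_box_integrals_zero)
    have sub: "box a b \<subseteq> U" using ab box_subset_cbox by blast
    have int: "integrable (lebesgue_on (box a b)) w"
      using L2_integrable[OF _ L2_subset[OF w _ Us sub]] by simp
    then show sa: "set_integrable lebesgue (box a b) w"
      by (simp add: set_integrable_def integrable_restrict_space)
    fix c d assume cd: "box c d \<subseteq> box a b"
    show "(LINT x:box c d|lebesgue. w x) = 0"
    \<comment> \<open>When the open box is empty, \<open>cbox c d\<close> can still be a degenerate
      box that sticks out of \<open>U\<close>; only nonempty boxes admit the approximation by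
      bumps.\<close>
    proof (cases "box c d = {}")
      case False
      have cU: "cbox c d \<subseteq> U"
      proof -
        have "cbox c d = closure (box c d)" using False by (simp add: closure_box)
        also have "\<dots> \<subseteq> cbox a b" using cd box_subset_cbox by (intro closure_minimal) blast+
        finally show ?thesis using ab by blast
      qed
      let ?\<phi> = "\<lambda>n. box_bump (1 / real (Suc n)) c d"
      have tf: "test_fun U (?\<phi> n)" for n by (rule test_fun_box_bump) (use cU in auto)
      have sub': "box c d \<subseteq> U" using cU box_subset_cbox by blast
      have "set_integrable lebesgue (box c d) w"
        using cd by (intro set_integrable_subset[OF sa]) auto
      then have int': "integrable lebesgue (\<lambda>x. indicator (box c d) x * w x)"
        by (simp add: set_integrable_def)
      have m: "?\<phi> n \<in> borel_measurable lebesgue" for n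
      proof -
        have "Ck 0 (?\<phi> n)" using tf test_fun_def by blast
        then have "?\<phi> n \<in> borel_measurable borel" by (simp add: borel_measurable_continuous_onI)
        then show ?thesis by (intro measurable_completion) simp
      qed
      have "(\<lambda>n. LINT x|lebesgue. ?\<phi> n x * (indicator (box c d) x * w x)) \<longlonglongrightarrow>
            (LINT x|lebesgue. indicator (box c d) x * (indicator (box c d) x * w x))"
      proof (rule integral_dominated_convergence)
        show "integrable lebesgue (\<lambda>x. \<bar>indicator (box c d) x * w x\<bar>)"
          using int' by (rule integrable_abs)
        show "AE x in lebesgue. (\<lambda>n. ?\<phi> n x * (indicator (box c d) x * w x)) \<longlonglongrightarrow>
            indicator (box c d) x * (indicator (box c d) x * w x)"
          by (intro AE_I2 tendsto_mult box_bump_tendsto tendsto_const)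
        show "AE x in lebesgue. norm (?\<phi> n x * (indicator (box c d) x * w x)) \<le> \<bar>indicator (box c d) x * w x\<bar>" for n
          using box_bump_bounds[of "1 / real (Suc n)" c d]
          by (intro AE_I2) (auto simp: abs_mult intro!: mult_left_le_one_le)
        show "(\<lambda>x. ?\<phi> n x * (indicator (box c d) x * w x)) \<in> borel_measurable lebesgue" for n
          by (rule borel_measurable_times[OF m borel_measurable_integrable[OF int']])
        show "(\<lambda>x. indicator (box c d) x * (indicator (box c d) x * w x)) \<in> borel_measurable lebesgue"
          by (rule borel_measurable_times[OF borel_measurable_indicator borel_measurable_integrable[OF int']]) auto
      qed
      moreover have "(LINT x|lebesgue. ?\<phi> n x * (indicator (box c d) x * w x)) = 0" for n
      proof -
        have "(LINT x|lebesgue. ?\<phi> n x * (indicator (box c d) x * w x)) = (LINT x|lebesgue. indicator U x *\<^sub>R (w x * ?\<phi> n x))"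
          by (rule Bochner_Integration.integral_cong)
            (use sub' box_bump_eq_0_iff[of "1 / real (Suc n)" c d] in \<open>auto simp: indicator_def\<close>)
        also have "\<dots> = 0" using z[OF tf[of n]] Us by (simp add: integral_restrict_space)
        finally show ?thesis .
      qed
      ultimately have "(LINT x|lebesgue. indicator (box c d) x * (indicator (box c d) x * w x)) = 0"
        by (simp add: LIMSEQ_const_iff)
      moreover have "(\<lambda>x. indicator (box c d) x * (indicator (box c d) x * w x)) = (\<lambda>x. indicator (box c d) x *\<^sub>R w x)"
        by (auto simp: indicator_def)
      ultimately show ?thesis by (simp add: set_lebesgue_integral_def)
    qed (simp add: set_lebesgue_integral_def)
  qed
  obtain \<D> where D: "countable \<D>" "\<And>X. X \<in> \<D> \<Longrightarrow> X \<subseteq> U" "\<And>X. X \<in> \<D> \<Longrightarrow> \<exists>a b. X = cbox a b" "\<Union>\<D> = U"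
    by (rule open_countable_Union_open_cbox[OF U]) blast
  have "AE x in lebesgue. \<forall>X\<in>\<D>. x \<in> X \<longrightarrow> w x = 0"
  unfolding AE_ball_countable[OF D(1)]
  proof
    fix X assume X: "X \<in> \<D>"
    then obtain a b where ab: "X = cbox a b" using D(3) by blast
    have "AE x in lebesgue. x \<notin> cbox a b - box a b"
      by (rule AE_not_in) (simp add: negligible_frontier_interval flip: negligible_iff_null_sets)
    then show "AE x in lebesgue. x \<in> X \<longrightarrow> w x = 0"
      using box[OF D(2)[OF X, unfolded ab]] by eventually_elim (use ab in auto)
  qed
  then show ?thesis
    unfolding AE_lebesgue_on_iff[OF Us] by eventually_elim (use D(4) in auto)
qed

section \<open>Weak gradients of continuously differentiable functions\<close>

text \<open>Difference quotients have integral zero. By the mean value theorem they are bounded by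
  \<open>B\<close>, and they vanish outside the ball of radius R + 1 because the increments are at
  most 1, so dominated convergence passes to the derivative. The derivative is measurable as a
  pointwise limit, without being continuous.\<close>

lemma integral_directional_derivative_zero:
  fixes g :: "'a::euclidean_space \<Rightarrow> real"
  assumes g: "\<And>x. (g has_derivative D x) (at x)" and supp: "\<And>x. norm x > R \<Longrightarrow> g x = 0"
    and e: "norm e = 1" and B: "\<And>x. \<bar>D x e\<bar> \<le> B"
  shows "(LINT x|lborel. D x e) = 0"
proof -
  define h where "h n = 1 / real (Suc n)" for n
  have h: "0 < h n" "h n \<le> 1" for n by (auto simp: h_def)
  have h0: "h \<longlonglongrightarrow> 0" unfolding h_def by (intro LIMSEQ_Suc lim_1_over_n)
  define q where "q n x = (g (x + h n *\<^sub>R e) - g x) / h n" for n x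
  have contg: "continuous_on UNIV g"
    using g by (auto simp: continuous_on_eq_continuous_at intro: has_derivative_continuous)
  then have mg: "g \<in> borel_measurable borel" by (rule borel_measurable_continuous_onI)
  have DD: "((\<lambda>t. g (x + t *\<^sub>R e)) has_real_derivative D (x + t *\<^sub>R e) e) (at t)" for x t
  proof -
    have "((\<lambda>t. g (x + t *\<^sub>R e)) has_derivative (\<lambda>s. D (x + t *\<^sub>R e) (s *\<^sub>R e))) (at t)"
      by (rule has_derivative_compose[OF _ g]) (auto intro!: derivative_eq_intros)
    moreover have "D (x + t *\<^sub>R e) (s *\<^sub>R e) = D (x + t *\<^sub>R e) e * s" for s
      using linear_cmul[OF has_derivative_linear[OF g]] by simp
    ultimately show ?thesis by (simp add: has_field_derivative_def mult.commute[of _ "D (x + t *\<^sub>R e) e"])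
  qed
  have q_lim: "(\<lambda>n. q n x) \<longlonglongrightarrow> D x e" for x
  proof -
    have "((\<lambda>s. (g (x + (0 + s) *\<^sub>R e) - g (x + 0 *\<^sub>R e)) / s) \<longlongrightarrow> D (x + 0 *\<^sub>R e) e) (at 0)"
      using DD[of x 0] unfolding DERIV_def .
    moreover have "filterlim h (at 0) sequentially"
      using h0 h by (auto simp: filterlim_at less_imp_neq[symmetric] eventually_sequentially)
    ultimately show ?thesis using filterlim_compose unfolding q_def by fastforce
  qed
  have q_bd: "\<bar>q n x\<bar> \<le> B * indicator (cball 0 (R + 1)) x" for n x
  proof (cases "x \<in> cball 0 (R + 1)")
    case True
    obtain z where "g (x + h n *\<^sub>R e) - g (x + 0 *\<^sub>R e) = (h n - 0) * D (x + z *\<^sub>R e) e"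
      using MVT2[OF h(1)[of n], of "\<lambda>t. g (x + t *\<^sub>R e)" "\<lambda>t. D (x + t *\<^sub>R e) e"] DD by blast
    then have "q n x = D (x + z *\<^sub>R e) e" using h[of n] by (simp add: q_def)
    then show ?thesis using True B by simp
  next
    case False
    then have x: "norm x > R + 1" by simp
    moreover have "norm x \<le> norm (x + h n *\<^sub>R e) + norm (h n *\<^sub>R e)"
      using norm_triangle_ineq4[of "x + h n *\<^sub>R e" "h n *\<^sub>R e"] by simp
    ultimately have "norm (x + h n *\<^sub>R e) > R" using e h[of n] by simp
    then show ?thesis using x supp by (simp add: q_def)
  qed
  have int_g: "integrable lborel g"
  proof -
    have "integrable lborel (\<lambda>x. indicator (cball 0 R) x *\<^sub>R g x)"
      using contg by (intro borel_integrable_compact) (auto intro: continuous_on_subset)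
    moreover have "(\<lambda>x. indicator (cball 0 R) x *\<^sub>R g x) = g"
      using supp by (auto simp: indicator_def fun_eq_iff not_le)
    ultimately show ?thesis by simp
  qed
  have int_shift: "integrable lborel (\<lambda>x. g (x + c))" "(LINT x|lborel. g (x + c)) = (LINT x|lborel. g x)" for c
  proof -
    have "integrable (distr lborel borel ((+) c)) g" using int_g by (simp add: lborel_distr_plus)
    then show "integrable lborel (\<lambda>x. g (x + c))" using mg by (simp add: integrable_distr_eq add.commute)
    have "(LINT x|lborel. g x) = (LINT x|distr lborel borel ((+) c). g x)" by (simp add: lborel_distr_plus)
    also have "\<dots> = (LINT x|lborel. g (x + c))" using mg by (simp add: integral_distr add.commute)
    finally show "(LINT x|lborel. g (x + c)) = (LINT x|lborel. g x)" by simp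
  qed
  have q0: "(LINT x|lborel. q n x) = 0" for n
    unfolding q_def using int_shift int_g by simp
  have mq: "q n \<in> borel_measurable lborel" for n
    unfolding q_def using int_shift(1) int_g by (intro borel_measurable_divide borel_measurable_diff) auto
  have "(\<lambda>n. LINT x|lborel. q n x) \<longlonglongrightarrow> (LINT x|lborel. D x e)"
  proof (rule integral_dominated_convergence)
    show "(\<lambda>x. D x e) \<in> borel_measurable lborel"
      using borel_measurable_LIMSEQ_real[OF q_lim mq] by simp
    have "integrable lborel (\<lambda>x. indicator (cball (0::'a) (R + 1)) x *\<^sub>R B)"
      by (intro borel_integrable_compact) auto
    then show "integrable lborel (\<lambda>x. B * indicator (cball (0::'a) (R + 1)) x)" by (simp add: mult.commute)
  qed (use q_lim q_bd mq in auto)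
  then show ?thesis by (simp add: q0 LIMSEQ_const_iff)
qed

lemma borel_measurable_lebesgue_on_continuous:
  fixes f :: "'a::euclidean_space \<Rightarrow> real"
  assumes "continuous_on S f" "S \<in> sets lebesgue"
  shows "f \<in> borel_measurable (lebesgue_on S)"
  using assms continuous_imp_measurable_on_sets_lebesgue by blast

lemma test_funD:
  assumes "test_fun U \<phi>"
  shows "\<And>x. (\<phi> has_derivative frechet_derivative \<phi> (at x)) (at x)"
    "continuous_on UNIV \<phi>" "continuous_on UNIV (pd i \<phi>)"
    "x \<notin> closure {x. \<phi> x \<noteq> 0} \<Longrightarrow> \<phi> x = 0"
    "x \<notin> closure {x. \<phi> x \<noteq> 0} \<Longrightarrow> pd i \<phi> x = 0"
proof -
  have C: "Ck (Suc 0) \<phi>" "Ck 0 \<phi>" using assms unfolding test_fun_def by blast+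
  show d: "\<And>x. (\<phi> has_derivative frechet_derivative \<phi> (at x)) (at x)"
    using C(1) by (auto simp: frechet_derivative_works[symmetric])
  show "continuous_on UNIV \<phi>" "continuous_on UNIV (pd i \<phi>)" using C by auto
  show z: "x \<notin> closure {x. \<phi> x \<noteq> 0} \<Longrightarrow> \<phi> x = 0" for x
    using closure_subset[of "{x. \<phi> x \<noteq> 0}"] by blast
  assume x: "x \<notin> closure {x. \<phi> x \<noteq> 0}"
  have "((\<lambda>x. 0) has_derivative frechet_derivative \<phi> (at x)) (at x)"
  proof (rule has_derivative_transform_within_open[OF d])
    show "open (- closure {x. \<phi> x \<noteq> 0})" by (simp add: open_Compl)
  qed (use x z in blast)+
  then have "frechet_derivative \<phi> (at x) = (\<lambda>h. 0)"
    by (rule has_derivative_unique[OF _ has_derivative_const])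
  then show "pd i \<phi> x = 0" by (simp add: pd_def)
qed

lemma L2_bounded_continuous:
  assumes "continuous_on U f" "U \<in> lmeasurable" "\<And>x. x \<in> U \<Longrightarrow> \<bar>f x\<bar> \<le> B"
  shows "L2 U f"
  using assms fmeasurableD[OF assms(2)]
  by (intro L2_bounded borel_measurable_lebesgue_on_continuous AE_I2) auto

text \<open>Integration by parts needs no regularity of the boundary here: the product with a test
  function extends by zero to a differentiable function on the plane, whose partial derivative
  integrates to zero.\<close>

lemma has_weak_partial_C1:
  assumes U: "open U" "bounded U"
    and der: "\<And>x. x \<in> U \<Longrightarrow> (V has_derivative (\<lambda>h. G x \<bullet> h)) (at x)"
    and G: "continuous_on U G"
    and bV: "\<And>x. x \<in> U \<Longrightarrow> \<bar>V x\<bar> \<le> B" and bG: "\<And>x. x \<in> U \<Longrightarrow> norm (G x) \<le> B"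
  shows "has_weak_partial U i V (\<lambda>x. G x $ i)"
proof -
  have Um: "U \<in> lmeasurable" using U by (simp add: bounded_set_imp_lmeasurable)
  have Us: "U \<in> sets lebesgue" using U by auto
  have contV: "continuous_on U V"
    using der U(1) by (auto simp: continuous_on_eq_continuous_at intro: has_derivative_continuous)
  have L2V: "L2 U V" using contV Um bV by (rule L2_bounded_continuous)
  have bGi: "\<bar>G x $ i\<bar> \<le> B" if "x \<in> U" for x
    using bG[OF that] component_le_norm_cart[of "G x" i] by linarith
  have contGi: "continuous_on U (\<lambda>x. G x $ i)" using G by (intro continuous_intros)
  have L2G: "L2 U (\<lambda>x. G x $ i)" using contGi Um bGi by (rule L2_bounded_continuous)
  have "(LINT x|lebesgue_on U. V x * pd i \<phi> x) = - (LINT x|lebesgue_on U. G x $ i * \<phi> x)"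
    if tf: "test_fun U \<phi>" for \<phi>
  proof -
    note T = test_funD[OF tf]
    let ?S = "closure {x. \<phi> x \<noteq> 0}"
    have S: "compact ?S" "?S \<subseteq> U" using tf unfolding test_fun_def by auto
    let ?e = "axis i 1 :: point"
    obtain B1 where B1: "\<And>x. x \<in> ?S \<Longrightarrow> \<bar>\<phi> x\<bar> \<le> B1"
      using compact_imp_bounded[OF compact_continuous_image[OF continuous_on_subset[OF T(2)] S(1)]]
      by (auto simp: bounded_iff)
    obtain B2 where B2: "\<And>x. x \<in> ?S \<Longrightarrow> \<bar>pd i \<phi> x\<bar> \<le> B2"
      using compact_imp_bounded[OF compact_continuous_image[OF continuous_on_subset[OF T(3)[of i]] S(1)]]
      by (auto simp: bounded_iff)
    have B1': "\<bar>\<phi> x\<bar> \<le> max 0 B1" for x using B1[of x] T(4)[of x] by (cases "x \<in> ?S") auto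
    have B2': "\<bar>pd i \<phi> x\<bar> \<le> max 0 B2" for x using B2[of x] T(5)[of x i] by (cases "x \<in> ?S") auto
    have L2\<phi>: "L2 U \<phi>"
      using continuous_on_subset[OF T(2)] Um B1' by (intro L2_bounded_continuous) auto
    have L2p: "L2 U (pd i \<phi>)"
      using continuous_on_subset[OF T(3)] Um B2' by (intro L2_bounded_continuous) auto
    \<comment> \<open>The cut is made at the support rather than at \<open>U\<close>. The open sets
      \<open>U\<close> and the complement of the support cover the plane, and on each of them the
      derivative of \<open>g\<close> is evident.\<close>
    define g where "g x = (if x \<in> ?S then V x * \<phi> x else 0)" for x
    define D where "D x = (if x \<in> ?S then (\<lambda>h. V x * frechet_derivative \<phi> (at x) h + (G x \<bullet> h) * \<phi> x) else (\<lambda>h. 0))" for x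
    have gU: "g x = V x * \<phi> x" if "x \<in> U" for x using T(4)[of x] by (cases "x \<in> ?S") (simp_all add: g_def)
    have gd: "(g has_derivative D x) (at x)" for x
    proof (cases "x \<in> ?S")
      case True
      then have x: "x \<in> U" using S by auto
      have "((\<lambda>x. V x * \<phi> x) has_derivative D x) (at x)"
        unfolding D_def using True by (simp add: has_derivative_mult[OF der[OF x] T(1)])
      then show ?thesis
        by (rule has_derivative_transform_within_open[of _ _ _ _ U]) (use x U gU in auto)
    next
      case False
      have "((\<lambda>x. 0) has_derivative D x) (at x)" using False by (simp add: D_def)
      then show ?thesis
        by (rule has_derivative_transform_within_open[of _ _ _ _ "- ?S"]) (use False in \<open>auto simp: g_def\<close>)
    qed
    obtain R where R: "\<And>x. x \<in> ?S \<Longrightarrow> norm x \<le> R"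
      using compact_imp_bounded[OF S(1)] by (auto simp: bounded_iff)
    have De: "D x ?e = (if x \<in> ?S then V x * pd i \<phi> x + G x $ i * \<phi> x else 0)" for x
      by (simp add: D_def pd_def inner_axis)
    have bd: "\<bar>D x ?e\<bar> \<le> \<bar>B\<bar> * max 0 B2 + \<bar>B\<bar> * max 0 B1" for x
    proof (cases "x \<in> ?S")
      case True
      then have x: "x \<in> U" using S by auto
      have "\<bar>V x * pd i \<phi> x\<bar> \<le> \<bar>B\<bar> * max 0 B2"
        unfolding abs_mult using bV[OF x] B2' by (intro mult_mono) auto
      moreover have "\<bar>G x $ i * \<phi> x\<bar> \<le> \<bar>B\<bar> * max 0 B1"
        unfolding abs_mult using bGi[OF x] B1' by (intro mult_mono) auto
      ultimately show ?thesis using True unfolding De by simp linarith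
    qed (auto simp: De)
    have "g x = 0" if "norm x > R" for x using R[of x] that by (auto simp: g_def)
    then have "(LINT x|lborel. D x ?e) = 0"
      by (rule integral_directional_derivative_zero[OF gd _ norm_axis_1 bd])
    moreover have "(LINT x|lborel. D x ?e) = (LINT x|lebesgue. indicator U x *\<^sub>R (V x * pd i \<phi> x + G x $ i * \<phi> x))"
    proof -
      have eq: "D x ?e = indicator U x *\<^sub>R (V x * pd i \<phi> x + G x $ i * \<phi> x)" for x
        using S(2) T(4)[of x] T(5)[of x i] by (cases "x \<in> ?S") (auto simp: De indicator_def)
      have "continuous_on U (\<lambda>x. V x * pd i \<phi> x + G x $ i * \<phi> x)"
        by (intro continuous_intros contV contGi continuous_on_subset[OF T(2)] continuous_on_subset[OF T(3)]) auto
      then have "(\<lambda>x. indicator U x *\<^sub>R (V x * pd i \<phi> x + G x $ i * \<phi> x)) \<in> borel_measurable borel"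
        using U by (intro borel_measurable_continuous_on_indicator) auto
      then show ?thesis unfolding eq by (subst integral_completion) auto
    qed
    ultimately have "(LINT x|lebesgue_on U. V x * pd i \<phi> x + G x $ i * \<phi> x) = 0"
      using Us by (simp add: integral_restrict_space)
    then show ?thesis
      using L2_mult_integrable[OF L2V L2p] L2_mult_integrable[OF L2G L2\<phi>] by simp
  qed
  then show ?thesis using L2V L2G unfolding has_weak_partial_def by blast
qed

text \<open>This removes the arbitrariness of \<open>SOME\<close>: any weak derivative that can be
  computed may replace the chosen one.\<close>

lemma wgrad_unique:
  assumes U: "open U" and w: "has_weak_partial U i v w"
  shows "AE x in lebesgue_on U. wgrad U v x $ i = w x"
proof -
  let ?w = "SOME w. has_weak_partial U i v w"
  have w': "has_weak_partial U i v ?w"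
  proof -
    from w have "\<exists>w. has_weak_partial U i v w" by blast
    then show ?thesis by (rule someI_ex)
  qed
  have d: "L2 U (\<lambda>x. ?w x + (-1) * w x)"
    using has_weak_partialD(2)[OF w'] has_weak_partialD(2)[OF w] by (rule L2_lincomb)
  have "AE x in lebesgue_on U. ?w x + (-1) * w x = 0"
  proof (rule AE_zero_if_test_integrals_zero[OF U d])
    fix \<phi> assume tf: "test_fun U \<phi>"
    have S: "compact (closure {x. \<phi> x \<noteq> 0})" "closure {x. \<phi> x \<noteq> 0} \<subseteq> U"
      using tf unfolding test_fun_def by auto
    note T = test_funD[OF tf]
    obtain B1 where B1: "\<And>x. x \<in> closure {x. \<phi> x \<noteq> 0} \<Longrightarrow> \<bar>\<phi> x\<bar> \<le> B1"
      using compact_imp_bounded[OF compact_continuous_image[OF continuous_on_subset[OF T(2)] S(1)]]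
      by (auto simp: bounded_iff)
    let ?S = "closure {x. \<phi> x \<noteq> 0}"
    have Us: "U \<in> sets lebesgue" using U by auto
    have SU: "?S \<in> sets lebesgue" using S(1) by (simp add: compact_imp_closed)
    have "L2 ?S \<phi>"
      using B1 S(1) continuous_on_subset[OF T(2)] by (intro L2_bounded_continuous) (auto simp: lmeasurable_compact)
    \<comment> \<open>\<open>U\<close> may be unbounded, so integrability is obtained on the compact
      support of the test function and extended by zero.\<close>
    have int: "integrable (lebesgue_on U) (\<lambda>x. z x * \<phi> x)" if z: "L2 U z" for z
    proof -
      have "integrable (lebesgue_on ?S) (\<lambda>x. z x * \<phi> x)"
        by (rule L2_mult_integrable[OF L2_subset[OF z SU Us S(2)] \<open>L2 ?S \<phi>\<close>])
      then have "integrable lebesgue (\<lambda>x. indicator ?S x *\<^sub>R (z x * \<phi> x))"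
        using SU by (simp add: integrable_restrict_space)
      moreover have "(\<lambda>x. indicator ?S x *\<^sub>R (z x * \<phi> x)) = (\<lambda>x. indicator U x *\<^sub>R (z x * \<phi> x))"
      proof
        fix x show "indicator ?S x *\<^sub>R (z x * \<phi> x) = indicator U x *\<^sub>R (z x * \<phi> x)"
          using S(2) T(4)[of x] by (cases "x \<in> ?S") (auto simp: indicator_def)
      qed
      ultimately show ?thesis using Us by (simp add: integrable_restrict_space)
    qed
    have "(LINT x|lebesgue_on U. ?w x * \<phi> x) = (LINT x|lebesgue_on U. w x * \<phi> x)"
      using has_weak_partialD(3)[OF w tf] has_weak_partialD(3)[OF w' tf] by simp
    moreover have "(LINT x|lebesgue_on U. (?w x + - 1 * w x) * \<phi> x)
        = (LINT x|lebesgue_on U. ?w x * \<phi> x - w x * \<phi> x)"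
      by (simp add: algebra_simps)
    ultimately show "(LINT x|lebesgue_on U. (?w x + - 1 * w x) * \<phi> x) = 0"
      using int[OF has_weak_partialD(2)[OF w']] int[OF has_weak_partialD(2)[OF w]] by simp
  qed
  then show ?thesis by eventually_elim (use w in \<open>auto simp: wgrad_def\<close>)
qed

lemma has_weak_partial_cong_AE:
  assumes "has_weak_partial U i v w" "AE x in lebesgue_on U. v x = v' x" "U \<in> sets lebesgue"
  shows "has_weak_partial U i v' w"
proof -
  have L2: "L2 U v" "L2 U v'"
    using has_weak_partialD(1)[OF assms(1)] L2_cong_AE[OF _ assms(2,3)] by blast+
  have "(LINT x|lebesgue_on U. v' x * pd i \<phi> x) = (LINT x|lebesgue_on U. v x * pd i \<phi> x)"
    if tf: "test_fun U \<phi>" for \<phi>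
  proof (rule integral_cong_AE)
    have "pd i \<phi> \<in> borel_measurable (lebesgue_on U)"
      using test_funD(3)[OF tf] assms(3)
      by (intro borel_measurable_lebesgue_on_continuous) (auto intro: continuous_on_subset)
    then show "(\<lambda>x. v' x * pd i \<phi> x) \<in> borel_measurable (lebesgue_on U)"
      "(\<lambda>x. v x * pd i \<phi> x) \<in> borel_measurable (lebesgue_on U)"
      using L2 unfolding L2_def by auto
    show "AE x in lebesgue_on U. v' x * pd i \<phi> x = v x * pd i \<phi> x"
      using assms(2) by eventually_elim simp
  qed
  then show ?thesis
    using assms(1) L2 unfolding has_weak_partial_def by simp
qed

section \<open>Traces of bounded and of continuous functions\<close>

text \<open>The means in \<open>has_trace\<close> have a positive denominator: a ball around a point
  of the closure meets an open set in a nonempty open set.\<close>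

lemma Int_ball_measure:
  fixes K :: "point set"
  assumes "open K" "z \<in> closure K" "r > 0"
  shows "K \<inter> ball z r \<in> lmeasurable" "measure lebesgue (K \<inter> ball z r) > 0"
proof -
  show lm: "K \<inter> ball z r \<in> lmeasurable"
    using assms(1) by (intro bounded_set_imp_lmeasurable) (auto intro: bounded_subset[OF bounded_ball])
  have "open (K \<inter> ball z r)" using assms(1) by auto
  moreover obtain y where "y \<in> K" "dist y z < r"
    using assms(2,3) unfolding closure_approachable by blast
  then have "K \<inter> ball z r \<noteq> {}" by (auto simp: dist_commute)
  ultimately have "\<not> negligible (K \<inter> ball z r)" using open_not_negligible by blast
  then have "measure lebesgue (K \<inter> ball z r) \<noteq> 0"
    using lm negligible_iff_measure0 by blast
  then show "measure lebesgue (K \<inter> ball z r) > 0"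
    using measure_nonneg[of lebesgue "K \<inter> ball z r"] by linarith
qed

lemma AE_lebesgue_on_subset:
  assumes "AE x in lebesgue_on U. P x" "S \<subseteq> U" "S \<in> sets lebesgue" "U \<in> sets lebesgue"
  shows "AE x in lebesgue_on S. P x"
  using assms(1) unfolding AE_lebesgue_on_iff[OF assms(3)] AE_lebesgue_on_iff[OF assms(4)]
  by eventually_elim (use assms(2) in auto)

lemma mean_ge:
  fixes K :: "point set" and f :: "point \<Rightarrow> real"
  assumes K: "open K" "bounded K" and z: "z \<in> closure K" and r: "r > 0"
    and f: "integrable (lebesgue_on K) f" "AE x in lebesgue_on K. d \<le> f x"
  shows "d \<le> (LINT x|lebesgue_on (K \<inter> ball z r). f x) / measure lebesgue (K \<inter> ball z r)"
proof -
  let ?B = "K \<inter> ball z r"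
  note m = Int_ball_measure[OF K(1) z r]
  have s: "?B \<in> sets lebesgue" "K \<in> sets lebesgue" using K(1) by auto
  interpret finite_measure "lebesgue_on ?B" using m(1) by (rule finite_measure_lebesgue_on)
  have "d * measure lebesgue ?B = (LINT x|lebesgue_on ?B. d)"
    using s by (simp add: measure_restrict_space)
  also have "\<dots> \<le> (LINT x|lebesgue_on ?B. f x)"
  proof (rule integral_mono_AE)
    show "integrable (lebesgue_on ?B) f" using f(1) s by (rule integrable_lebesgue_on_subset) auto
    show "AE x in lebesgue_on ?B. d \<le> f x" using f(2) by (rule AE_lebesgue_on_subset) (use s in auto)
  qed simp
  finally show ?thesis using m(2) by (simp add: pos_le_divide_eq)
qed

text \<open>Since |v - \<tau>| is at least |\<tau>| - B almost everywhere, so are its means, and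
  these tend to zero. Existence of a trace is not presupposed, which suits the coefficient \<beta>;
  the default value zero obeys the bound because B is nonnegative.\<close>

lemma trc_bounded:
  fixes K :: "point set"
  assumes K: "open K" "bounded K" and p: "p ` {0..1} \<subseteq> closure K"
    and v: "v \<in> borel_measurable (lebesgue_on K)" "AE x in lebesgue_on K. \<bar>v x\<bar> \<le> B" and B: "0 \<le> B"
  shows "AE t in lebesgue_on {0..1}. \<bar>trc K p v t\<bar> \<le> B"
proof (cases "\<exists>\<tau>. has_trace K p v \<tau>")
  case True
  let ?\<tau> = "SOME \<tau>. has_trace K p v \<tau>"
  have "has_trace K p v ?\<tau>" using True by (rule someI_ex)
  then have "AE t in lebesgue_on {0..1}.
        ((\<lambda>r. (LINT x|lebesgue_on (K \<inter> ball (p t) r). \<bar>v x - ?\<tau> t\<bar>)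
               / measure lebesgue (K \<inter> ball (p t) r)) \<longlongrightarrow> 0) (at_right 0)"
    unfolding has_trace_def[of _ _ _ "Eps _"] by blast
  then have "AE t in lebesgue_on {0..1}. \<bar>?\<tau> t\<bar> \<le> B"
  proof (rule lebesgue_on_mono)
    fix t assume t: "t \<in> {0..1::real}"
      and lim: "((\<lambda>r. (LINT x|lebesgue_on (K \<inter> ball (p t) r). \<bar>v x - ?\<tau> t\<bar>)
               / measure lebesgue (K \<inter> ball (p t) r)) \<longlongrightarrow> 0) (at_right 0)"
    have z: "p t \<in> closure K" using p t by auto
    have lm: "K \<in> lmeasurable" using K by (simp add: bounded_set_imp_lmeasurable)
    have "L2 K v" using lm v by (rule L2_bounded)
    then have "integrable (lebesgue_on K) (\<lambda>x. \<bar>v x - ?\<tau> t\<bar>)"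
      by (intro integrable_abs Bochner_Integration.integrable_diff L2_integrable[OF lm]
          finite_measure.integrable_const[OF finite_measure_lebesgue_on[OF lm]])
    moreover have "AE x in lebesgue_on K. \<bar>?\<tau> t\<bar> - B \<le> \<bar>v x - ?\<tau> t\<bar>"
      using v(2) by eventually_elim linarith
    ultimately have "\<forall>\<^sub>F r in at_right 0. \<bar>?\<tau> t\<bar> - B \<le> (LINT x|lebesgue_on (K \<inter> ball (p t) r). \<bar>v x - ?\<tau> t\<bar>)
               / measure lebesgue (K \<inter> ball (p t) r)"
      using mean_ge[OF K z] unfolding eventually_at_right_field by (auto intro!: exI[of _ 1])
    from tendsto_lowerbound[OF lim this] show "\<bar>?\<tau> t\<bar> \<le> B" by simp
  qed
  then show ?thesis using True by (simp only: trc_def if_True)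
next
  case False
  then show ?thesis using B by (simp only: trc_def if_not_P[OF False] if_False) simp
qed

lemma has_trace_continuous:
  fixes K :: "point set"
  assumes K: "open K" "bounded K" and p: "p ` {0..1} \<subseteq> closure K" "continuous_on {0..1} p"
    and V: "continuous_on (closure K) V" "AE x in lebesgue_on K. v x = V x"
  shows "has_trace K p v (\<lambda>t. V (p t))"
proof -
  have "continuous_on {0..1} (\<lambda>t. V (p t))"
    using continuous_on_compose2[OF V(1) p(2,1)] .
  moreover from this obtain B where "\<And>t. t \<in> {0..1} \<Longrightarrow> \<bar>V (p t)\<bar> \<le> B"
    using compact_imp_bounded[OF compact_continuous_image[OF _ compact_Icc]]
    by (fastforce simp: bounded_iff)
  ultimately have "L2 {0..1} (\<lambda>t. V (p t))"
    by (intro L2_bounded borel_measurable_lebesgue_on_continuous AE_I2) auto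
  moreover have "((\<lambda>r. (LINT x|lebesgue_on (K \<inter> ball (p t) r). \<bar>v x - V (p t)\<bar>)
               / measure lebesgue (K \<inter> ball (p t) r)) \<longlongrightarrow> 0) (at_right 0)" if t: "t \<in> {0..1}" for t
  proof (rule tendstoI)
    fix e :: real assume e: "e > 0"
    have z: "p t \<in> closure K" using p t by auto
    obtain d where d: "d > 0" "\<And>x. x \<in> closure K \<Longrightarrow> dist x (p t) < d \<Longrightarrow> dist (V x) (V (p t)) < e / 2"
      using V(1) z e unfolding continuous_on_iff by (metis half_gt_zero)
    have "dist ((LINT x|lebesgue_on (K \<inter> ball (p t) r). \<bar>v x - V (p t)\<bar>)
               / measure lebesgue (K \<inter> ball (p t) r)) 0 < e" if r: "0 < r" "r < d" for r
    proof -
      let ?B = "K \<inter> ball (p t) r"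
      note m = Int_ball_measure[OF K(1) z r(1)]
      have s: "?B \<in> sets lebesgue" "K \<in> sets lebesgue" using K(1) by auto
      interpret finite_measure "lebesgue_on ?B" using m(1) by (rule finite_measure_lebesgue_on)
      have AE: "AE x in lebesgue_on ?B. v x = V x" using V(2) by (rule AE_lebesgue_on_subset) (use s in auto)
      have "(LINT x|lebesgue_on ?B. \<bar>v x - V (p t)\<bar>) \<le> (LINT x|lebesgue_on ?B. e / 2)"
      proof (rule integral_mono_AE')
        show "AE x in lebesgue_on ?B. \<bar>v x - V (p t)\<bar> \<le> e / 2"
          using AE
        proof (rule lebesgue_on_mono)
          fix x assume "v x = V x" "x \<in> ?B"
          then show "\<bar>v x - V (p t)\<bar> \<le> e / 2"
            using d(2)[of x] r closure_subset[of K] by (auto simp: dist_commute dist_real_def)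
        qed
      qed (use e in auto)
      also have "\<dots> = e / 2 * measure lebesgue ?B" using s by (simp add: measure_restrict_space)
      finally have "(LINT x|lebesgue_on ?B. \<bar>v x - V (p t)\<bar>) / measure lebesgue ?B \<le> e / 2"
        using m(2) by (simp add: pos_divide_le_eq)
      moreover have "0 \<le> (LINT x|lebesgue_on ?B. \<bar>v x - V (p t)\<bar>) / measure lebesgue ?B"
        by (intro divide_nonneg_nonneg integral_nonneg_AE) auto
      ultimately show ?thesis using e unfolding dist_real_def by linarith
    qed
    then show "\<forall>\<^sub>F r in at_right 0. dist ((LINT x|lebesgue_on (K \<inter> ball (p t) r). \<bar>v x - V (p t)\<bar>)
               / measure lebesgue (K \<inter> ball (p t) r)) 0 < e"
      unfolding eventually_at_right_field using d(1) by blast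
  qed
  ultimately show ?thesis unfolding has_trace_def by (auto intro!: AE_I2)
qed

text \<open>A Lebesgue value is unique: |\<tau> - V| is at most |v - \<tau>| + |v - V|, and the
  means of both terms tend to zero. So the chosen trace must be the boundary value of the continuous
  representative.\<close>

lemma trc_continuous:
  fixes K :: "point set"
  assumes K: "open K" "bounded K" and p: "p ` {0..1} \<subseteq> closure K" "continuous_on {0..1} p"
    and V: "continuous_on (closure K) V" "AE x in lebesgue_on K. v x = V x"
  shows "AE t in lebesgue_on {0..1}. trc K p v t = V (p t)"
proof -
  let ?\<tau> = "SOME \<tau>. has_trace K p v \<tau>"
  have T: "has_trace K p v (\<lambda>t. V (p t))" by (rule has_trace_continuous) fact+
  then have "\<exists>\<tau>. has_trace K p v \<tau>" by blast
  then have T': "has_trace K p v ?\<tau>" by (rule someI_ex)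
  have "AE t in lebesgue_on {0..1}.
        ((\<lambda>r. (LINT x|lebesgue_on (K \<inter> ball (p t) r). \<bar>v x - ?\<tau> t\<bar>)
               / measure lebesgue (K \<inter> ball (p t) r)) \<longlongrightarrow> 0) (at_right 0)"
    using T' unfolding has_trace_def[of _ _ _ "Eps _"] by blast
  moreover have "AE t in lebesgue_on {0..1}.
        ((\<lambda>r. (LINT x|lebesgue_on (K \<inter> ball (p t) r). \<bar>v x - V (p t)\<bar>)
               / measure lebesgue (K \<inter> ball (p t) r)) \<longlongrightarrow> 0) (at_right 0)"
    using T unfolding has_trace_def by blast
  ultimately have "AE t in lebesgue_on {0..1}.
        ((\<lambda>r. (LINT x|lebesgue_on (K \<inter> ball (p t) r). \<bar>v x - ?\<tau> t\<bar>)
               / measure lebesgue (K \<inter> ball (p t) r)) \<longlongrightarrow> 0) (at_right 0) \<and>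
        ((\<lambda>r. (LINT x|lebesgue_on (K \<inter> ball (p t) r). \<bar>v x - V (p t)\<bar>)
               / measure lebesgue (K \<inter> ball (p t) r)) \<longlongrightarrow> 0) (at_right 0)"
    by eventually_elim (rule conjI)
  then have "AE t in lebesgue_on {0..1}. ?\<tau> t = V (p t)"
  proof (rule lebesgue_on_mono, elim conjE)
    fix t assume t: "t \<in> {0..1::real}"
    let ?m = "\<lambda>c r. (LINT x|lebesgue_on (K \<inter> ball (p t) r). \<bar>v x - c\<bar>) / measure lebesgue (K \<inter> ball (p t) r)"
    assume lim: "(?m (?\<tau> t) \<longlongrightarrow> 0) (at_right 0)" "(?m (V (p t)) \<longlongrightarrow> 0) (at_right 0)"
    have z: "p t \<in> closure K" using p t by auto
    have lm: "K \<in> lmeasurable" using K by (simp add: bounded_set_imp_lmeasurable)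
    have Ks: "K \<in> sets lebesgue" using K by auto
    obtain B where B: "\<And>x. x \<in> closure K \<Longrightarrow> \<bar>V x\<bar> \<le> B"
      using compact_imp_bounded[OF compact_continuous_image[OF V(1)]] K(2)
      by (auto simp: bounded_iff compact_closure)
    have "L2 K V" using continuous_on_subset[OF V(1) closure_subset] lm
      by (rule L2_bounded_continuous) (use B closure_subset in blast)
    then have "L2 K v" by (rule L2_cong_AE) (use V(2) Ks in \<open>auto elim: eventually_mono\<close>)
    then have int: "integrable (lebesgue_on K) (\<lambda>x. \<bar>v x - c\<bar>)" for c
      by (intro integrable_abs Bochner_Integration.integrable_diff L2_integrable[OF lm]
          finite_measure.integrable_const[OF finite_measure_lebesgue_on[OF lm]])
    have "\<bar>?\<tau> t - V (p t)\<bar> \<le> ?m (?\<tau> t) r + ?m (V (p t)) r" if r: "r > 0" for r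
    proof -
      have s: "K \<inter> ball (p t) r \<in> sets lebesgue" using K(1) by auto
      have "\<bar>?\<tau> t - V (p t)\<bar> \<le> (LINT x|lebesgue_on (K \<inter> ball (p t) r). \<bar>v x - ?\<tau> t\<bar> + \<bar>v x - V (p t)\<bar>)
          / measure lebesgue (K \<inter> ball (p t) r)"
        by (rule mean_ge[OF K z r]) (use int in auto)
      also have "\<dots> = ?m (?\<tau> t) r + ?m (V (p t)) r"
        using integrable_lebesgue_on_subset[OF int s Ks] by (simp add: add_divide_distrib)
      finally show ?thesis .
    qed
    then have "\<forall>\<^sub>F r in at_right 0. \<bar>?\<tau> t - V (p t)\<bar> \<le> ?m (?\<tau> t) r + ?m (V (p t)) r"
      unfolding eventually_at_right_field by (auto intro!: exI[of _ 1])
    from tendsto_lowerbound[OF tendsto_add[OF lim] this] show "?\<tau> t = V (p t)" by simp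
  qed
  moreover have "trc K p v = ?\<tau>" using T by (auto simp: trc_def)
  ultimately show ?thesis by simp
qed

section \<open>Curved meshes\<close>

lemma vd_eqI: "(p has_vector_derivative v) (at t) \<Longrightarrow> vd p t = v"
  unfolding vd_def by (rule vector_derivative_at)

text \<open>The common denominator of straight edges and arcs: enough for a bounded positive speed,
  a continuous normal and a null image. The condition runs over all real parameters because
  \<open>vd\<close> is a two-sided derivative, also at the end points 0 and 1.\<close>

definition regular_path :: "(real \<Rightarrow> point) \<Rightarrow> bool" where
  "regular_path p \<longleftrightarrow> (\<forall>t. p differentiable (at t)) \<and> continuous_on UNIV (vd p) \<and> (\<forall>t. vd p t \<noteq> 0)"

lemma Ck_pathD:
  assumes "Ck_path k p" "k \<ge> 1"
  shows "(p has_vector_derivative vd p t) (at t)" "continuous_on UNIV (vd p)"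
proof -
  have "((vd ^^ 0) p) differentiable (at t)" "continuous_on UNIV ((vd ^^ 1) p)"
    using assms unfolding Ck_path_def by (metis less_eq_Suc_le One_nat_def, metis)
  then have d: "p differentiable (at t)" and c: "continuous_on UNIV (vd p)" by simp_all
  show "(p has_vector_derivative vd p t) (at t)"
    using d unfolding vd_def by (rule vector_derivative_works[THEN iffD1])
  show "continuous_on UNIV (vd p)" by (rule c)
qed

lemma regular_path_curve:
  assumes "closed_curve k c" "k \<ge> 1"
  shows "regular_path (par c)"
proof -
  have C: "Ck_path k (par c)" "\<forall>t. vd (par c) t \<noteq> 0" using assms(1) unfolding closed_curve_def by blast+
  show ?thesis
    unfolding regular_path_def
    using C(2) Ck_pathD(2)[OF C(1) assms(2)] Ck_pathD(1)[OF C(1) assms(2), THEN differentiableI_vector]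
    by blast
qed

lemma regular_path_arc:
  assumes c: "regular_path (par c)" and p: "arc_of c p"
  shows "regular_path p"
proof -
  obtain a b where ab: "a \<noteq> b" "p = (\<lambda>t. par c (a + t * (b - a)))" using p unfolding arc_of_def by blast
  have hv: "(p has_vector_derivative (b - a) *\<^sub>R vd (par c) (a + t * (b - a))) (at t)" for t
  proof -
    have "((\<lambda>t. a + t * (b - a)) has_vector_derivative (b - a)) (at t)"
      by (auto intro!: derivative_eq_intros)
    moreover have "(par c has_vector_derivative vd (par c) (a + t * (b - a))) (at (a + t * (b - a)))"
      using c unfolding regular_path_def vd_def by (blast intro: vector_derivative_works[THEN iffD1])
    ultimately show ?thesis unfolding ab(2) by (rule vector_diff_chain_at[unfolded o_def])
  qed
  then have eq: "vd p = (\<lambda>t. (b - a) *\<^sub>R vd (par c) (a + t * (b - a)))" by (intro ext vd_eqI)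
  have "continuous_on UNIV (\<lambda>t. vd (par c) (a + t * (b - a)))"
    using c unfolding regular_path_def
    by (intro continuous_on_compose2[of UNIV "vd (par c)" UNIV "\<lambda>t. a + t * (b - a)"] continuous_intros) auto
  then have "continuous_on UNIV (vd p)" unfolding eq by (intro continuous_intros)
  moreover have "vd p t \<noteq> 0" for t using c ab(1) by (simp add: eq regular_path_def)
  ultimately show ?thesis using hv by (auto simp: regular_path_def intro: differentiableI_vector)
qed

lemma regular_path_linepath:
  assumes "a \<noteq> b"
  shows "regular_path (linepath a b)"
proof -
  have hv: "(linepath a b has_vector_derivative (b - a)) (at t)" for t
    by (rule has_vector_derivative_linepath_within)
  then have "vd (linepath a b) = (\<lambda>t. b - a)" by (intro ext vd_eqI)
  with hv assms show ?thesis by (auto simp: regular_path_def intro: differentiableI_vector)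
qed

lemma negligible_regular_path_image:
  assumes "regular_path p"
  shows "negligible (p ` S)"
proof -
  have "p differentiable_on S"
    using assms by (auto simp: regular_path_def differentiable_on_def intro: differentiable_at_withinI)
  then show ?thesis by (intro negligible_differentiable_image_lowdim) auto
qed

lemma regular_path_continuous: "regular_path p \<Longrightarrow> continuous_on S p"
  by (auto simp: regular_path_def continuous_on_eq_continuous_within
      intro: differentiable_imp_continuous_within differentiable_at_withinI)

lemma regular_path_nrml:
  assumes "regular_path p"
  shows "continuous_on UNIV (nrml p)"
proof -
  have "continuous_on UNIV (\<lambda>t. (1 / norm (vd p t)) *\<^sub>R vd p t)"
    using assms unfolding regular_path_def by (intro continuous_intros) auto
  then show ?thesis unfolding nrml_def[abs_def]
    by (rule bounded_linear.continuous_on[OF matrix_vector_mul_bounded_linear])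
qed

text \<open>One mesh and one coefficient are fixed. The constants obtained for them are numerals,
  and this is what gives uniformity over a family of meshes.\<close>

locale dg_mesh =
  fixes G :: geometry and \<epsilon>0 \<epsilon> Csh :: real and M :: mesh and \<beta> :: "point \<Rightarrow> real"
    and blo bhi :: real and m :: nat and \<sigma> :: real
  assumes geom: "geometry_ok G \<epsilon>0" and eps: "0 < \<epsilon>" "\<epsilon> \<le> \<epsilon>0"
    and mesh: "curved_mesh G \<epsilon> Csh M" and coeff: "coefficient_ok G blo bhi \<beta>"
    and blo: "0 < blo" "blo \<le> bhi" and m: "m \<ge> 1" and \<sigma>: "\<sigma> > 0"
begin

section \<open>Consequences of the geometric and mesh conditions\<close>

lemma
  shows open_Om: "open (Om G)" and connected_Om: "connected (Om G)" and bounded_Om: "bounded (Om G)"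
    and frontier_Om: "frontier (Om G) = curve_set (cb G)"
    and open_subdomains: "open (OmM G)" "open (OmP G)"
    and subdomains_disjoint: "OmM G \<inter> OmP G = {}"
    and Om_eq: "Om G = OmM G \<union> curve_set (ci G) \<union> OmP G"
    and frenet_regular_all: "\<forall>\<epsilon>. 0 < \<epsilon> \<and> \<epsilon> \<le> \<epsilon>0 \<longrightarrow> frenet_regular (cb G) \<epsilon> \<and> frenet_regular (ci G) \<epsilon> \<and>
        tube (cb G) \<epsilon> \<inter> tube (ci G) \<epsilon> = {}"
  using geom unfolding geometry_ok_def by - (elim conjE, assumption)+

lemma curves: "closed_curve 2 (cb G)" "closed_curve 2 (ci G)"
  using geom unfolding geometry_ok_def by auto

lemma regular_curves: "regular_path (par (cb G))" "regular_path (par (ci G))"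
  using curves by (auto intro: regular_path_curve)

lemma
  shows triangulation_tris: "triangulation (tris M)"
    and simplex_tris': "\<forall>T\<in>tris M. 2 simplex T"
    and chord_bij: "bij_betw chord (edges M) {F. \<exists>T\<in>tris M. F facet_of T}"
    and bedges_subset: "bedges M \<subseteq> edges M"
    and straight_edges: "\<forall>p\<in>edges M - (bedges M \<union> iedges M). p = linepath (p 0) (p 1)"
    and bedges_arcs: "\<forall>p\<in>bedges M. arc_of (cb G) p" and iedges_arcs: "\<forall>p\<in>iedges M. arc_of (ci G) p"
    and conforming: "\<forall>p\<in>edges M. \<forall>q\<in>edges M. p \<noteq> q \<longrightarrow>
        path_image p \<inter> path_image q \<subseteq> {p 0, p 1} \<inter> {q 0, q 1}"
    and elems_disjoint: "\<forall>T\<in>tris M. \<forall>T'\<in>tris M. T \<noteq> T' \<longrightarrow> elem M T \<inter> elem M T' = {}"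
    and elems_cover: "(\<Union>T\<in>tris M. closure (elem M T)) = closure (Om G)"
    and bedges_cover: "(\<Union>p\<in>bedges M. path_image p) = curve_set (cb G)"
    and adj_boundary': "\<forall>p\<in>boundary_edges G M. {T\<in>tris M. p \<in> edges_of M T} = {el1 M p}"
    and adj_interior': "\<forall>p\<in>edges M - boundary_edges G M. el1 M p \<noteq> el2 M p \<and>
        {T\<in>tris M. p \<in> edges_of M T} = {el1 M p, el2 M p}"
    and normals: "\<forall>p\<in>edges M. \<forall>t\<in>{0<..<1}.
        (\<forall>\<^sub>F d in at_right 0. p t - d *\<^sub>R nrml p t \<in> elem M (el1 M p)) \<and>
        (p \<notin> boundary_edges G M \<longrightarrow>
           (\<forall>\<^sub>F d in at_right 0. p t + d *\<^sub>R nrml p t \<in> elem M (el2 M p)))"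
    and branches: "\<forall>T\<in>tris M. curved M T \<longrightarrow>
        closure (elem M T) \<subseteq> tube (assoc_curve G M T) \<epsilon> \<and>
        continuous_on (closure (elem M T)) (branch M T) \<and>
        (\<forall>x\<in>closure (elem M T). \<bar>branch M T x $ 1\<bar> \<le> \<epsilon> \<and>
           frenet (assoc_curve G M T) (branch M T x) = x)"
  using mesh unfolding curved_mesh_def by - (elim conjE, assumption)+

lemma finite_tris: "finite (tris M)"
  using triangulation_tris unfolding triangulation_def by blast

lemma simplex_tris: "T \<in> tris M \<Longrightarrow> 2 simplex T"
  using simplex_tris' by blast

lemma finite_edges: "finite (edges M)"
proof -
  have "finite (\<Union>T\<in>tris M. {F. F facet_of T})"
    using finite_tris simplex_tris by (auto intro!: finite_polytope_facets simplex_imp_polytope)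
  moreover have "{F. \<exists>T\<in>tris M. F facet_of T} = (\<Union>T\<in>tris M. {F. F facet_of T})" by auto
  ultimately show ?thesis using bij_betw_finite[OF chord_bij] by simp
qed

text \<open>The chord is a facet of a triangle and so has dimension one, whereas a segment with
  equal ends is a point.\<close>

lemma edge_endpoints:
  assumes "p \<in> edges M"
  shows "p 0 \<noteq> p 1"
proof
  assume eq: "p 0 = p 1"
  obtain T where T: "T \<in> tris M" "chord p facet_of T"
    using bij_betw_apply[OF chord_bij assms] by blast
  then have "aff_dim (chord p) = 1"
    using aff_dim_simplex[OF simplex_tris] by (auto simp: facet_of_def)
  then show False using eq by (simp add: chord_def)
qed

lemma edge_arcs: "p \<in> bedges M \<Longrightarrow> arc_of (cb G) p" "p \<in> iedges M \<Longrightarrow> arc_of (ci G) p"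
  using bedges_arcs iedges_arcs by blast+

lemma edge_straight: "p \<in> edges M \<Longrightarrow> p \<notin> bedges M \<Longrightarrow> p \<notin> iedges M \<Longrightarrow> p = linepath (p 0) (p 1)"
  using straight_edges by blast

lemma regular_edge:
  assumes "p \<in> edges M"
  shows "regular_path p"
proof -
  consider "p \<in> bedges M" | "p \<in> iedges M" | "p = linepath (p 0) (p 1)"
    using edge_straight[OF assms] by blast
  then show ?thesis
  proof cases
    case 3
    from regular_path_linepath[OF edge_endpoints[OF assms]] show ?thesis unfolding 3[symmetric] .
  qed (use edge_arcs[of p] regular_path_arc regular_curves in blast)+
qed

lemma edge_continuous: "p \<in> edges M \<Longrightarrow> continuous_on S p"
  using regular_edge regular_path_continuous by blast

definition adj :: "(real \<Rightarrow> point) \<Rightarrow> point set set" where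
  "adj p = {T \<in> tris M. p \<in> edges_of M T}"

lemma adj_boundary: "p \<in> boundary_edges G M \<Longrightarrow> adj p = {el1 M p}"
  using adj_boundary' unfolding adj_def by blast

lemma adj_interior: "p \<in> edges M \<Longrightarrow> p \<notin> boundary_edges G M \<Longrightarrow> adj p = {el1 M p, el2 M p}"
  using adj_interior' unfolding adj_def by blast

lemma el1_adj: "p \<in> edges M \<Longrightarrow> el1 M p \<in> adj p"
  using adj_boundary adj_interior by (cases "p \<in> boundary_edges G M") auto

lemma el2_adj: "p \<in> edges M \<Longrightarrow> p \<notin> boundary_edges G M \<Longrightarrow> el2 M p \<in> adj p"
  using adj_interior by auto

lemma closed_edges_of: "closed (\<Union>p\<in>edges_of M T. path_image p)"
  using finite_edges edge_continuous unfolding edges_of_def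
  by (intro closed_UN) (auto simp: path_image_def intro!: compact_imp_closed compact_continuous_image)

lemma open_elem: "open (elem M T)"
  unfolding elem_def by (rule open_inside[OF closed_edges_of])

lemma elem_subset: "T \<in> tris M \<Longrightarrow> elem M T \<subseteq> closure (Om G)"
proof -
  assume "T \<in> tris M"
  then have "closure (elem M T) \<subseteq> (\<Union>T\<in>tris M. closure (elem M T))" by blast
  also have "\<dots> = closure (Om G)" by (rule elems_cover)
  finally show ?thesis using closure_subset by blast
qed

lemma bounded_elem: "T \<in> tris M \<Longrightarrow> bounded (elem M T)"
  using elem_subset bounded_closure[OF bounded_Om] bounded_subset by blast

lemma elem_lmeasurable: "T \<in> tris M \<Longrightarrow> elem M T \<in> lmeasurable"
  using open_elem bounded_elem by (simp add: bounded_set_imp_lmeasurable)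

lemma elem_sets: "elem M T \<in> sets lebesgue"
  using open_elem by auto

text \<open>Defining an element by \<open>inside\<close> gives only that its frontier lies in its
  edges. The converse direction comes from the normals: an inner point of an edge is the limit of
  points of the element along the normal, and the two end points follow by continuity.\<close>

lemma edge_in_closure:
  assumes p: "p \<in> edges M" and T: "T \<in> adj p"
  shows "p ` {0..1} \<subseteq> closure (elem M T)"
proof -
  have "p t \<in> closure (elem M T)" if t: "t \<in> {0<..<1}" for t
  proof -
    note n = bspec[OF bspec[OF normals p] t]
    have "((\<lambda>d. p t - d *\<^sub>R nrml p t) \<longlongrightarrow> p t - 0 *\<^sub>R nrml p t) (at_right 0)"
      "((\<lambda>d. p t + d *\<^sub>R nrml p t) \<longlongrightarrow> p t + 0 *\<^sub>R nrml p t) (at_right 0)"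
      by (intro tendsto_intros)+
    moreover have "(\<forall>\<^sub>F d in at_right 0. p t - d *\<^sub>R nrml p t \<in> closure (elem M T)) \<or>
      (\<forall>\<^sub>F d in at_right 0. p t + d *\<^sub>R nrml p t \<in> closure (elem M T))"
    proof -
      consider "T = el1 M p" | "p \<notin> boundary_edges G M" "T = el2 M p"
        using T adj_boundary[of p] adj_interior[OF p] by auto
      then show ?thesis
      proof cases
        case 1
        then have "\<forall>\<^sub>F d in at_right 0. p t - d *\<^sub>R nrml p t \<in> elem M T" using n by blast
        then show ?thesis by (rule disjI1[OF eventually_mono]) (use closure_subset in blast)
      next
        case 2
        then have "\<forall>\<^sub>F d in at_right 0. p t + d *\<^sub>R nrml p t \<in> elem M T" using n by blast
        then show ?thesis by (rule disjI2[OF eventually_mono]) (use closure_subset in blast)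
      qed
    qed
    ultimately show ?thesis
      using Lim_in_closed_set[OF closed_closure _ trivial_limit_at_right_real] by fastforce
  qed
  then have "p ` closure {0<..<1} \<subseteq> closure (elem M T)"
    using edge_continuous[OF p] by (intro image_closure_subset) auto
  then show ?thesis by simp
qed

lemma elem_nonempty: "p \<in> edges M \<Longrightarrow> T \<in> adj p \<Longrightarrow> elem M T \<noteq> {}"
  using edge_in_closure by force

lemma AE_elem_subdomains:
  assumes "T \<in> tris M"
  shows "AE x in lebesgue_on (elem M T). x \<in> OmM G \<union> OmP G"
proof -
  have neg: "negligible (curve_set (cb G) \<union> curve_set (ci G))"
    using negligible_regular_path_image[OF regular_curves(1)] negligible_regular_path_image[OF regular_curves(2)]
    by (simp add: curve_set_def)
  have "closure (Om G) = Om G \<union> curve_set (cb G)"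
    using closure_Un_frontier[of "Om G"] by (simp add: frontier_Om)
  then have "x \<in> OmM G \<union> OmP G" if "x \<in> elem M T" "x \<notin> curve_set (cb G) \<union> curve_set (ci G)" for x
    using that elem_subset[OF assms] Om_eq by blast
  moreover have "AE x in lebesgue. x \<notin> curve_set (cb G) \<union> curve_set (ci G)"
    using neg by (intro AE_not_in) (simp add: negligible_iff_null_sets)
  ultimately show ?thesis unfolding AE_lebesgue_on_iff[OF elem_sets] by (auto elim: eventually_mono)
qed

section \<open>Coefficient, penalty weights and square integrability on edges\<close>

lemma beta_bounds:
  assumes T: "T \<in> tris M"
  shows "AE x in lebesgue_on (elem M T). blo \<le> \<beta> x \<and> \<beta> x \<le> bhi"
proof -
  have s: "OmM G \<union> OmP G \<in> sets lebesgue" using open_subdomains by auto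
  then have "AE x in lebesgue. x \<in> OmM G \<union> OmP G \<longrightarrow> blo \<le> \<beta> x \<and> \<beta> x \<le> bhi"
    using coeff unfolding coefficient_ok_def AE_lebesgue_on_iff[OF s] by blast
  then show ?thesis
    using AE_elem_subdomains[OF T] unfolding AE_lebesgue_on_iff[OF elem_sets]
    by eventually_elim auto
qed

lemma beta_measurable:
  assumes T: "T \<in> tris M"
  shows "\<beta> \<in> borel_measurable (lebesgue_on (elem M T))"
proof -
  have s: "OmM G \<in> sets lebesgue" "OmP G \<in> sets lebesgue" "OmM G \<inter> OmP G = {}"
    using open_subdomains subdomains_disjoint by auto
  have "\<beta> \<in> borel_measurable (lebesgue_on (OmM G))" "\<beta> \<in> borel_measurable (lebesgue_on (OmP G))"
    using coeff unfolding coefficient_ok_def W1inf_def Linf_def by auto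
  then have "(\<lambda>x. (if x \<in> OmM G then \<beta> x else 0) + (if x \<in> OmP G then \<beta> x else 0)) \<in> borel_measurable lebesgue"
    using s by (intro borel_measurable_add borel_measurable_if_I)
  then have "(\<lambda>x. (if x \<in> OmM G then \<beta> x else 0) + (if x \<in> OmP G then \<beta> x else 0))
      \<in> borel_measurable (lebesgue_on (elem M T))"
    by (rule measurable_restrict_space1)
  then show ?thesis
    by (rule borel_measurable_lebesgue_on_AE[OF _ _ elem_sets])
      (use AE_elem_subdomains[OF T] s(3) in \<open>auto elim!: eventually_mono\<close>)
qed

text \<open>The essential supremum is also compared with \<open>bhi\<close>, to exclude the value
  infinity, which \<open>real_of_ereal\<close> would turn into 0.\<close>

lemma beta_elem_bounds:
  assumes T: "T \<in> tris M" and ne: "elem M T \<noteq> {}"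
  shows "blo \<le> beta_elem M \<beta> T"
proof -
  let ?N = "lebesgue_on (elem M T)"
  let ?e = "esssup ?N (\<lambda>x. ereal (\<beta> x))"
  have meas: "(\<lambda>x. ereal (\<beta> x)) \<in> borel_measurable ?N" using beta_measurable[OF T] by simp
  have "AE x in ?N. ereal (\<beta> x) \<le> ereal bhi"
    using beta_bounds[OF T] by eventually_elim simp
  then have up: "?e \<le> ereal bhi" by (rule esssup_I[OF meas])
  have "AE x in ?N. ereal (\<beta> x) \<le> ?e" by (rule esssup_AE)
  then have "AE x in ?N. ereal blo \<le> ?e"
    using beta_bounds[OF T] by eventually_elim (meson ereal_less_eq(3) order_trans)
  \<comment> \<open>The lower bound does not mention x; it can be read off because a nonempty open
    element is not a null set.\<close>
  moreover have "\<not> (AE x in ?N. False)"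
  proof
    assume "AE x in ?N. False"
    then have "AE x in lebesgue. x \<notin> elem M T" by (simp add: AE_lebesgue_on_iff[OF elem_sets])
    then have "negligible (elem M T)"
      using elem_sets by (simp add: negligible_iff_null_sets AE_iff_null_sets)
    then show False using open_not_negligible[OF open_elem ne] by blast
  qed
  ultimately have "ereal blo \<le> ?e" by (auto elim!: contrapos_np eventually_mono)
  with up show ?thesis unfolding beta_elem_def by (cases ?e) auto
qed

lemma beta_edge_pos:
  assumes p: "p \<in> edges M"
  shows "0 < beta_edge M \<beta> p"
proof -
  have "finite (adj p)" using finite_tris by (simp add: adj_def)
  moreover have "el1 M p \<in> adj p" "el1 M p \<in> tris M" using el1_adj[OF p] by (auto simp: adj_def)
  ultimately have "beta_elem M \<beta> (el1 M p) \<le> beta_edge M \<beta> p"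
    unfolding beta_edge_def adj_def[symmetric] by (intro Max_ge) auto
  moreover have "blo \<le> beta_elem M \<beta> (el1 M p)"
    using beta_elem_bounds \<open>el1 M p \<in> tris M\<close> elem_nonempty[OF p el1_adj[OF p]] by blast
  ultimately show ?thesis using blo by simp
qed

lemma L2_edge_continuous:
  fixes f :: "real \<Rightarrow> real"
  assumes "continuous_on UNIV f"
  shows "f \<in> borel_measurable (lebesgue_on {0..1})" "\<exists>B. AE t in lebesgue_on {0..1}. \<bar>f t\<bar> \<le> B"
proof -
  have c: "continuous_on {0..1} f" using assms continuous_on_subset by blast
  then show "f \<in> borel_measurable (lebesgue_on {0..1})"
    by (intro borel_measurable_lebesgue_on_continuous) auto
  obtain B where "\<And>t. t \<in> {0..1} \<Longrightarrow> \<bar>f t\<bar> \<le> B"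
    using compact_imp_bounded[OF compact_continuous_image[OF c compact_Icc]]
    by (fastforce simp: bounded_iff)
  then show "\<exists>B. AE t in lebesgue_on {0..1}. \<bar>f t\<bar> \<le> B"
    by (intro exI[of _ B] AE_I2) auto
qed

lemma L2_mult_continuous:
  fixes v :: "real \<Rightarrow> real"
  assumes "L2 {0..1} v" "continuous_on UNIV f"
  shows "L2 {0..1} (\<lambda>t. f t * v t)"
  using L2_bounded_mult[OF assms(1)] L2_edge_continuous[OF assms(2)] by blast

lemma speed_continuous: "p \<in> edges M \<Longrightarrow> continuous_on UNIV (\<lambda>t. norm (vd p t))"
  using regular_edge unfolding regular_path_def by (auto intro!: continuous_intros)

lemma edge_integrable:
  assumes p: "p \<in> edges M" and F: "L2 {0..1} F" and H: "L2 {0..1} H"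
  shows "integrable (lebesgue_on {0..1}) (\<lambda>t. F t * H t * norm (vd p t))"
proof -
  have "L2 {0..1} (\<lambda>t. norm (vd p t) * H t)" using H speed_continuous[OF p] by (rule L2_mult_continuous)
  from L2_mult_integrable[OF F this] show ?thesis by (simp add: mult_ac)
qed

lemma L2_const: "L2 {0..1::real} (\<lambda>t. c)"
  by (rule L2_bounded[where B="\<bar>c\<bar>"]) auto

lemma edge_len_pos:
  assumes p: "p \<in> edges M"
  shows "0 < edge_len p"
proof -
  have "continuous_on {0..1} (\<lambda>t. norm (vd p t))"
    using speed_continuous[OF p] continuous_on_subset by blast
  then obtain s where s: "s \<in> {0..1}" "\<And>t. t \<in> {0..1} \<Longrightarrow> norm (vd p s) \<le> norm (vd p t)"
    using continuous_attains_inf[of "{0..1::real}" "\<lambda>t. norm (vd p t)"] by auto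
  have "0 < norm (vd p s)" using regular_edge[OF p] by (simp add: regular_path_def)
  also have "\<dots> = (LINT t|lebesgue_on {0..1::real}. norm (vd p s))"
    by (simp add: measure_restrict_space)
  also have "\<dots> \<le> edge_len p" unfolding edge_len_def edge_int_def
  proof (rule integral_mono_AE)
    show "integrable (lebesgue_on {0..1}) (\<lambda>t. 1 * norm (vd p t))"
      using edge_integrable[OF p L2_const[of 1] L2_const[of 1]] by simp
    show "integrable (lebesgue_on {0..1::real}) (\<lambda>t. norm (vd p s))"
      using L2_const by (intro L2_integrable) auto
  qed (use s in \<open>auto intro!: AE_I2\<close>)
  finally show ?thesis .
qed

lemma pen_pos: "p \<in> edges M \<Longrightarrow> 0 < pen M m \<sigma> \<beta> p"
  using beta_edge_pos edge_len_pos m \<sigma> unfolding pen_def by auto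

lemma L2_jump: "L2 {0..1} (jump G M v p)"
  using L2_lincomb[OF L2_trc L2_trc, where c="-1"] L2_trc unfolding jump_def[abs_def]
  by (cases "p \<in> boundary_edges G M") auto

lemma L2_normal_flux:
  fixes F :: "real \<Rightarrow> point"
  assumes p: "p \<in> edges M" and T: "T \<in> adj p" and F: "\<And>i. L2 {0..1} (\<lambda>t. F t $ i)"
  shows "L2 {0..1} (\<lambda>t. trc (elem M T) p \<beta> t * (F t \<bullet> nrml p t))"
proof -
  have n: "continuous_on UNIV (\<lambda>t. nrml p t $ i)" for i
    using regular_path_nrml[OF regular_edge[OF p]] by (intro continuous_intros)
  have T': "T \<in> tris M" using T by (simp add: adj_def)
  have "L2 {0..1} (\<lambda>t. nrml p t $ 1 * F t $ 1 + 1 * (nrml p t $ 2 * F t $ 2))"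
    by (intro L2_lincomb L2_mult_continuous F n)
  moreover have "(\<lambda>t. F t \<bullet> nrml p t) = (\<lambda>t. nrml p t $ 1 * F t $ 1 + 1 * (nrml p t $ 2 * F t $ 2))"
    by (simp add: inner_vec_def sum_2 mult.commute)
  ultimately have "L2 {0..1} (\<lambda>t. F t \<bullet> nrml p t)" by simp
  moreover have "AE x in lebesgue_on (elem M T). \<bar>\<beta> x\<bar> \<le> bhi"
    using beta_bounds[OF T'] by eventually_elim (use blo in auto)
  then have "AE t in lebesgue_on {0..1}. \<bar>trc (elem M T) p \<beta> t\<bar> \<le> bhi"
    using open_elem bounded_elem[OF T'] edge_in_closure[OF p T] beta_measurable[OF T'] blo
    by (intro trc_bounded) auto
  ultimately show ?thesis
    using L2_trc[of "elem M T" p \<beta>] by (intro L2_bounded_mult) (auto simp: L2_def)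
qed

lemma L2_flux: "p \<in> edges M \<Longrightarrow> T \<in> adj p \<Longrightarrow> L2 {0..1} (flux M \<beta> v T p)"
  unfolding flux_def[abs_def] by (intro L2_normal_flux) (auto intro: L2_trc)

lemma L2_avg_flux:
  assumes "p \<in> edges M"
  shows "L2 {0..1} (avg_flux G M \<beta> v p)"
proof (cases "p \<in> boundary_edges G M")
  case True
  then show ?thesis using L2_flux[OF assms el1_adj[OF assms]] by (simp add: avg_flux_def[abs_def])
next
  case False
  have "L2 {0..1} (\<lambda>t. (0 + 1/2 * flux M \<beta> v (el1 M p) p t) + 1/2 * flux M \<beta> v (el2 M p) p t)"
    using L2_flux[OF assms el1_adj[OF assms]] L2_flux[OF assms el2_adj[OF assms False]]
    by (intro L2_lincomb) auto
  then show ?thesis using False by (simp add: avg_flux_def[abs_def] add_divide_distrib)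
qed

lemma energy_integrable:
  fixes F H :: "point \<Rightarrow> point"
  assumes T: "T \<in> tris M" and F: "\<And>i. L2 (elem M T) (\<lambda>x. F x $ i)" and H: "\<And>i. L2 (elem M T) (\<lambda>x. H x $ i)"
  shows "integrable (lebesgue_on (elem M T)) (\<lambda>x. (\<beta> x *\<^sub>R F x) \<bullet> H x)"
proof -
  have "AE x in lebesgue_on (elem M T). \<bar>\<beta> x\<bar> \<le> bhi"
    using beta_bounds[OF T] by eventually_elim (use blo in auto)
  then have "L2 (elem M T) (\<lambda>x. \<beta> x * F x $ i)" for i
    using F beta_measurable[OF T] by (intro L2_bounded_mult)
  then have "integrable (lebesgue_on (elem M T)) (\<lambda>x. \<beta> x * F x $ 1 * H x $ 1 + \<beta> x * F x $ 2 * H x $ 2)"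
    by (intro Bochner_Integration.integrable_add L2_mult_integrable H)
  then show ?thesis by (simp add: inner_vec_def sum_2)
qed

end

section \<open>Continuity and coercivity\<close>

context dg_mesh
begin

definition grad_form :: "(point \<Rightarrow> real) \<Rightarrow> (point \<Rightarrow> real) \<Rightarrow> real" where
  "grad_form w v = (\<Sum>T\<in>tris M. LINT x|lebesgue_on (elem M T).
     (\<beta> x *\<^sub>R wgrad (elem M T) w x) \<bullet> wgrad (elem M T) v x)"

definition flux_form :: "(point \<Rightarrow> real) \<Rightarrow> (point \<Rightarrow> real) \<Rightarrow> real" where
  "flux_form w v = (\<Sum>p\<in>edges M. edge_int p (\<lambda>t. avg_flux G M \<beta> w p t * jump G M v p t))"

definition jump_form :: "(point \<Rightarrow> real) \<Rightarrow> (point \<Rightarrow> real) \<Rightarrow> real" where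
  "jump_form w v = (\<Sum>p\<in>edges M. pen M m \<sigma> \<beta> p * edge_int p (\<lambda>t. jump G M w p t * jump G M v p t))"

lemma a_h_eq: "a_h G M m \<sigma> \<beta> w v = grad_form w v - flux_form w v - flux_form v w + jump_form w v"
  by (simp add: a_h_def grad_form_def flux_form_def jump_form_def)

lemma energy_sq_eq: "energy_sq M \<beta> v = grad_form v v"
  unfolding energy_sq_def grad_form_def
proof (rule sum.cong[OF refl])
  fix T assume T: "T \<in> tris M"
  let ?g = "wgrad (elem M T) v"
  let ?A = "\<lambda>x. (\<beta> x *\<^sub>R ?g x) \<bullet> ?g x"
  have meas: "?A \<in> borel_measurable (lebesgue_on (elem M T))"
    using energy_integrable[OF T L2_wgrad L2_wgrad] by (rule borel_measurable_integrable)
  have AE: "AE x in lebesgue_on (elem M T). ?A x = (norm (sqrt (\<beta> x) *\<^sub>R ?g x))\<^sup>2"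
    using beta_bounds[OF T]
  proof eventually_elim
    case (elim x)
    then have "(sqrt (\<beta> x))\<^sup>2 = \<beta> x" using blo by simp
    then show ?case by (simp add: power_mult_distrib power2_norm_eq_inner)
  qed
  then show "(LINT x|lebesgue_on (elem M T). (norm (sqrt (\<beta> x) *\<^sub>R ?g x))\<^sup>2) = (LINT x|lebesgue_on (elem M T). ?A x)"
    using meas borel_measurable_lebesgue_on_AE[OF meas AE elem_sets]
    by (intro integral_cong_AE) (auto elim: eventually_mono)
qed

lemma jump_sq_eq: "jump_sq G M m \<sigma> \<beta> v = jump_form v v"
  unfolding jump_sq_def jump_form_def
proof (rule sum.cong[OF refl])
  fix p assume p: "p \<in> edges M"
  have eq: "(sqrt (pen M m \<sigma> \<beta> p) * jump G M v p t)\<^sup>2 * norm (vd p t)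
      = pen M m \<sigma> \<beta> p * (jump G M v p t * jump G M v p t * norm (vd p t))" for t
    using pen_pos[OF p] by (simp add: power_mult_distrib power2_eq_square[of "jump G M v p t"])
  then show "edge_int p (\<lambda>t. (sqrt (pen M m \<sigma> \<beta> p) * jump G M v p t)\<^sup>2)
      = pen M m \<sigma> \<beta> p * edge_int p (\<lambda>t. jump G M v p t * jump G M v p t)"
    by (simp only: edge_int_def eq integral_mult_right_zero)
qed

lemma edge_int_quad:
  assumes p: "p \<in> edges M" and L2: "L2 {0..1} F" "L2 {0..1} H"
  shows "0 \<le> edge_int p (\<lambda>t. (F t)\<^sup>2) + 2 * s * edge_int p (\<lambda>t. F t * H t) + s\<^sup>2 * edge_int p (\<lambda>t. (H t)\<^sup>2)"
  unfolding edge_int_def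
proof (rule integral_quad)
  show "integrable (lebesgue_on {0..1}) (\<lambda>t. (F t)\<^sup>2 * norm (vd p t))"
    "integrable (lebesgue_on {0..1}) (\<lambda>t. (H t)\<^sup>2 * norm (vd p t))"
    "integrable (lebesgue_on {0..1}) (\<lambda>t. F t * H t * norm (vd p t))"
    using edge_integrable[OF p L2(1) L2(1)] edge_integrable[OF p L2(2) L2(2)] edge_integrable[OF p L2]
    by (simp_all add: power2_eq_square)
  have "0 \<le> (F t + s * H t)\<^sup>2 * norm (vd p t)" for t by simp
  moreover have "(F t + s * H t)\<^sup>2 * norm (vd p t) = (F t)\<^sup>2 * norm (vd p t)
      + 2 * s * (F t * H t * norm (vd p t)) + s\<^sup>2 * ((H t)\<^sup>2 * norm (vd p t))" for t
    by (simp add: power2_eq_square algebra_simps)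
  ultimately show "AE t in lebesgue_on {0..1}. 0 \<le> (F t)\<^sup>2 * norm (vd p t)
      + 2 * s * (F t * H t * norm (vd p t)) + s\<^sup>2 * ((H t)\<^sup>2 * norm (vd p t))" by simp
qed

text \<open>Adding the quadratics of all elements or edges before taking the discriminant yields
  Cauchy-Schwarz for integrals and for sums in a single step.\<close>

lemma sum_quad:
  fixes A B C :: "'a \<Rightarrow> real"
  assumes "\<And>i s. i \<in> I \<Longrightarrow> 0 \<le> A i + 2 * s * B i + s\<^sup>2 * C i"
  shows "\<bar>sum B I\<bar> \<le> sqrt (sum A I) * sqrt (sum C I)"
proof (rule quad_nonneg_imp_sq_le)
  fix s
  have "0 \<le> (\<Sum>i\<in>I. A i + 2 * s * B i + s\<^sup>2 * C i)" using assms by (intro sum_nonneg)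
  then show "0 \<le> sum A I + 2 * s * sum B I + s\<^sup>2 * sum C I"
    by (simp add: sum.distrib sum_distrib_left)
qed

lemma grad_form_bound: "\<bar>grad_form w v\<bar> \<le> sqrt (energy_sq M \<beta> w) * sqrt (energy_sq M \<beta> v)"
  unfolding energy_sq_eq unfolding grad_form_def
proof (rule sum_quad, rule integral_quad)
  fix T s assume T: "T \<in> tris M"
  let ?a = "\<lambda>u v x. (\<beta> x *\<^sub>R wgrad (elem M T) u x) \<bullet> wgrad (elem M T) v x"
  show "integrable (lebesgue_on (elem M T)) (?a w w)" "integrable (lebesgue_on (elem M T)) (?a w v)"
    "integrable (lebesgue_on (elem M T)) (?a v v)"
    by (intro energy_integrable[OF T] L2_wgrad)+
  show "AE x in lebesgue_on (elem M T). 0 \<le> ?a w w x + 2 * s * ?a w v x + s\<^sup>2 * ?a v v x"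
    using beta_bounds[OF T]
  proof eventually_elim
    case (elim x)
    let ?z = "wgrad (elem M T) w x + s *\<^sub>R wgrad (elem M T) v x"
    have "0 \<le> \<beta> x * (?z \<bullet> ?z)" using elim blo by (intro mult_nonneg_nonneg) auto
    also have "\<dots> = ?a w w x + 2 * s * ?a w v x + s\<^sup>2 * ?a v v x"
      by (simp add: inner_add inner_commute power2_eq_square algebra_simps)
    finally show ?case .
  qed
qed

text \<open>The penalty weight is distributed as reciprocal square root on the flux and square root
  on the jump, so the product of the two factors is unchanged.\<close>

lemma flux_form_bound: "\<bar>flux_form w v\<bar> \<le> sqrt (flux_sq G M m \<sigma> \<beta> w) * sqrt (jump_sq G M m \<sigma> \<beta> v)"
  unfolding flux_form_def flux_sq_def jump_sq_def
proof (rule sum_quad)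
  fix p s assume p: "p \<in> edges M"
  let ?F = "\<lambda>t. sqrt (1 / pen M m \<sigma> \<beta> p) * avg_flux G M \<beta> w p t"
  let ?H = "\<lambda>t. sqrt (pen M m \<sigma> \<beta> p) * jump G M v p t"
  have F: "L2 {0..1} (\<lambda>t. 0 + sqrt (1 / pen M m \<sigma> \<beta> p) * avg_flux G M \<beta> w p t)"
    by (intro L2_lincomb L2_zero L2_avg_flux p)
  have H: "L2 {0..1} (\<lambda>t. 0 + sqrt (pen M m \<sigma> \<beta> p) * jump G M v p t)"
    by (intro L2_lincomb L2_zero L2_jump)
  have "sqrt (1 / pen M m \<sigma> \<beta> p) * sqrt (pen M m \<sigma> \<beta> p) = 1"
    using pen_pos[OF p] by (simp add: real_sqrt_divide)
  then have eq: "?F t * ?H t = avg_flux G M \<beta> w p t * jump G M v p t" for t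
    by (simp add: mult_ac)
  show "0 \<le> edge_int p (\<lambda>t. (?F t)\<^sup>2) + 2 * s * edge_int p (\<lambda>t. avg_flux G M \<beta> w p t * jump G M v p t)
      + s\<^sup>2 * edge_int p (\<lambda>t. (?H t)\<^sup>2)"
    using edge_int_quad[OF p F H, where s=s] unfolding add_0_left eq .
qed

lemma jump_form_bound: "\<bar>jump_form w v\<bar> \<le> sqrt (jump_sq G M m \<sigma> \<beta> w) * sqrt (jump_sq G M m \<sigma> \<beta> v)"
  unfolding jump_sq_eq unfolding jump_form_def
proof (rule sum_quad)
  fix p s assume p: "p \<in> edges M"
  have "0 \<le> pen M m \<sigma> \<beta> p * (edge_int p (\<lambda>t. (jump G M w p t)\<^sup>2)
      + 2 * s * edge_int p (\<lambda>t. jump G M w p t * jump G M v p t) + s\<^sup>2 * edge_int p (\<lambda>t. (jump G M v p t)\<^sup>2))"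
    using edge_int_quad[OF p L2_jump[where v=w] L2_jump[where v=v], where s=s] pen_pos[OF p] by (intro mult_nonneg_nonneg) auto
  then show "0 \<le> pen M m \<sigma> \<beta> p * edge_int p (\<lambda>t. jump G M w p t * jump G M w p t)
      + 2 * s * (pen M m \<sigma> \<beta> p * edge_int p (\<lambda>t. jump G M w p t * jump G M v p t))
      + s\<^sup>2 * (pen M m \<sigma> \<beta> p * edge_int p (\<lambda>t. jump G M v p t * jump G M v p t))"
    by (simp add: power2_eq_square algebra_simps)
qed

lemma energy_sq_nonneg: "0 \<le> energy_sq M \<beta> v"
  unfolding energy_sq_def by (intro sum_nonneg Bochner_Integration.integral_nonneg) auto

lemma jump_sq_nonneg: "0 \<le> jump_sq G M m \<sigma> \<beta> v"
  unfolding jump_sq_def edge_int_def by (intro sum_nonneg Bochner_Integration.integral_nonneg) auto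

lemma flux_sq_nonneg: "0 \<le> flux_sq G M m \<sigma> \<beta> v"
  unfolding flux_sq_def edge_int_def by (intro sum_nonneg Bochner_Integration.integral_nonneg) auto

lemma hnorm_sq: "(hnorm G M m \<sigma> \<beta> v)\<^sup>2 = energy_sq M \<beta> v + jump_sq G M m \<sigma> \<beta> v"
  using energy_sq_nonneg jump_sq_nonneg by (simp add: hnorm_def)

lemma hnorm3_eq: "hnorm3 G M m \<sigma> \<beta> v = sqrt (energy_sq M \<beta> v + jump_sq G M m \<sigma> \<beta> v + flux_sq G M m \<sigma> \<beta> v)"
  by (simp add: hnorm3_def hnorm_sq)

text \<open>The factor 4 counts the terms of \<open>a_h\<close>. Each flux term pairs the flux of
  one argument with the jump of the other, and the triple norm controls both.\<close>

lemma continuity: "\<bar>a_h G M m \<sigma> \<beta> w v\<bar> \<le> 4 * hnorm3 G M m \<sigma> \<beta> w * hnorm3 G M m \<sigma> \<beta> v"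
proof -
  have le: "sqrt (energy_sq M \<beta> u) \<le> hnorm3 G M m \<sigma> \<beta> u"
    "sqrt (jump_sq G M m \<sigma> \<beta> u) \<le> hnorm3 G M m \<sigma> \<beta> u"
    "sqrt (flux_sq G M m \<sigma> \<beta> u) \<le> hnorm3 G M m \<sigma> \<beta> u" "0 \<le> hnorm3 G M m \<sigma> \<beta> u" for u
    using energy_sq_nonneg[of u] jump_sq_nonneg[of u] flux_sq_nonneg[of u] by (simp_all add: hnorm3_eq)
  have "\<bar>grad_form w v\<bar> \<le> hnorm3 G M m \<sigma> \<beta> w * hnorm3 G M m \<sigma> \<beta> v"
    by (rule order_trans[OF grad_form_bound mult_mono]) (use le energy_sq_nonneg in auto)
  moreover have "\<bar>flux_form w v\<bar> \<le> hnorm3 G M m \<sigma> \<beta> w * hnorm3 G M m \<sigma> \<beta> v"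
    by (rule order_trans[OF flux_form_bound mult_mono]) (use le jump_sq_nonneg in auto)
  moreover have "\<bar>flux_form v w\<bar> \<le> hnorm3 G M m \<sigma> \<beta> v * hnorm3 G M m \<sigma> \<beta> w"
    by (rule order_trans[OF flux_form_bound mult_mono]) (use le jump_sq_nonneg in auto)
  moreover have "\<bar>jump_form w v\<bar> \<le> hnorm3 G M m \<sigma> \<beta> w * hnorm3 G M m \<sigma> \<beta> v"
    by (rule order_trans[OF jump_form_bound mult_mono]) (use le jump_sq_nonneg in auto)
  ultimately show ?thesis unfolding a_h_eq by (simp add: mult.commute[of "hnorm3 G M m \<sigma> \<beta> v"])
qed

text \<open>The inverse inequality absorbs the flux part into the energy; the jump part is only
  enlarged by the factor.\<close>

lemma hnorm3_le:
  assumes "Cit > 0" and it: "flux_sq G M m \<sigma> \<beta> v \<le> Cit / \<sigma> * energy_sq M \<beta> v"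
  shows "hnorm3 G M m \<sigma> \<beta> v \<le> sqrt (1 + Cit / \<sigma>) * hnorm G M m \<sigma> \<beta> v"
proof -
  have "energy_sq M \<beta> v + jump_sq G M m \<sigma> \<beta> v + flux_sq G M m \<sigma> \<beta> v
      \<le> (1 + Cit / \<sigma>) * (energy_sq M \<beta> v + jump_sq G M m \<sigma> \<beta> v)"
    (is "?E + ?J + ?F \<le> (1 + ?c) * (?E + ?J)")
  proof -
    have "0 \<le> ?c * ?J" using assms(1) \<sigma> jump_sq_nonneg[of v] by simp
    moreover have "(1 + c) * (?E + ?J) = ?E + ?J + c * ?E + c * ?J" for c by (simp add: algebra_simps)
    ultimately show ?thesis using it by simp
  qed
  then show ?thesis unfolding hnorm3_eq hnorm_def real_sqrt_mult[symmetric] by (rule real_sqrt_le_mono)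
qed

text \<open>With \<sigma> at least 4 Cit the squared flux part is at most a quarter of the energy E.
  Then \<open>flux_form\<close> is at most half of sqrt E times sqrt J, hence at most (E + J)/4. It
  is subtracted twice, which leaves half of E + J.\<close>

lemma coercivity:
  assumes "Cit > 0" and it: "flux_sq G M m \<sigma> \<beta> v \<le> Cit / \<sigma> * energy_sq M \<beta> v" and pen: "\<sigma> \<ge> 4 * Cit"
  shows "a_h G M m \<sigma> \<beta> v v \<ge> 1/2 * (hnorm G M m \<sigma> \<beta> v)\<^sup>2"
proof -
  let ?E = "energy_sq M \<beta> v" and ?J = "jump_sq G M m \<sigma> \<beta> v"
  have "Cit / \<sigma> \<le> 1 / 4" using pen \<sigma> by (simp add: field_simps)
  then have "Cit / \<sigma> * ?E \<le> 1 / 4 * ?E" by (rule mult_right_mono[OF _ energy_sq_nonneg])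
  then have "sqrt (flux_sq G M m \<sigma> \<beta> v) \<le> sqrt (1 / 4 * ?E)" using it by (intro real_sqrt_le_mono) linarith
  also have "\<dots> = sqrt ?E / 2" by (simp add: real_sqrt_divide)
  finally have "sqrt (flux_sq G M m \<sigma> \<beta> v) * sqrt ?J \<le> sqrt ?E / 2 * sqrt ?J"
    by (rule mult_right_mono) (simp add: jump_sq_nonneg)
  then have "\<bar>flux_form v v\<bar> \<le> (sqrt ?E * sqrt ?J) / 2" using flux_form_bound[of v v] by simp
  moreover have "2 * (sqrt ?E * sqrt ?J) \<le> (sqrt ?E)\<^sup>2 + (sqrt ?J)\<^sup>2"
    using sum_squares_bound[of "sqrt ?E" "sqrt ?J"] by (simp only: mult.assoc)
  moreover have "(sqrt ?E)\<^sup>2 = ?E" "(sqrt ?J)\<^sup>2 = ?J" by (simp_all add: energy_sq_nonneg jump_sq_nonneg)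
  moreover have "1 / 2 * (E + J) \<le> E - F - F + J"
    if "\<bar>F\<bar> \<le> x / 2" "2 * x \<le> E' + J'" "E' = E" "J' = J" for E E' F J J' x :: real
    using that by (auto simp: abs_le_iff)
  ultimately show ?thesis
    unfolding a_h_eq hnorm_sq energy_sq_eq[symmetric] jump_sq_eq[symmetric] by blast
qed

end

section \<open>Linearity of the forms on piecewise smooth functions\<close>

context dg_mesh
begin

text \<open>\<open>V\<close> is a version of \<open>v\<close> with gradient \<open>D\<close>.
  Continuity of both up to the boundary is what identifies the traces of \<open>v\<close> and of its
  gradient, while differentiability is asked only in the open element.\<close>

definition rep :: "point set \<Rightarrow> (point \<Rightarrow> real) \<Rightarrow> (point \<Rightarrow> real) \<Rightarrow> (point \<Rightarrow> point) \<Rightarrow> bool" where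
  "rep T v V D \<longleftrightarrow> continuous_on (closure (elem M T)) V \<and> continuous_on (closure (elem M T)) D \<and>
     (\<forall>x\<in>elem M T. (V has_derivative (\<lambda>h. D x \<bullet> h)) (at x)) \<and>
     (AE x in lebesgue_on (elem M T). v x = V x)"

definition smooth :: "(point \<Rightarrow> real) \<Rightarrow> bool" where
  "smooth v \<longleftrightarrow> (\<forall>T\<in>tris M. \<exists>V D. rep T v V D)"

lemma rep_lincomb:
  assumes u: "rep T u U D" and v: "rep T v V E"
    and w: "AE x in lebesgue_on (elem M T). w x = u x + c * v x"
  shows "rep T w (\<lambda>x. U x + c * V x) (\<lambda>x. D x + c *\<^sub>R E x)"
proof -
  have "((\<lambda>x. U x + c * V x) has_derivative (\<lambda>h. (D x + c *\<^sub>R E x) \<bullet> h)) (at x)" if "x \<in> elem M T" for x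
    using u v that unfolding rep_def
    by (auto intro!: derivative_eq_intros simp: inner_add_left)
  moreover have "AE x in lebesgue_on (elem M T). w x = U x + c * V x"
  proof -
    have "AE x in lebesgue_on (elem M T). u x = U x" "AE x in lebesgue_on (elem M T). v x = V x"
      using u v unfolding rep_def by blast+
    then show ?thesis using w by eventually_elim simp
  qed
  moreover have "continuous_on (closure (elem M T)) (\<lambda>x. U x + c * V x)"
    "continuous_on (closure (elem M T)) (\<lambda>x. D x + c *\<^sub>R E x)"
    using u v unfolding rep_def by (auto intro!: continuous_intros)
  ultimately show ?thesis unfolding rep_def by blast
qed

lemma rep_wgrad:
  assumes T: "T \<in> tris M" and r: "rep T v V D"
  shows "AE x in lebesgue_on (elem M T). wgrad (elem M T) v x = D x"
proof -
  let ?K = "elem M T"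
  have cV: "continuous_on (closure ?K) V" and cD: "continuous_on (closure ?K) D"
    and der: "\<And>x. x \<in> ?K \<Longrightarrow> (V has_derivative (\<lambda>h. D x \<bullet> h)) (at x)"
    and ae: "AE x in lebesgue_on ?K. v x = V x"
    using r unfolding rep_def by blast+
  have cK: "compact (closure ?K)" using bounded_elem[OF T] by (simp add: compact_closure)
  obtain B1 where B1: "\<And>x. x \<in> closure ?K \<Longrightarrow> norm (V x) \<le> B1"
    using compact_imp_bounded[OF compact_continuous_image[OF cV cK]] by (auto simp: bounded_iff)
  obtain B2 where B2: "\<And>x. x \<in> closure ?K \<Longrightarrow> norm (D x) \<le> B2"
    using compact_imp_bounded[OF compact_continuous_image[OF cD cK]] by (auto simp: bounded_iff)
  have "AE x in lebesgue_on ?K. wgrad ?K v x $ i = D x $ i" for i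
  proof -
    have "has_weak_partial ?K i V (\<lambda>x. D x $ i)"
    proof (rule has_weak_partial_C1[OF open_elem bounded_elem[OF T] der])
      show "continuous_on ?K D" using cD closure_subset by (rule continuous_on_subset)
      show "\<bar>V x\<bar> \<le> max B1 B2" "norm (D x) \<le> max B1 B2" if "x \<in> ?K" for x
        using B1[of x] B2[of x] closure_subset[of ?K] that by (auto simp: le_max_iff_disj)
    qed
    then have "has_weak_partial ?K i v (\<lambda>x. D x $ i)"
      by (rule has_weak_partial_cong_AE) (use ae elem_sets in \<open>auto elim: eventually_mono\<close>)
    then show ?thesis by (rule wgrad_unique[OF open_elem])
  qed
  from this[of 1] this[of 2] show ?thesis
    by eventually_elim (simp add: vec_eq_iff forall_2)
qed

lemma adj_tris: "T \<in> adj p \<Longrightarrow> T \<in> tris M"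
  by (simp add: adj_def)

lemma rep_trc:
  assumes p: "p \<in> edges M" and T: "T \<in> adj p" and r: "rep T v V D"
  shows "AE t in lebesgue_on {0..1}. trc (elem M T) p v t = V (p t)"
  using r bounded_elem[OF adj_tris[OF T]] edge_in_closure[OF p T] edge_continuous[OF p] open_elem
  unfolding rep_def by (intro trc_continuous) auto

text \<open>Traces see only means over the element, so agreement almost everywhere of each component
  of \<open>wgrad\<close> with a function continuous on the closure is enough.\<close>

lemma rep_trc_wgrad:
  assumes p: "p \<in> edges M" and T: "T \<in> adj p" and r: "rep T v V D"
  shows "AE t in lebesgue_on {0..1}. (\<chi> i. trc (elem M T) p (\<lambda>x. wgrad (elem M T) v x $ i) t) = D (p t)"
proof -
  have "AE t in lebesgue_on {0..1}. trc (elem M T) p (\<lambda>x. wgrad (elem M T) v x $ i) t = D (p t) $ i" for i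
  proof (rule trc_continuous[OF open_elem bounded_elem[OF adj_tris[OF T]] edge_in_closure[OF p T] edge_continuous[OF p]])
    show "continuous_on (closure (elem M T)) (\<lambda>x. D x $ i)"
      using r unfolding rep_def by (auto intro!: continuous_intros)
    show "AE x in lebesgue_on (elem M T). wgrad (elem M T) v x $ i = D x $ i"
      using rep_wgrad[OF adj_tris[OF T] r] by eventually_elim simp
  qed
  from this[of 1] this[of 2] show ?thesis
    by eventually_elim (simp add: vec_eq_iff forall_2)
qed

text \<open>Only almost everywhere equality is required, so that the case \<open>c = 0\<close> expresses invariance under
  changes on null sets.\<close>

definition lincomb :: "(point \<Rightarrow> real) \<Rightarrow> (point \<Rightarrow> real) \<Rightarrow> real \<Rightarrow> (point \<Rightarrow> real) \<Rightarrow> bool" where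
  "lincomb w u c v \<longleftrightarrow> smooth u \<and> smooth v \<and>
     (\<forall>T\<in>tris M. AE x in lebesgue_on (elem M T). w x = u x + c * v x)"

lemma lincomb_reps:
  assumes l: "lincomb w u c v" and T: "T \<in> tris M"
  obtains U D V E where "rep T u U D" "rep T v V E" "rep T w (\<lambda>x. U x + c * V x) (\<lambda>x. D x + c *\<^sub>R E x)"
proof -
  obtain U D V E where "rep T u U D" "rep T v V E"
    using l T unfolding lincomb_def smooth_def by blast
  moreover from this have "rep T w (\<lambda>x. U x + c * V x) (\<lambda>x. D x + c *\<^sub>R E x)"
    using l T unfolding lincomb_def by (intro rep_lincomb) auto
  ultimately show ?thesis by (rule that)
qed

lemma lincomb_wgrad:
  assumes l: "lincomb w u c v" and T: "T \<in> tris M"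
  shows "AE x in lebesgue_on (elem M T). wgrad (elem M T) w x = wgrad (elem M T) u x + c *\<^sub>R wgrad (elem M T) v x"
proof -
  obtain U D V E where "rep T u U D" "rep T v V E" "rep T w (\<lambda>x. U x + c * V x) (\<lambda>x. D x + c *\<^sub>R E x)"
    by (rule lincomb_reps[OF l T])
  from this[THEN rep_wgrad[OF T]] show ?thesis by eventually_elim simp
qed

lemma lincomb_trc:
  assumes l: "lincomb w u c v" and p: "p \<in> edges M" and T: "T \<in> adj p"
  shows "AE t in lebesgue_on {0..1}. trc (elem M T) p w t = trc (elem M T) p u t + c * trc (elem M T) p v t"
proof -
  obtain U D V E where "rep T u U D" "rep T v V E" "rep T w (\<lambda>x. U x + c * V x) (\<lambda>x. D x + c *\<^sub>R E x)"
    by (rule lincomb_reps[OF l adj_tris[OF T]])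
  from this[THEN rep_trc[OF p T]] show ?thesis by eventually_elim simp
qed

lemma lincomb_flux:
  assumes l: "lincomb w u c v" and p: "p \<in> edges M" and T: "T \<in> adj p"
  shows "AE t in lebesgue_on {0..1}. flux M \<beta> w T p t = flux M \<beta> u T p t + c * flux M \<beta> v T p t"
proof -
  obtain U D V E where "rep T u U D" "rep T v V E" "rep T w (\<lambda>x. U x + c * V x) (\<lambda>x. D x + c *\<^sub>R E x)"
    by (rule lincomb_reps[OF l adj_tris[OF T]])
  from this[THEN rep_trc_wgrad[OF p T]] show ?thesis
    unfolding flux_def by eventually_elim (simp add: inner_add_left algebra_simps)
qed

lemma lincomb_jump:
  assumes l: "lincomb w u c v" and p: "p \<in> edges M"
  shows "AE t in lebesgue_on {0..1}. jump G M w p t = jump G M u p t + c * jump G M v p t"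
proof (cases "p \<in> boundary_edges G M")
  case True
  with lincomb_trc[OF l p el1_adj[OF p]] show ?thesis by (simp add: jump_def)
next
  case False
  from lincomb_trc[OF l p el1_adj[OF p]] lincomb_trc[OF l p el2_adj[OF p False]] show ?thesis
    by eventually_elim (use False in \<open>simp add: jump_def algebra_simps\<close>)
qed

lemma lincomb_avg_flux:
  assumes l: "lincomb w u c v" and p: "p \<in> edges M"
  shows "AE t in lebesgue_on {0..1}. avg_flux G M \<beta> w p t = avg_flux G M \<beta> u p t + c * avg_flux G M \<beta> v p t"
proof (cases "p \<in> boundary_edges G M")
  case True
  with lincomb_flux[OF l p el1_adj[OF p]] show ?thesis by (simp add: avg_flux_def)
next
  case False
  from lincomb_flux[OF l p el1_adj[OF p]] lincomb_flux[OF l p el2_adj[OF p False]] show ?thesis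
    by eventually_elim (use False in \<open>simp add: avg_flux_def field_simps\<close>)
qed

lemma integral_lincomb_AE:
  fixes f g h :: "'a \<Rightarrow> real"
  assumes "integrable N g" "integrable N h" "f \<in> borel_measurable N" "AE x in N. f x = g x + c * h x"
  shows "(LINT x|N. f x) = (LINT x|N. g x) + c * (LINT x|N. h x)"
proof -
  have "(LINT x|N. f x) = (LINT x|N. g x + c * h x)"
    by (rule integral_cong_AE) (use assms in auto)
  then show ?thesis using assms by simp
qed

text \<open>Smoothness concerns only the argument that is decomposed; the other one enters through
  its chosen gradient, which is square integrable in any case.\<close>

lemma grad_form_lin:
  assumes l: "lincomb w u c v"
  shows "grad_form w z = grad_form u z + c * grad_form v z"
proof -
  have "(LINT x|lebesgue_on (elem M T). (\<beta> x *\<^sub>R wgrad (elem M T) w x) \<bullet> wgrad (elem M T) z x)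
    = (LINT x|lebesgue_on (elem M T). (\<beta> x *\<^sub>R wgrad (elem M T) u x) \<bullet> wgrad (elem M T) z x)
      + c * (LINT x|lebesgue_on (elem M T). (\<beta> x *\<^sub>R wgrad (elem M T) v x) \<bullet> wgrad (elem M T) z x)"
    if T: "T \<in> tris M" for T
  proof (rule integral_lincomb_AE)
    show "AE x in lebesgue_on (elem M T). (\<beta> x *\<^sub>R wgrad (elem M T) w x) \<bullet> wgrad (elem M T) z x
      = (\<beta> x *\<^sub>R wgrad (elem M T) u x) \<bullet> wgrad (elem M T) z x
        + c * ((\<beta> x *\<^sub>R wgrad (elem M T) v x) \<bullet> wgrad (elem M T) z x)"
      using lincomb_wgrad[OF l T] by eventually_elim (simp add: inner_add_left algebra_simps)
  qed (intro energy_integrable[OF T] borel_measurable_integrable L2_wgrad)+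
  then show ?thesis by (simp add: grad_form_def sum.distrib sum_distrib_left)
qed

lemma edge_int_lincomb:
  assumes p: "p \<in> edges M" and "L2 {0..1} A" "L2 {0..1} B" "L2 {0..1} C" and D: "L2 {0..1} D"
    and ae: "AE t in lebesgue_on {0..1}. C t = A t + c * B t"
  shows "edge_int p (\<lambda>t. C t * D t) = edge_int p (\<lambda>t. A t * D t) + c * edge_int p (\<lambda>t. B t * D t)"
  unfolding edge_int_def
proof (rule integral_lincomb_AE)
  show "AE t in lebesgue_on {0..1}. C t * D t * norm (vd p t) = A t * D t * norm (vd p t) + c * (B t * D t * norm (vd p t))"
    using ae by eventually_elim (simp add: algebra_simps)
qed (intro edge_integrable[OF p] borel_measurable_integrable assms)+

lemma flux_form_lin:
  assumes l: "lincomb w u c v"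
  shows "flux_form w z = flux_form u z + c * flux_form v z" "flux_form z w = flux_form z u + c * flux_form z v"
proof -
  have "edge_int p (\<lambda>t. avg_flux G M \<beta> w p t * jump G M z p t)
      = edge_int p (\<lambda>t. avg_flux G M \<beta> u p t * jump G M z p t) + c * edge_int p (\<lambda>t. avg_flux G M \<beta> v p t * jump G M z p t)"
    if "p \<in> edges M" for p
    using that by (intro edge_int_lincomb L2_avg_flux L2_jump lincomb_avg_flux[OF l])
  then show "flux_form w z = flux_form u z + c * flux_form v z"
    by (simp add: flux_form_def sum.distrib sum_distrib_left)
  have "edge_int p (\<lambda>t. jump G M w p t * avg_flux G M \<beta> z p t)
      = edge_int p (\<lambda>t. jump G M u p t * avg_flux G M \<beta> z p t) + c * edge_int p (\<lambda>t. jump G M v p t * avg_flux G M \<beta> z p t)"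
    if "p \<in> edges M" for p
    using that by (intro edge_int_lincomb L2_avg_flux L2_jump lincomb_jump[OF l])
  then show "flux_form z w = flux_form z u + c * flux_form z v"
    by (simp add: flux_form_def sum.distrib sum_distrib_left mult.commute[of "avg_flux G M \<beta> z _ _"])
qed

lemma jump_form_lin:
  assumes l: "lincomb w u c v"
  shows "jump_form w z = jump_form u z + c * jump_form v z"
proof -
  have "edge_int p (\<lambda>t. jump G M w p t * jump G M z p t)
      = edge_int p (\<lambda>t. jump G M u p t * jump G M z p t) + c * edge_int p (\<lambda>t. jump G M v p t * jump G M z p t)"
    if "p \<in> edges M" for p
    using that by (intro edge_int_lincomb L2_jump lincomb_jump[OF l])
  then show ?thesis
    by (simp add: jump_form_def sum.distrib sum_distrib_left algebra_simps)
qed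

lemma a_h_lin:
  assumes l: "lincomb w u c v"
  shows "a_h G M m \<sigma> \<beta> w z = a_h G M m \<sigma> \<beta> u z + c * a_h G M m \<sigma> \<beta> v z"
  using grad_form_lin[OF l, of z] flux_form_lin[OF l, of z] jump_form_lin[OF l, of z]
  by (simp add: a_h_eq algebra_simps)

text \<open>The two flux terms change places. Linearity in the second argument is then inherited
  from the first.\<close>

lemma a_h_commute: "a_h G M m \<sigma> \<beta> w v = a_h G M m \<sigma> \<beta> v w"
proof -
  have "grad_form w v = grad_form v w" by (simp add: grad_form_def inner_commute)
  moreover have "jump_form w v = jump_form v w" by (simp add: jump_form_def mult.commute)
  ultimately show ?thesis by (simp add: a_h_eq)
qed

section \<open>From elements to the whole domain\<close>

lemma frontier_elem_subset: "frontier (elem M T) \<subseteq> (\<Union>p\<in>edges_of M T. path_image p)"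
  unfolding elem_def by (rule frontier_inside_subset[OF closed_edges_of])

text \<open>Only the closed elements are known to cover the domain; what they add to the open ones
  lies on finitely many edges, which are null sets.\<close>

lemma AE_Om_elems:
  assumes "\<And>T. T \<in> tris M \<Longrightarrow> AE x in lebesgue_on (elem M T). P x"
  shows "AE x in lebesgue_on (Om G). P x"
proof -
  have "negligible (\<Union>p\<in>edges M. path_image p)"
    using finite_edges negligible_regular_path_image[OF regular_edge]
    by (auto simp: path_image_def intro!: negligible_Union)
  then have "AE x in lebesgue. x \<notin> (\<Union>p\<in>edges M. path_image p)"
    by (intro AE_not_in) (simp add: negligible_iff_null_sets)
  moreover have "AE x in lebesgue. \<forall>T\<in>tris M. x \<in> elem M T \<longrightarrow> P x"
    using assms finite_tris unfolding AE_lebesgue_on_iff[OF elem_sets] by (intro AE_finite_allI)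
  ultimately have "AE x in lebesgue. x \<in> Om G \<longrightarrow> P x"
  proof eventually_elim
    case (elim x)
    show ?case
    proof
      assume "x \<in> Om G"
      then obtain T where T: "T \<in> tris M" "x \<in> closure (elem M T)"
        using elems_cover closure_subset[of "Om G"] by blast
      have "x \<in> elem M T"
      proof (rule ccontr)
        assume "x \<notin> elem M T"
        then have "x \<in> frontier (elem M T)" using T(2) open_elem by (simp add: frontier_def interior_open)
        then show False using frontier_elem_subset elim(1) by (auto simp: edges_of_def)
      qed
      then show "P x" using elim(2) T(1) by blast
    qed
  qed
  moreover have "Om G \<in> sets lebesgue" using open_Om by auto
  ultimately show ?thesis by (simp add: AE_lebesgue_on_iff)
qed

end

section \<open>Boundary data and piecewise constant functions\<close>

lemma L2_real_affine:
  fixes \<phi> :: "real \<Rightarrow> real"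
  assumes \<phi>: "L2 S \<phi>" and S: "S \<in> sets lebesgue" and c: "c \<noteq> 0"
    and R: "R \<in> sets lebesgue" "\<And>t. t \<in> R \<Longrightarrow> a + c * t \<in> S"
  shows "L2 R (\<lambda>t. \<phi> (a + c * t))"
proof -
  define \<psi> where "\<psi> x = (if x \<in> S then \<phi> x else 0)" for x
  have m: "\<psi> \<in> borel_measurable lebesgue"
    using \<phi> S unfolding \<psi>_def[abs_def] L2_def by (intro borel_measurable_if_I) auto
  have aff: "(\<lambda>t. a + c * t) \<in> lebesgue \<rightarrow>\<^sub>M lebesgue"
    using lebesgue_affine_measurable[of "\<lambda>_. c" a] c by (simp add: mult.commute)
  have m': "(\<lambda>t. \<psi> (a + c * t)) \<in> borel_measurable lebesgue"
    using measurable_compose[OF aff m] .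
  have "integrable lebesgue (\<lambda>x. (\<psi> x)\<^sup>2)"
  proof -
    have "integrable lebesgue (\<lambda>x. indicator S x *\<^sub>R (\<phi> x)\<^sup>2)"
      using \<phi> S unfolding L2_def by (simp add: integrable_restrict_space)
    moreover have "(\<lambda>x. indicator S x *\<^sub>R (\<phi> x)\<^sup>2) = (\<lambda>x. (\<psi> x)\<^sup>2)" by (auto simp: \<psi>_def)
    ultimately show ?thesis by simp
  qed
  then have "integrable lebesgue (\<lambda>t. (\<psi> (a + c * t))\<^sup>2)"
    using lebesgue_integrable_real_affine_iff[OF c, of "\<lambda>x. (\<psi> x)\<^sup>2" a] by simp
  then have "L2 UNIV (\<lambda>t. \<psi> (a + c * t))" using m' by (simp add: L2_def lebesgue_on_UNIV_eq)
  then have "L2 R (\<lambda>t. \<psi> (a + c * t))" by (rule L2_subset) (use R in auto)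
  then show ?thesis
    by (rule L2_cong_AE) (use R in \<open>auto intro!: AE_I2 simp: \<psi>_def\<close>)
qed

lemma L2_Un:
  fixes \<phi> :: "'a::euclidean_space \<Rightarrow> real"
  assumes "L2 S \<phi>" "L2 T \<phi>" "S \<in> sets lebesgue" "T \<in> sets lebesgue"
  shows "L2 (S \<union> T) \<phi>"
proof -
  have "set_integrable lebesgue S (\<lambda>x. (\<phi> x)\<^sup>2)" "set_integrable lebesgue T (\<lambda>x. (\<phi> x)\<^sup>2)"
    using assms unfolding L2_def by (simp_all add: integrable_restrict_space set_integrable_def)
  then have "set_integrable lebesgue (S \<union> T) (\<lambda>x. (\<phi> x)\<^sup>2)"
    using assms by (intro set_integrable_Un)
  then have "integrable (lebesgue_on (S \<union> T)) (\<lambda>x. (\<phi> x)\<^sup>2)"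
    using assms by (simp add: integrable_restrict_space set_integrable_def)
  moreover have "\<phi> \<in> borel_measurable (lebesgue_on (S \<union> T))"
  proof (rule borel_measurable_if_D)
    have "L2 (T - S) \<phi>" using assms by (intro L2_subset[OF assms(2)]) auto
    then have "(\<lambda>x. (if x \<in> S then \<phi> x else 0) + (if x \<in> T - S then \<phi> x else 0)) \<in> borel_measurable lebesgue"
      using assms unfolding L2_def by (intro borel_measurable_add borel_measurable_if_I) auto
    moreover have "(\<lambda>x. (if x \<in> S then \<phi> x else 0) + (if x \<in> T - S then \<phi> x else 0))
        = (\<lambda>x. if x \<in> S \<union> T then \<phi> x else 0)" by auto
    ultimately show "(\<lambda>x. if x \<in> S \<union> T then \<phi> x else 0) \<in> borel_measurable lebesgue" by simp
  qed
  ultimately show ?thesis by (simp add: L2_def)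
qed

text \<open>Boundary data are square integrable over one period, but the parameter interval of an
  arc may lie anywhere on the line. Each induction step shifts the interval already covered by one
  period to either side.\<close>

lemma L2_periodic:
  fixes \<phi> :: "real \<Rightarrow> real"
  assumes P: "b - a > 0" and per: "\<And>t. \<phi> (t + (b - a)) = \<phi> t" and base: "L2 {a..b} \<phi>"
  shows "L2 {a - real n * (b - a)..b + real n * (b - a)} \<phi>"
proof (induction n)
  case (Suc n)
  let ?I = "\<lambda>n::nat. {a - real n * (b - a)..b + real n * (b - a)}"
  let ?P = "b - a"
  let ?L = "{a - real (Suc n) * ?P..b + real n * ?P - ?P}"
  let ?R = "{a - real n * ?P + ?P..b + real (Suc n) * ?P}"
  have per': "\<phi> (- ?P + 1 * t) = \<phi> t" for t
    using per[of "- ?P + 1 * t"] by (simp add: algebra_simps)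
  have "L2 ?L (\<lambda>t. \<phi> (?P + 1 * t))"
    by (rule L2_real_affine[OF Suc]) (auto simp: algebra_simps)
  then have L: "L2 ?L \<phi>" using per by (simp add: add.commute)
  have "L2 ?R (\<lambda>t. \<phi> (- ?P + 1 * t))"
    by (rule L2_real_affine[OF Suc]) (auto simp: algebra_simps)
  then have R: "L2 ?R \<phi>" unfolding per' .
  have "L2 ((?L \<union> ?R) \<union> ?I n) \<phi>" by (intro L2_Un L R Suc) auto
  moreover have "?I (Suc n) \<subseteq> (?L \<union> ?R) \<union> ?I n"
  proof -
    have *: "real (Suc n) * ?P = real n * ?P + ?P" "0 \<le> real n * ?P"
      using P by (simp_all add: distrib_right)
    have "{a - (k + ?P)..b + (k + ?P)} \<subseteq> ({a - (k + ?P)..b + k - ?P} \<union> {a - k + ?P..b + (k + ?P)}) \<union> {a - k..b + k}"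
      if "0 \<le> k" for k using that P by auto
    then show ?thesis using *(2) unfolding *(1) by blast
  qed
  ultimately show ?case by (intro L2_subset[where S="?I (Suc n)"]) auto
qed (use base in simp)

context dg_mesh
begin

text \<open>An undesignated edge on the boundary curve would be covered by designated arcs. By
  conformity it meets these only in its end points, so its image would be finite, which contradicts
  connectedness and distinct end points.\<close>

lemma boundary_edges_eq: "boundary_edges G M = bedges M"
proof
  show "bedges M \<subseteq> boundary_edges G M"
    using bedges_subset bedges_cover by (auto simp: boundary_edges_def)
  show "boundary_edges G M \<subseteq> bedges M"
  proof
    fix p assume "p \<in> boundary_edges G M"
    then have p: "p \<in> edges M" "path_image p \<subseteq> curve_set (cb G)" by (auto simp: boundary_edges_def)
    show "p \<in> bedges M"
    proof (rule ccontr)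
      assume np: "p \<notin> bedges M"
      have "path_image p \<subseteq> {p 0, p 1}"
      proof
        fix x assume x: "x \<in> path_image p"
        then obtain q where q: "q \<in> bedges M" "x \<in> path_image q" using p(2) bedges_cover by blast
        then have "p \<noteq> q" "q \<in> edges M" using np bedges_subset by auto
        then show "x \<in> {p 0, p 1}" using bspec[OF bspec[OF conforming p(1)], of q] x q(2) by blast
      qed
      then have "finite (path_image p)" by (rule finite_subset) simp
      moreover have "connected (path_image p)"
        using edge_continuous[OF p(1)] by (intro connected_path_image) (simp add: path_def)
      ultimately have "path_image p = {} \<or> (\<exists>a. path_image p = {a})"
        by (simp add: connected_finite_iff_sing)
      moreover have "p 0 \<in> path_image p" "p 1 \<in> path_image p" by (auto simp: path_image_def)
      ultimately show False using edge_endpoints[OF p(1)] by auto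
    qed
  qed
qed

lemma L2_boundary_data:
  assumes p: "p \<in> boundary_edges G M" and g: "L2_curve (cb G) g"
  shows "L2 {0..1} (\<lambda>t. g (p t))"
proof -
  let ?c = "cb G"
  obtain a b where ab: "a \<noteq> b" "p = (\<lambda>t. par ?c (a + t * (b - a)))"
    using bedges_arcs p unfolding boundary_edges_eq arc_of_def by blast
  have per: "period ?c > 0" "\<And>t. par ?c (t + period ?c) = par ?c t"
    using curves(1) unfolding closed_curve_def by auto
  \<comment> \<open>Bounds the parameters of the arc together with both ends of the base interval,
    so that sufficiently many periods on each side contain the arc.\<close>
  define d where "d = \<bar>a\<bar> + \<bar>b\<bar> + \<bar>lo ?c\<bar> + \<bar>hi ?c\<bar>"
  obtain n where n: "d < real n * period ?c" using per(1) ex_less_of_nat_mult by blast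
  have "L2 {lo ?c - real n * period ?c..hi ?c + real n * period ?c} (\<lambda>t. g (par ?c t))"
    using g per by (intro L2_periodic) (auto simp: L2_curve_def)
  then have "L2 {0..1} (\<lambda>t. g (par ?c (a + (b - a) * t)))"
  proof (rule L2_real_affine)
    fix t :: real assume t: "t \<in> {0..1}"
    have "a + (b - a) * t = (1 - t) * a + t * b" by (simp add: algebra_simps)
    moreover have "\<bar>(1 - t) * a\<bar> \<le> \<bar>a\<bar>" "\<bar>t * b\<bar> \<le> \<bar>b\<bar>"
      using t by (auto simp: abs_mult intro!: mult_left_le_one_le)
    ultimately have "\<bar>a + (b - a) * t\<bar> \<le> \<bar>a\<bar> + \<bar>b\<bar>" by linarith
    then show "a + (b - a) * t \<in> {lo ?c - real n * period ?c..hi ?c + real n * period ?c}"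
      using n unfolding d_def by auto
  qed (use ab in auto)
  then show ?thesis by (simp add: ab(2) mult.commute)
qed

lemma L_h_lin:
  assumes f: "L2 (Om G) f" and g: "L2_curve (cb G) g" and l: "lincomb w u c v"
    and L2: "L2 (Om G) u" "L2 (Om G) v" "L2 (Om G) w"
  shows "L_h G M m \<sigma> \<beta> f g w = L_h G M m \<sigma> \<beta> f g u + c * L_h G M m \<sigma> \<beta> f g v"
proof -
  have "(LINT x|lebesgue_on (Om G). f x * w x) = (LINT x|lebesgue_on (Om G). f x * u x) + c * (LINT x|lebesgue_on (Om G). f x * v x)"
  proof (rule integral_lincomb_AE)
    have "AE x in lebesgue_on (Om G). w x = u x + c * v x"
      using l unfolding lincomb_def by (intro AE_Om_elems) blast
    then show "AE x in lebesgue_on (Om G). f x * w x = f x * u x + c * (f x * v x)"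
      by eventually_elim (simp add: algebra_simps)
  qed (intro L2_mult_integrable borel_measurable_integrable f L2)+
  moreover have "edge_int p (\<lambda>t. g (p t) * (- flux M \<beta> w (el1 M p) p t + pen M m \<sigma> \<beta> p * trc (elem M (el1 M p)) p w t))
     = edge_int p (\<lambda>t. g (p t) * (- flux M \<beta> u (el1 M p) p t + pen M m \<sigma> \<beta> p * trc (elem M (el1 M p)) p u t))
     + c * edge_int p (\<lambda>t. g (p t) * (- flux M \<beta> v (el1 M p) p t + pen M m \<sigma> \<beta> p * trc (elem M (el1 M p)) p v t))"
    if pb: "p \<in> boundary_edges G M" for p
  proof -
    have p: "p \<in> edges M" using pb by (simp add: boundary_edges_def)
    note T = el1_adj[OF p]
    let ?b = "\<lambda>z t. - flux M \<beta> z (el1 M p) p t + pen M m \<sigma> \<beta> p * trc (elem M (el1 M p)) p z t"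
    have L2b: "L2 {0..1} (?b z)" for z
      by (intro L2_lincomb L2_minus L2_flux[OF p T] L2_trc)
    have "AE t in lebesgue_on {0..1}. ?b w t = ?b u t + c * ?b v t"
      using lincomb_flux[OF l p T] lincomb_trc[OF l p T] by eventually_elim (simp add: algebra_simps)
    then have "edge_int p (\<lambda>t. ?b w t * g (p t)) = edge_int p (\<lambda>t. ?b u t * g (p t)) + c * edge_int p (\<lambda>t. ?b v t * g (p t))"
      by (intro edge_int_lincomb[OF p] L2b L2_boundary_data[OF pb g])
    then show ?thesis by (simp only: mult.commute[of "g _"])
  qed
  ultimately show ?thesis
    by (simp add: L_h_def sum.distrib sum_distrib_left algebra_simps)
qed

section \<open>Propagation of constants through the mesh\<close>

lemma Om_diff_finite_meets:
  assumes T: "T \<in> tris M" and ne: "elem M T \<noteq> {}" and E: "finite E"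
  shows "elem M T \<inter> (Om G - E) \<noteq> {}"
proof
  assume e: "elem M T \<inter> (Om G - E) = {}"
  have "elem M T \<inter> closure (Om G) \<noteq> {}" using elem_subset[OF T] ne by blast
  then have ne': "elem M T \<inter> Om G \<noteq> {}" using open_Int_closure_eq_empty[OF open_elem] by blast
  have "elem M T \<inter> Om G \<subseteq> E" using e by blast
  then have "finite (elem M T \<inter> Om G)" using E finite_subset by blast
  moreover have "open (elem M T \<inter> Om G)" using open_elem open_Om by blast
  ultimately show False using ne' finite_imp_not_open by blast
qed

text \<open>The open elements are disjoint, so a common point of their closures lies on both
  frontiers and hence on an edge of each. Distinct edges meet only in end points, which are
  excluded.\<close>

lemma closures_share_edge:
  assumes T: "T \<in> tris M" "T' \<in> tris M" "T \<noteq> T'"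
    and x: "x \<in> closure (elem M T)" "x \<in> closure (elem M T')" "\<And>p. p \<in> edges M \<Longrightarrow> x \<noteq> p 0 \<and> x \<noteq> p 1"
  shows "\<exists>p\<in>edges M. T \<in> adj p \<and> T' \<in> adj p"
proof -
  have e: "\<exists>p\<in>edges_of M S. x \<in> path_image p"
    if S: "S \<in> tris M" "S' \<in> tris M" "S \<noteq> S'" "x \<in> closure (elem M S)" "x \<in> closure (elem M S')" for S S'
  proof -
    have "elem M S \<inter> elem M S' = {}" using elems_disjoint S(1-3) by blast
    then have "x \<notin> elem M S" using open_Int_closure_eq_empty[OF open_elem] S(5) by blast
    then have "x \<in> frontier (elem M S)" using S(4) open_elem by (simp add: frontier_def interior_open)
    then show ?thesis using frontier_elem_subset by blast
  qed
  obtain p where p: "p \<in> edges_of M T" "x \<in> path_image p" using e[OF T x(1,2)] by blast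
  obtain q where q: "q \<in> edges_of M T'" "x \<in> path_image q" using e[OF T(2,1) T(3)[symmetric] x(2,1)] by blast
  have pq: "p \<in> edges M" "q \<in> edges M" using p q by (auto simp: edges_of_def)
  have "p = q"
  proof (rule ccontr)
    assume "p \<noteq> q"
    then have "x \<in> {p 0, p 1}" using bspec[OF bspec[OF conforming pq(1)] pq(2)] p(2) q(2) by blast
    then show False using x(3)[OF pq(1)] by blast
  qed
  then show ?thesis using p q pq T by (auto simp: adj_def)
qed

text \<open>Instead of a chain of neighbours, the argument takes the union of the closed elements
  with value zero and the union of the others. Away from the vertices, where elements may touch
  without sharing an edge, these two closed sets would disconnect the domain.\<close>

lemma elementwise_constant_eq_0:
  assumes k: "\<And>p T T'. p \<in> edges M \<Longrightarrow> T \<in> adj p \<Longrightarrow> T' \<in> adj p \<Longrightarrow> k T = k T'"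
    and kb: "\<And>p. p \<in> boundary_edges G M \<Longrightarrow> k (el1 M p) = 0"
    and T1: "T1 \<in> tris M" "elem M T1 \<noteq> {}"
  shows "k T1 = (0::real)"
proof (rule ccontr)
  assume k1: "k T1 \<noteq> 0"
  define E where "E = (\<Union>p\<in>edges M. {p 0, p 1})"
  have E: "finite E" using finite_edges by (simp add: E_def)
  define A where "A = (\<Union>T\<in>{T\<in>tris M. k T = 0}. closure (elem M T))"
  define B where "B = (\<Union>T\<in>{T\<in>tris M. k T \<noteq> 0}. closure (elem M T))"
  have "curve_set (cb G) \<noteq> {}" using curves(1) by (auto simp: curve_set_def closed_curve_def)
  then obtain p where p: "p \<in> boundary_edges G M" using bedges_cover boundary_edges_eq by blast
  then have pe: "p \<in> edges M" by (simp add: boundary_edges_def)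
  let ?T0 = "el1 M p"
  have T0: "?T0 \<in> tris M" "elem M ?T0 \<noteq> {}" using adj_tris elem_nonempty pe el1_adj by blast+
  have "connected (Om G - E)"
    using open_Om connected_Om E by (intro connected_open_diff_countable) (auto simp: countable_finite)
  moreover have "closed A" "closed B" using finite_tris by (auto simp: A_def B_def)
  moreover have "Om G - E \<subseteq> A \<union> B"
  proof
    fix x assume "x \<in> Om G - E"
    then obtain T where "T \<in> tris M" "x \<in> closure (elem M T)"
      using elems_cover closure_subset[of "Om G"] by blast
    then show "x \<in> A \<union> B" by (cases "k T = 0") (auto simp: A_def B_def)
  qed
  moreover have "A \<inter> B \<inter> (Om G - E) = {}"
  proof (rule ccontr)
    assume "A \<inter> B \<inter> (Om G - E) \<noteq> {}"
    then obtain x T T' where x: "T \<in> tris M" "k T = 0" "T' \<in> tris M" "k T' \<noteq> 0"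
      "x \<in> closure (elem M T)" "x \<in> closure (elem M T')" "x \<notin> E" unfolding A_def B_def by blast
    then have "\<exists>p\<in>edges M. T \<in> adj p \<and> T' \<in> adj p"
      by (intro closures_share_edge[of T T' x]) (auto simp: E_def)
    then show False using k[of _ T T'] x(2,4) by auto
  qed
  moreover have "A \<inter> (Om G - E) \<noteq> {}"
    using Om_diff_finite_meets[OF T0 E] T0(1) kb[OF p] closure_subset[of "elem M ?T0"] unfolding A_def by blast
  moreover have "B \<inter> (Om G - E) \<noteq> {}"
    using Om_diff_finite_meets[OF T1 E] T1(1) k1 closure_subset[of "elem M T1"] unfolding B_def by blast
  ultimately show False unfolding connected_closed by blast
qed

text \<open>Every jump is a constant along its edge, so the jump norm is a sum of squares with
  positive weights and each jump vanishes.\<close>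

lemma elementwise_constant_jump_zero:
  assumes r: "\<And>T. T \<in> tris M \<Longrightarrow> rep T v (\<lambda>x. k T) (\<lambda>x. 0)" and j: "jump_sq G M m \<sigma> \<beta> v = 0"
  shows "AE x in lebesgue_on (Om G). v x = 0"
proof -
  have tr: "AE t in lebesgue_on {0..1}. trc (elem M T) p v t = k T" if "p \<in> edges M" "T \<in> adj p" for p T
    using rep_trc[OF that r[OF adj_tris[OF that(2)]]] .
  define J where "J p = (if p \<in> boundary_edges G M then k (el1 M p) else k (el1 M p) - k (el2 M p))" for p
  have jmp: "AE t in lebesgue_on {0..1}. jump G M v p t = J p" if p: "p \<in> edges M" for p
  proof (cases "p \<in> boundary_edges G M")
    case True
    then show ?thesis using tr[OF p el1_adj[OF p]] by (simp add: jump_def J_def)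
  next
    case False
    from tr[OF p el1_adj[OF p]] tr[OF p el2_adj[OF p False]] show ?thesis
      by eventually_elim (use False in \<open>simp add: jump_def J_def\<close>)
  qed
  have ei: "edge_int p (\<lambda>t. jump G M v p t * jump G M v p t) = (J p)\<^sup>2 * edge_len p" if p: "p \<in> edges M" for p
  proof -
    have "edge_int p (\<lambda>t. jump G M v p t * jump G M v p t) = (LINT t|lebesgue_on {0..1}. (J p)\<^sup>2 * norm (vd p t))"
      unfolding edge_int_def
    proof (rule integral_cong_AE)
      show "(\<lambda>t. jump G M v p t * jump G M v p t * norm (vd p t)) \<in> borel_measurable (lebesgue_on {0..1})"
        by (intro borel_measurable_integrable edge_integrable[OF p] L2_jump)
      show "(\<lambda>t. (J p)\<^sup>2 * norm (vd p t)) \<in> borel_measurable (lebesgue_on {0..1})"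
        using L2_edge_continuous(1)[OF speed_continuous[OF p]] by simp
      show "AE t in lebesgue_on {0..1}. jump G M v p t * jump G M v p t * norm (vd p t) = (J p)\<^sup>2 * norm (vd p t)"
        using jmp[OF p] by eventually_elim (simp add: power2_eq_square)
    qed
    then show ?thesis by (simp add: edge_len_def edge_int_def)
  qed
  have "(\<Sum>p\<in>edges M. pen M m \<sigma> \<beta> p * ((J p)\<^sup>2 * edge_len p)) = 0"
    using j ei by (simp add: jump_sq_eq jump_form_def)
  moreover have nn: "0 \<le> pen M m \<sigma> \<beta> p * ((J p)\<^sup>2 * edge_len p)" if "p \<in> edges M" for p
    using pen_pos[OF that] edge_len_pos[OF that] by simp
  ultimately have "\<forall>p\<in>edges M. pen M m \<sigma> \<beta> p * ((J p)\<^sup>2 * edge_len p) = 0"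
    using sum_nonneg_eq_0_iff[OF finite_edges nn] by simp
  then have J: "J p = 0" if "p \<in> edges M" for p
    using pen_pos[OF that] edge_len_pos[OF that] that by auto
  have kb: "k (el1 M p) = 0" if "p \<in> boundary_edges G M" for p
    using J[of p] that by (simp add: J_def boundary_edges_def)
  have k: "k T = k T'" if p: "p \<in> edges M" "T \<in> adj p" "T' \<in> adj p" for p T T'
  proof (cases "p \<in> boundary_edges G M")
    case True
    then show ?thesis using adj_boundary p by auto
  next
    case False
    then have "k (el1 M p) = k (el2 M p)" using J[OF p(1)] by (simp add: J_def)
    then show ?thesis using adj_interior[OF p(1) False] p by auto
  qed
  show ?thesis
  proof (rule AE_Om_elems)
    fix T assume T: "T \<in> tris M"
    show "AE x in lebesgue_on (elem M T). v x = 0"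
    proof (cases "elem M T = {}")
      case True
      then show ?thesis by (auto intro: AE_I2)
    next
      case False
      have "k T = 0" using k kb T False by (rule elementwise_constant_eq_0)
      then show ?thesis using r[OF T] by (simp add: rep_def)
    qed
  qed
qed

end

section \<open>Mapped polynomials\<close>

lemma linear_functional_eq_inner:
  fixes f :: "point \<Rightarrow> real"
  assumes "linear f"
  shows "f h = (\<chi> i. f (axis i 1)) \<bullet> h"
proof -
  interpret linear f by fact
  have "h = h $ 1 *\<^sub>R axis 1 1 + h $ 2 *\<^sub>R axis 2 1"
    by (simp add: vec_eq_iff forall_2 axis_def)
  then have "f h = f (h $ 1 *\<^sub>R axis 1 1 + h $ 2 *\<^sub>R axis 2 1)" by simp
  also have "\<dots> = h $ 1 * f (axis 1 1) + h $ 2 * f (axis 2 1)" by (simp add: add scale)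
  finally show ?thesis by (simp add: inner_vec_def sum_2 mult.commute)
qed

lemma real_polynomial_function_C1:
  fixes q :: "point \<Rightarrow> real"
  assumes "real_polynomial_function q"
  shows "\<exists>D. (\<forall>y. (q has_derivative (\<lambda>h. D y \<bullet> h)) (at y)) \<and> continuous_on UNIV D"
  using assms
proof induction
  case (linear f)
  have "(f has_derivative (\<lambda>h. (\<chi> i. f (axis i 1)) \<bullet> h)) (at y)" for y
    using bounded_linear_imp_has_derivative[OF linear]
      linear_functional_eq_inner[OF bounded_linear.linear[OF linear], symmetric] by simp
  then show ?case by (intro exI[of _ "\<lambda>y. \<chi> i. f (axis i 1)"]) auto
next
  case (const c)
  show ?case by (intro exI[of _ "\<lambda>y. 0"]) auto
next
  case (add f g)
  then obtain D E where "\<And>y. (f has_derivative (\<lambda>h. D y \<bullet> h)) (at y)" "continuous_on UNIV D"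
    "\<And>y. (g has_derivative (\<lambda>h. E y \<bullet> h)) (at y)" "continuous_on UNIV E" by blast
  then show ?case
    by (intro exI[of _ "\<lambda>y. D y + E y"]) (auto intro!: derivative_eq_intros continuous_intros simp: inner_add_left)
next
  case (mult f g)
  then obtain D E where D: "\<And>y. (f has_derivative (\<lambda>h. D y \<bullet> h)) (at y)" "continuous_on UNIV D"
    "\<And>y. (g has_derivative (\<lambda>h. E y \<bullet> h)) (at y)" "continuous_on UNIV E" by blast
  have "continuous_on UNIV f" "continuous_on UNIV g"
    using D(1,3) by (auto simp: continuous_on_eq_continuous_at intro: has_derivative_continuous)
  with D show ?case
    by (intro exI[of _ "\<lambda>y. f y *\<^sub>R E y + g y *\<^sub>R D y"])
      (auto intro!: derivative_eq_intros continuous_intros simp: inner_add_left)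
qed

lemma poly2_real_polynomial_function:
  assumes "q \<in> poly2 m"
  shows "real_polynomial_function q"
proof -
  obtain a where q: "q = (\<lambda>y. \<Sum>(i, j)\<in>{(i, j). i + j \<le> m}. a i j * (y $ 1) ^ i * (y $ 2) ^ j)"
    using assms by (auto simp: poly2_def)
  have fin: "finite {p. fst p + snd p \<le> m}"
    by (rule finite_subset[of _ "{..m} \<times> {..m}"]) auto
  have lin: "real_polynomial_function (\<lambda>y::point. y $ i)" for i
    by (intro real_polynomial_function.intros(1) bounded_linear_vec_nth)
  show ?thesis unfolding q case_prod_beta
    by (intro real_polynomial_function_sum fin real_polynomial_function.intros(4)
        real_polynomial_function.intros(2) real_polynomial_function_power lin)
qed

text \<open>Along the line from \<open>y0\<close> to an arbitrary point the polynomial becomes one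
  in a single variable that takes the value c infinitely often.\<close>

lemma real_polynomial_function_const_on_open:
  fixes q :: "point \<Rightarrow> real"
  assumes q: "real_polynomial_function q" and S: "open S" "y0 \<in> S" "\<And>y. y \<in> S \<Longrightarrow> q y = c"
  shows "q y = c"
proof -
  let ?l = "\<lambda>t::real. y0 + t *\<^sub>R (y - y0)"
  have "polynomial_function (\<lambda>t. y0 + t *\<^sub>R (y - y0))"
    by (intro polynomial_function_add polynomial_function_mult polynomial_function_id polynomial_function_const)
  then have "real_polynomial_function (q \<circ> ?l)" using q by (intro real_polynomial_function_compose)
  then obtain a n where an: "\<And>t. q (?l t) = (\<Sum>i\<le>n. a i * t ^ i)"
    using real_polynomial_function_imp_sum[of "q \<circ> ?l"] by (auto simp: fun_eq_iff o_def)
  obtain r where r: "r > 0" "ball y0 r \<subseteq> S" using S openE by blast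
  \<comment> \<open>Parameters below d keep the line inside the ball of radius r; adding 1 guards
    against y = y0.\<close>
  define d where "d = r / (norm (y - y0) + 1)"
  have n1: "0 < norm (y - y0) + 1" using norm_ge_zero[of "y - y0"] by linarith
  have d: "d > 0" using r n1 by (simp add: d_def)
  have "q (?l t) = c" if "t \<in> {0<..<d}" for t
  proof -
    have "\<bar>t\<bar> * norm (y - y0) \<le> \<bar>t\<bar> * (norm (y - y0) + 1)" by (simp add: mult_left_mono)
    also have "\<dots> < d * (norm (y - y0) + 1)" using that n1 by (intro mult_strict_right_mono) auto
    also have "\<dots> = r" using n1 by (simp add: d_def)
    finally have "?l t \<in> ball y0 r" by (simp add: dist_norm)
    then show ?thesis using r S(3) by blast
  qed
  then have sub: "{0<..<d} \<subseteq> {t. (\<Sum>i\<le>n. (if i = 0 then a 0 - c else a i) * t ^ i) = 0}"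
  proof -
    have "(\<Sum>i\<le>n. (if i = 0 then a 0 - c else a i) * t ^ i) = (\<Sum>i\<le>n. a i * t ^ i) - c" for t
    proof -
      have "(\<Sum>i\<le>n. (if i = 0 then a 0 - c else a i) * t ^ i) = (\<Sum>i\<le>n. a i * t ^ i - (if i = 0 then c else 0))"
        by (intro sum.cong) auto
      then show ?thesis by (simp add: sum_subtractf)
    qed
    then show ?thesis using \<open>\<And>t. t \<in> {0<..<d} \<Longrightarrow> q (?l t) = c\<close> an by auto
  qed
  have "infinite {0<..<d}" using d by simp
  then have "\<not> finite {t. (\<Sum>i\<le>n. (if i = 0 then a 0 - c else a i) * t ^ i) = 0}"
    using sub finite_subset by blast
  then have z: "\<And>i. i \<le> n \<Longrightarrow> (if i = 0 then a 0 - c else a i) = 0"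
    using polyfun_finite_roots[of "\<lambda>i. if i = 0 then a 0 - c else a i" n] by blast
  have "q (?l 1) = (\<Sum>i\<le>n. a i * 1 ^ i)" by (rule an)
  also have "\<dots> = (\<Sum>i\<le>n. if i = 0 then c else 0)"
  proof (rule sum.cong[OF refl])
    fix i assume "i \<in> {..n}"
    then show "a i * 1 ^ i = (if i = 0 then c else 0)" using z[of i] by (cases "i = 0") auto
  qed
  finally show ?thesis by simp
qed

section \<open>Differentiability of the inverse Frenet map\<close>

lemma vd_shift:
  assumes "\<And>t. p (t + c) = p t" and d: "\<And>t. (p has_vector_derivative vd p t) (at t)"
  shows "vd p (t + c) = vd p t"
proof -
  have "((\<lambda>t. t + c) has_vector_derivative 1) (at t)" by (auto intro!: derivative_eq_intros)
  from vector_diff_chain_at[OF this d] have "((\<lambda>t. p (t + c)) has_vector_derivative vd p (t + c)) (at t)"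
    by (simp add: o_def)
  then have "(p has_vector_derivative vd p (t + c)) (at t)" by (simp add: assms(1))
  then show ?thesis by (rule vd_eqI[symmetric])
qed

locale smooth_closed_curve =
  fixes c :: curve
  assumes closed: "closed_curve 2 c"
begin

abbreviation "g \<equiv> par c"

lemma period_pos: "period c > 0" and periodic: "g (t + period c) = g t"
  using closed by (auto simp: closed_curve_def)

lemma velocity: "(g has_vector_derivative vd g t) (at t)" "continuous_on UNIV (vd g)" "vd g t \<noteq> 0"
  using closed Ck_pathD[of 2 g] unfolding closed_curve_def by auto

lemma acceleration: "(vd g has_vector_derivative vd (vd g) t) (at t)" "continuous_on UNIV (vd (vd g))"
proof -
  have C: "Ck_path 2 g" using closed unfolding closed_curve_def by blast
  have "((vd ^^ 1) g) differentiable (at t)"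
    using C unfolding Ck_path_def by (metis one_less_numeral_iff semiring_norm(76))
  then have d: "vd g differentiable (at t)" by simp
  show "(vd g has_vector_derivative vd (vd g) t) (at t)"
    using d unfolding vd_def[of "vd g"] by (rule vector_derivative_works[THEN iffD1])
  have "continuous_on UNIV ((vd ^^ 2) g)" using C unfolding Ck_path_def by blast
  then show "continuous_on UNIV (vd (vd g))" by (simp add: numeral_2_eq_2)
qed

text \<open>The derivative of the unit normal, by the quotient rule for the normalised velocity;
  \<open>sgn (vd g t)\<close> is the unit tangent.\<close>

definition dnrml :: "real \<Rightarrow> point" where
  "dnrml t = Qm *v ((1 / norm (vd g t)) *\<^sub>R vd (vd g) t
     - ((sgn (vd g t) \<bullet> vd (vd g) t) / (norm (vd g t))\<^sup>2) *\<^sub>R vd g t)"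

lemma nrml_derivative: "(nrml g has_vector_derivative dnrml t) (at t)"
proof -
  have "((\<lambda>t. norm (vd g t)) has_derivative (\<lambda>h. (h *\<^sub>R vd (vd g) t) \<bullet> sgn (vd g t))) (at t)"
    by (rule has_derivative_compose[OF acceleration(1)[unfolded has_vector_derivative_def]
          has_derivative_norm[OF velocity(3)]])
  then have "((\<lambda>t. norm (vd g t)) has_real_derivative (vd (vd g) t \<bullet> sgn (vd g t))) (at t)"
    by (simp add: has_field_derivative_def mult.commute[of _ "vd (vd g) t \<bullet> sgn (vd g t)"])
  then have "((\<lambda>t. norm (vd g t)) has_real_derivative (sgn (vd g t) \<bullet> vd (vd g) t)) (at t)"
    by (simp only: inner_commute)
  then have "((\<lambda>t. 1 / norm (vd g t)) has_real_derivative (- (sgn (vd g t) \<bullet> vd (vd g) t) / (norm (vd g t))\<^sup>2)) (at t)"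
    using velocity(3)[of t] by (auto intro!: derivative_eq_intros simp: power2_eq_square)
  from has_vector_derivative_scaleR[OF this acceleration(1)]
  have "((\<lambda>t. (1 / norm (vd g t)) *\<^sub>R vd g t) has_vector_derivative
      ((1 / norm (vd g t)) *\<^sub>R vd (vd g) t + (- (sgn (vd g t) \<bullet> vd (vd g) t) / (norm (vd g t))\<^sup>2) *\<^sub>R vd g t)) (at t)" .
  from bounded_linear.has_vector_derivative[OF matrix_vector_mul_bounded_linear[of Qm] this]
  show ?thesis unfolding nrml_def[abs_def] dnrml_def by simp
qed

lemma continuous_dnrml: "continuous_on UNIV dnrml"
proof -
  have "continuous_on UNIV (\<lambda>t. sgn (vd g t))"
    using velocity(2,3) by (intro continuous_on_sgn) auto
  then have "continuous_on UNIV (\<lambda>t. (1 / norm (vd g t)) *\<^sub>R vd (vd g) t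
     - ((sgn (vd g t) \<bullet> vd (vd g) t) / (norm (vd g t))\<^sup>2) *\<^sub>R vd g t)"
    using velocity(2,3) acceleration(2) by (intro continuous_intros) auto
  then show ?thesis unfolding dnrml_def[abs_def]
    by (rule bounded_linear.continuous_on[OF matrix_vector_mul_bounded_linear])
qed

text \<open>\<open>fcol1\<close> and \<open>fcol2\<close> are the columns of the Jacobian matrix of
  the Frenet map, the derivatives in \<eta> and \<xi>, and \<open>fdet\<close> is its
  determinant.\<close>

definition fcol1 :: "point \<Rightarrow> point" where "fcol1 y = nrml g (y $ 2)"
definition fcol2 :: "point \<Rightarrow> point" where "fcol2 y = vd g (y $ 2) + y $ 1 *\<^sub>R dnrml (y $ 2)"
definition fdet :: "point \<Rightarrow> real" where "fdet y = fcol1 y $ 1 * fcol2 y $ 2 - fcol2 y $ 1 * fcol1 y $ 2"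

lemma continuous_fcols: "continuous_on UNIV fcol1" "continuous_on UNIV fcol2"
proof -
  have "regular_path g" by (rule regular_path_curve[OF closed]) simp
  from regular_path_nrml[OF this] show "continuous_on UNIV fcol1"
    unfolding fcol1_def[abs_def] by (rule continuous_on_compose2) (auto intro!: continuous_intros)
  have "continuous_on UNIV (\<lambda>y::point. vd g (y $ 2))" "continuous_on UNIV (\<lambda>y::point. dnrml (y $ 2))"
    by (rule continuous_on_compose2[OF velocity(2)] continuous_on_compose2[OF continuous_dnrml];
        auto intro!: continuous_intros)+
  then show "continuous_on UNIV fcol2"
    unfolding fcol2_def[abs_def] by (intro continuous_intros)
qed

lemma frenet_derivative: "(frenet c has_derivative (\<lambda>h. h $ 1 *\<^sub>R fcol1 y + h $ 2 *\<^sub>R fcol2 y)) (at y)"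
proof -
  have 2: "((\<lambda>y::point. y $ i) has_derivative (\<lambda>h. h $ i)) (at y)" for i
    by (rule bounded_linear_imp_has_derivative[OF bounded_linear_vec_nth])
  have a: "((\<lambda>y. g (y $ 2)) has_derivative (\<lambda>h. h $ 2 *\<^sub>R vd g (y $ 2))) (at y)"
    by (rule has_derivative_compose[OF 2 velocity(1)[unfolded has_vector_derivative_def]])
  have b: "((\<lambda>y. nrml g (y $ 2)) has_derivative (\<lambda>h. h $ 2 *\<^sub>R dnrml (y $ 2))) (at y)"
    by (rule has_derivative_compose[OF 2 nrml_derivative[unfolded has_vector_derivative_def]])
  have "((\<lambda>y. g (y $ 2) + y $ 1 *\<^sub>R nrml g (y $ 2)) has_derivative
     (\<lambda>h. h $ 2 *\<^sub>R vd g (y $ 2) + (y $ 1 *\<^sub>R (h $ 2 *\<^sub>R dnrml (y $ 2)) + h $ 1 *\<^sub>R nrml g (y $ 2)))) (at y)"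
    by (intro has_derivative_add a has_derivative_scaleR 2 b)
  moreover have "(\<lambda>h::point. h $ 2 *\<^sub>R vd g (y $ 2) + (y $ 1 *\<^sub>R (h $ 2 *\<^sub>R dnrml (y $ 2)) + h $ 1 *\<^sub>R nrml g (y $ 2)))
     = (\<lambda>h. h $ 1 *\<^sub>R fcol1 y + h $ 2 *\<^sub>R fcol2 y)"
    by (simp add: fcol1_def fcol2_def algebra_simps fun_eq_iff)
  ultimately show ?thesis unfolding frenet_def[abs_def] by simp
qed

lemma det_frenet_jac: "det (frenet_jac c y) = fdet y"
proof -
  have "frechet_derivative (frenet c) (at y) = (\<lambda>h. h $ 1 *\<^sub>R fcol1 y + h $ 2 *\<^sub>R fcol2 y)"
    using frechet_derivative_at[OF frenet_derivative] by simp
  then show ?thesis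
    by (simp add: frenet_jac_def det_2 matrix_def fdet_def axis_def)
qed

lemma shift_periods: "g (t + real_of_int k * period c) = g t"
proof (induction k rule: int_induct[where k=0])
  case (step1 i)
  then show ?case using periodic[of "t + real_of_int i * period c"] by (simp add: algebra_simps)
next
  case (step2 i)
  then show ?case using periodic[of "t + real_of_int (i - 1) * period c"] by (simp add: algebra_simps)
qed simp

text \<open>\<open>frenet_regular\<close> controls the determinant over one period of \<xi> only,
  while a continuous branch may cross the seam. Shifting by whole periods changes neither the
  velocity nor the acceleration, hence not the determinant.\<close>

lemma fdet_nonzero:
  assumes reg: "frenet_regular c \<epsilon>" and y: "\<bar>y $ 1\<bar> \<le> \<epsilon>"
  shows "fdet y \<noteq> 0"
proof -
  define k where "k = \<lfloor>(y $ 2 - lo c) / period c\<rfloor>"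
  let ?s = "real_of_int (- k) * period c"
  define y' :: point where "y' = (\<chi> i. if i = 1 then y $ 1 else y $ 2 + ?s)"
  have "real_of_int k \<le> (y $ 2 - lo c) / period c" "(y $ 2 - lo c) / period c < real_of_int k + 1"
    by (auto simp: k_def)
  then have "real_of_int k * period c \<le> y $ 2 - lo c" "y $ 2 - lo c < (real_of_int k + 1) * period c"
    using period_pos by (auto simp: le_divide_eq divide_less_eq)
  then have y': "y' $ 1 \<in> {-\<epsilon>..\<epsilon>}" "y' $ 2 \<in> {lo c..hi c}" using y by (auto simp: y'_def algebra_simps)
  have v1: "vd g (t + ?s) = vd g t" for t
    by (rule vd_shift[OF shift_periods velocity(1)])
  have v2: "vd (vd g) (t + ?s) = vd (vd g) t" for t
    by (rule vd_shift[OF v1 acceleration(1)])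
  have "y' $ 1 = y $ 1" "y' $ 2 = y $ 2 + ?s" by (simp_all add: y'_def)
  then have "fdet y' = fdet y"
    by (simp only: fdet_def fcol1_def fcol2_def nrml_def dnrml_def v1 v2)
  moreover have "fdet y' \<noteq> 0"
  proof -
    have "\<exists>c1>0. \<exists>c2. \<forall>y. y $ 1 \<in> {-\<epsilon>..\<epsilon>} \<and> y $ 2 \<in> {lo c..hi c} \<longrightarrow>
        (let J = frenet_jac c y; J' = matrix_inv J in
           c1 \<le> \<bar>det J\<bar> \<and> \<bar>det J\<bar> \<le> c2 \<and> c1 \<le> \<bar>det J'\<bar> \<and> \<bar>det J'\<bar> \<le> c2 \<and>
           onorm ((*v) J) \<le> c2 \<and> onorm ((*v) J') \<le> c2)"
      using reg unfolding frenet_regular_def by (elim conjE)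
    then obtain c1 where "c1 > 0" "c1 \<le> \<bar>det (frenet_jac c y')\<bar>" using y' by (auto simp: Let_def)
    then show ?thesis by (auto simp: det_frenet_jac)
  qed
  ultimately show ?thesis by simp
qed

text \<open>Cramer's rule for the inverse of the Jacobian matrix, applied to
  \<open>k\<close>.\<close>

definition finv :: "point \<Rightarrow> point \<Rightarrow> point" where
  "finv y k = (\<chi> i. if i = 1 then (k $ 1 * fcol2 y $ 2 - k $ 2 * fcol2 y $ 1) / fdet y
                   else (fcol1 y $ 1 * k $ 2 - fcol1 y $ 2 * k $ 1) / fdet y)"

lemma linear_finv: "linear (finv y)"
  by (rule linearI) (auto simp: finv_def vec_eq_iff algebra_simps add_divide_distrib diff_divide_distrib)

lemma finv_inverse:
  assumes "fdet y \<noteq> 0"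
  shows "finv y (h $ 1 *\<^sub>R fcol1 y + h $ 2 *\<^sub>R fcol2 y) = h"
proof -
  have "((h $ 1 * fcol1 y $ 1 + h $ 2 * fcol2 y $ 1) * fcol2 y $ 2 - (h $ 1 * fcol1 y $ 2 + h $ 2 * fcol2 y $ 2) * fcol2 y $ 1)
      = h $ 1 * fdet y"
    by (simp add: fdet_def algebra_simps)
  moreover have "fcol1 y $ 1 * (h $ 1 * fcol1 y $ 2 + h $ 2 * fcol2 y $ 2) - fcol1 y $ 2 * (h $ 1 * fcol1 y $ 1 + h $ 2 * fcol2 y $ 1)
      = h $ 2 * fdet y"
    by (simp add: fdet_def algebra_simps)
  ultimately show ?thesis using assms by (simp add: finv_def vec_eq_iff forall_2)
qed

text \<open>A continuous right inverse of a differentiable map with invertible derivative is itself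
  differentiable; continuity is all that a mesh provides for its branch.\<close>

lemma inverse_branch_derivative:
  assumes B: "continuous_on S B" "\<And>x. x \<in> S \<Longrightarrow> frenet c (B x) = x" and S: "open S" "x \<in> S"
    and d: "fdet (B x) \<noteq> 0"
  shows "(B has_derivative finv (B x)) (at x)"
proof (rule has_derivative_inverse_basic[OF frenet_derivative])
  show "bounded_linear (finv (B x))" using linear_finv linear_conv_bounded_linear by blast
  show "finv (B x) \<circ> (\<lambda>h. h $ 1 *\<^sub>R fcol1 (B x) + h $ 2 *\<^sub>R fcol2 (B x)) = id"
    using finv_inverse[OF d] by (simp add: fun_eq_iff)
  show "continuous (at x) B" using B(1) S by (simp add: continuous_on_eq_continuous_at)
qed (use B S in auto)

text \<open>The formula depends on the branch but not on derivatives of the branch, so it makes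
  sense and is continuous up to the boundary of an element.\<close>

lemma continuous_finv:
  assumes B: "continuous_on S B" and d: "\<And>x. x \<in> S \<Longrightarrow> fdet (B x) \<noteq> 0"
  shows "continuous_on S (\<lambda>x. finv (B x) k)"
proof -
  have c: "continuous_on S (\<lambda>x. fcol1 (B x))" "continuous_on S (\<lambda>x. fcol2 (B x))"
    using continuous_on_compose2[OF continuous_fcols(1) B] continuous_on_compose2[OF continuous_fcols(2) B] by auto
  then have "continuous_on S (\<lambda>x. fdet (B x))" unfolding fdet_def by (intro continuous_intros)
  then have "continuous_on S (\<lambda>x. finv (B x) k $ i)" for i
    using c d unfolding finv_def by (cases "i = 1") (auto intro!: continuous_intros)
  then have "continuous_on S (\<lambda>x. \<chi> i. finv (B x) k $ i)" by (rule continuous_on_vec_lambda)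
  then show ?thesis by simp
qed

end

section \<open>Element charts and mapped polynomials\<close>

context dg_mesh
begin

definition chart :: "point set \<Rightarrow> point \<Rightarrow> point" where
  "chart T x = (if curved M T then branch M T x else x)"

lemma Sloc_chart: "v \<in> Sloc k M T \<longleftrightarrow> (\<exists>q\<in>poly2 k. AE x in lebesgue_on (elem M T). v x = q (chart T x))"
  by (simp add: Sloc_def chart_def)

lemma continuous_chart: "T \<in> tris M \<Longrightarrow> continuous_on (closure (elem M T)) (chart T)"
  using branches unfolding chart_def[abs_def] by (cases "curved M T") auto

text \<open>On a curved element the Frenet map recovers the point from its coordinates. Injectivity
  is what invariance of domain will require.\<close>

lemma inj_on_chart: "T \<in> tris M \<Longrightarrow> inj_on (chart T) (closure (elem M T))"
  using branches unfolding chart_def[abs_def] inj_on_def by (cases "curved M T") (auto, metis)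

lemma chart_derivative:
  assumes T: "T \<in> tris M"
  obtains B' where "\<And>x. x \<in> elem M T \<Longrightarrow> (chart T has_derivative B' x) (at x)"
    "\<And>k. continuous_on (closure (elem M T)) (\<lambda>x. B' x k)"
proof (cases "curved M T")
  case False
  then have "chart T = (\<lambda>x. x)" by (simp add: chart_def fun_eq_iff)
  then show ?thesis by (intro that[of "\<lambda>x h. h"]) auto
next
  case True
  let ?K = "elem M T"
  let ?c = "assoc_curve G M T"
  have c: "smooth_closed_curve ?c" using curves by (simp add: smooth_closed_curve_def assoc_curve_def)
  interpret smooth_closed_curve ?c by (rule c)
  have reg: "frenet_regular ?c \<epsilon>" using frenet_regular_all eps by (auto simp: assoc_curve_def)
  have B: "chart T = branch M T" using True by (simp add: chart_def fun_eq_iff)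
  have br: "continuous_on (closure ?K) (branch M T)" "\<And>x. x \<in> closure ?K \<Longrightarrow> \<bar>branch M T x $ 1\<bar> \<le> \<epsilon>"
    "\<And>x. x \<in> closure ?K \<Longrightarrow> frenet ?c (branch M T x) = x"
    using branches T True by blast+
  have d: "fdet (branch M T x) \<noteq> 0" if "x \<in> closure ?K" for x
    using fdet_nonzero[OF reg br(2)[OF that]] .
  show ?thesis
  proof (rule that[of "\<lambda>x. finv (branch M T x)"])
    show "continuous_on (closure ?K) (\<lambda>x. finv (branch M T x) k)" for k
      by (rule continuous_finv[OF br(1) d])
    fix x assume x: "x \<in> ?K"
    then have xc: "x \<in> closure ?K" using closure_subset by blast
    show "(chart T has_derivative finv (branch M T x)) (at x)"
      unfolding B
    proof (rule inverse_branch_derivative[of ?K])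
      show "continuous_on ?K (branch M T)" using br(1) closure_subset by (rule continuous_on_subset)
      show "frenet ?c (branch M T z) = z" if "z \<in> ?K" for z using br(3) that closure_subset by blast
    qed (use x open_elem d[OF xc] in auto)
  qed
qed

lemma chart_polynomial_rep:
  assumes T: "T \<in> tris M" and q: "real_polynomial_function q"
    and v: "AE x in lebesgue_on (elem M T). v x = q (chart T x)"
  shows "\<exists>D. rep T v (\<lambda>x. q (chart T x)) D"
proof -
  let ?K = "elem M T"
  obtain Dq where Dq: "\<And>y. (q has_derivative (\<lambda>h. Dq y \<bullet> h)) (at y)" "continuous_on UNIV Dq"
    using real_polynomial_function_C1[OF q] by blast
  obtain B' where B': "\<And>x. x \<in> ?K \<Longrightarrow> (chart T has_derivative B' x) (at x)"
    "\<And>k. continuous_on (closure ?K) (\<lambda>x. B' x k)"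
    by (rule chart_derivative[OF T]) blast
  define D where "D x = (\<chi> i. Dq (chart T x) \<bullet> B' x (axis i 1))" for x
  have "continuous_on UNIV q"
    using Dq(1) by (auto simp: continuous_on_eq_continuous_at intro: has_derivative_continuous)
  then have "continuous_on (closure ?K) (\<lambda>x. q (chart T x))"
    using continuous_on_compose2[OF _ continuous_chart[OF T]] by blast
  moreover have "continuous_on (closure ?K) (\<lambda>x. Dq (chart T x))"
    using continuous_on_compose2[OF Dq(2) continuous_chart[OF T]] by blast
  then have "continuous_on (closure ?K) D"
    unfolding D_def by (intro continuous_on_vec_lambda continuous_intros B'(2))
  moreover have "((\<lambda>x. q (chart T x)) has_derivative (\<lambda>h. D x \<bullet> h)) (at x)" if x: "x \<in> ?K" for x
  proof -
    have d: "((\<lambda>x. q (chart T x)) has_derivative (\<lambda>h. Dq (chart T x) \<bullet> B' x h)) (at x)"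
      by (rule has_derivative_compose[OF B'(1)[OF x] Dq(1)])
    moreover have "Dq (chart T x) \<bullet> B' x h = D x \<bullet> h" for h
      unfolding D_def by (rule linear_functional_eq_inner[OF has_derivative_linear[OF d]])
    ultimately show ?thesis by simp
  qed
  ultimately show ?thesis using v unfolding rep_def by blast
qed

lemma Sloc_smooth:
  assumes "\<And>T. T \<in> tris M \<Longrightarrow> v \<in> Sloc k M T"
  shows "smooth v"
  unfolding smooth_def
proof
  fix T assume T: "T \<in> tris M"
  then obtain q where q: "q \<in> poly2 k" "AE x in lebesgue_on (elem M T). v x = q (chart T x)"
    using assms[OF T] unfolding Sloc_chart by blast
  then show "\<exists>V D. rep T v V D"
    using chart_polynomial_rep[OF T poly2_real_polynomial_function] by blast
qed

text \<open>A single ball suffices, although the element may a priori have several components: the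
  polynomial is constant on the chart image of the ball, this image is open by invariance of domain,
  and so the polynomial is constant everywhere.\<close>

lemma Sloc_gradient_zero_imp_constant:
  assumes T: "T \<in> tris M" and q: "real_polynomial_function q"
    and v: "AE x in lebesgue_on (elem M T). v x = q (chart T x)"
    and z: "AE x in lebesgue_on (elem M T). wgrad (elem M T) v x = 0"
  shows "\<exists>k. rep T v (\<lambda>x. k) (\<lambda>x. 0)"
proof (cases "elem M T = {}")
  case True
  then have "AE x in lebesgue_on (elem M T). v x = 0" by (intro AE_I2) simp
  then show ?thesis using True by (intro exI[of _ 0]) (simp add: rep_def)
next
  case False
  let ?K = "elem M T"
  obtain D where r: "rep T v (\<lambda>x. q (chart T x)) D" using chart_polynomial_rep[OF T q v] by blast
  have D0: "D x = 0" if x: "x \<in> ?K" for x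
  proof (rule ccontr)
    assume nz: "D x \<noteq> 0"
    have cD: "continuous_on ?K D"
    proof (rule continuous_on_subset[OF _ closure_subset])
      show "continuous_on (closure ?K) D" using r unfolding rep_def by blast
    qed
    let ?W = "{x \<in> ?K. D x \<in> - {0}}"
    have "?W = ?K \<inter> D -` (- {0})" by auto
    then have W: "open ?W" using continuous_open_preimage[OF cD open_elem open_Compl[OF closed_singleton]] by simp
    have "AE x in lebesgue_on ?K. D x = 0"
      using rep_wgrad[OF T r] z by eventually_elim simp
    then have "AE x in lebesgue. x \<notin> ?W"
      unfolding AE_lebesgue_on_iff[OF elem_sets] by eventually_elim auto
    then have "negligible ?W"
      using W by (simp add: negligible_iff_null_sets AE_iff_null_sets)
    then show False using open_not_negligible[OF W] x nz by auto
  qed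
  obtain z where zK: "z \<in> ?K" using False by blast
  obtain r0 where b: "r0 > 0" "ball z r0 \<subseteq> ?K" by (rule openE[OF open_elem zK])
  have "\<exists>k. \<forall>x\<in>ball z r0. q (chart T x) = k"
  proof (rule has_derivative_zero_constant)
    fix x assume "x \<in> ball z r0"
    then have x: "x \<in> ?K" using b by blast
    then have "((\<lambda>x. q (chart T x)) has_derivative (\<lambda>h. D x \<bullet> h)) (at x)"
      using r unfolding rep_def by blast
    then show "((\<lambda>x. q (chart T x)) has_derivative (\<lambda>h. 0)) (at x within ball z r0)"
      by (simp add: D0[OF x] has_derivative_at_withinI)
  qed simp
  then obtain k where k: "\<And>x. x \<in> ball z r0 \<Longrightarrow> q (chart T x) = k" by blast
  have sub: "ball z r0 \<subseteq> closure ?K" using b closure_subset by blast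
  have op: "open (chart T ` ball z r0)"
    by (rule invariance_of_domain)
      (use continuous_on_subset[OF continuous_chart[OF T] sub] inj_on_subset[OF inj_on_chart[OF T] sub] in auto)
  have zb: "chart T z \<in> chart T ` ball z r0" using b(1) by simp
  have qk: "q y = k" if "y \<in> chart T ` ball z r0" for y using that k by blast
  have "q y = k" for y by (rule real_polynomial_function_const_on_open[OF q op zb qk])
  then show ?thesis using v by (intro exI[of _ k]) (simp add: rep_def)
qed

end

section \<open>The discrete problem\<close>

definition linear_functional_on :: "('a \<Rightarrow> real) set \<Rightarrow> (('a \<Rightarrow> real) \<Rightarrow> real) \<Rightarrow> bool" where
  "linear_functional_on S F \<longleftrightarrow> (\<forall>u\<in>S. \<forall>v\<in>S. \<forall>c. F (\<lambda>x. u x + c * v x) = F u + c * F v)"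

lemma linear_functional_onD:
  "linear_functional_on S F \<Longrightarrow> u \<in> S \<Longrightarrow> v \<in> S \<Longrightarrow> F (\<lambda>x. u x + c * v x) = F u + c * F v"
  unfolding linear_functional_on_def by blast

text \<open>A bare set of functions with linear operations. Neither a basis nor finite dimension is
  available, since discrete functions may be altered on null sets.\<close>

locale function_subspace =
  fixes S :: "('a \<Rightarrow> real) set"
  assumes zero: "(\<lambda>x. 0) \<in> S" and comb: "u \<in> S \<Longrightarrow> v \<in> S \<Longrightarrow> (\<lambda>x. u x + c * v x) \<in> S"
begin

lemma functional_zero: "linear_functional_on S F \<Longrightarrow> F (\<lambda>x. 0) = 0"
  using linear_functional_onD[OF _ zero zero, of F 1] by simp

lemma functional_sum:
  assumes F: "linear_functional_on S F" and fin: "finite I" and \<phi>: "\<And>i. i \<in> I \<Longrightarrow> \<phi> i \<in> S"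
  shows "(\<lambda>x. \<Sum>i\<in>I. c i * \<phi> i x) \<in> S \<and> F (\<lambda>x. \<Sum>i\<in>I. c i * \<phi> i x) = (\<Sum>i\<in>I. c i * F (\<phi> i))"
  using fin \<phi>
proof (induction I rule: finite_induct)
  case empty
  then show ?case using zero functional_zero[OF F] by simp
next
  case (insert k I)
  have "(\<lambda>x. \<Sum>i\<in>insert k I. c i * \<phi> i x) = (\<lambda>x. (\<Sum>i\<in>I. c i * \<phi> i x) + c k * \<phi> k x)"
    using insert.hyps by (simp add: add.commute)
  moreover have "(\<lambda>x. (\<Sum>i\<in>I. c i * \<phi> i x) + c k * \<phi> k x) \<in> S"
    using insert by (intro comb) auto
  moreover have "F (\<lambda>x. (\<Sum>i\<in>I. c i * \<phi> i x) + c k * \<phi> k x) = (\<Sum>i\<in>I. c i * F (\<phi> i)) + c k * F (\<phi> k)"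
    using insert linear_functional_onD[OF F, of "\<lambda>x. \<Sum>i\<in>I. c i * \<phi> i x" "\<phi> k" "c k"] by auto
  ultimately show ?case using insert.hyps by simp
qed

text \<open>The last clause says that the solution lies in the span of the \<open>\<phi> i\<close>; it makes the
  induction on \<open>I\<close> (one Gram--Schmidt step for each new element) go through.\<close>

lemma galerkin_solvable:
  assumes sym: "\<And>u v. u \<in> S \<Longrightarrow> v \<in> S \<Longrightarrow> B u v = B v u"
    and lin: "\<And>v. v \<in> S \<Longrightarrow> linear_functional_on S (B v)"
    and pos: "\<And>v. v \<in> S \<Longrightarrow> 0 \<le> B v v"
    and fin: "finite I" and \<phi>: "\<And>i. i \<in> I \<Longrightarrow> \<phi> i \<in> S"
    and L: "linear_functional_on S L" "\<And>v. v \<in> S \<Longrightarrow> B v v = 0 \<Longrightarrow> L v = 0"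
  shows "\<exists>u\<in>S. (\<forall>i\<in>I. B u (\<phi> i) = L (\<phi> i)) \<and>
    (\<forall>F. linear_functional_on S F \<longrightarrow> (\<forall>i\<in>I. F (\<phi> i) = 0) \<longrightarrow> F u = 0)"
  using fin \<phi> L
proof (induction I arbitrary: L rule: finite_induct)
  case empty
  then show ?case using zero functional_zero by (intro bexI[of _ "\<lambda>x. 0"]) auto
next
  case (insert k I)
  \<comment> \<open>By Cauchy-Schwarz a function of zero energy is orthogonal to all others. This is
    the compatibility condition that lets the induction hypothesis be used for
    \<open>B (\<phi> k)\<close>.\<close>
  have null: "B v w = 0" if v: "v \<in> S" "B v v = 0" and w: "w \<in> S" for v w
  proof -
    have "0 \<le> B w w + 2 * t * B v w + t\<^sup>2 * B v v" for t
    proof -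
      let ?z = "\<lambda>x. w x + t * v x"
      have z: "?z \<in> S" using v w by (intro comb)
      have "B ?z ?z = B ?z w + t * B ?z v" by (rule linear_functional_onD[OF lin[OF z] w v(1)])
      also have "B ?z w = B w w + t * B w v"
        using sym[OF z w] linear_functional_onD[OF lin[OF w] w v(1)] by simp
      also have "B ?z v = B v w + t * B v v"
        using sym[OF z v(1)] linear_functional_onD[OF lin[OF v(1)] w v(1)] by simp
      finally show ?thesis using pos[OF z] sym[OF w v(1)] by (simp add: power2_eq_square algebra_simps)
    qed
    from quad_nonneg_imp_sq_le[OF this] show ?thesis using v by simp
  qed
  have k: "\<phi> k \<in> S" using insert by simp
  \<comment> \<open>The solution for the functional \<open>B (\<phi> k)\<close> is an orthogonal
    projection of the new element onto the span of the earlier ones.\<close>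
  have "\<exists>u\<in>S. (\<forall>i\<in>I. B u (\<phi> i) = B (\<phi> k) (\<phi> i)) \<and>
    (\<forall>F. linear_functional_on S F \<longrightarrow> (\<forall>i\<in>I. F (\<phi> i) = 0) \<longrightarrow> F u = 0)"
    using insert.prems(1) lin[OF k] null[OF _ _ k] sym k by (intro insert.IH) auto
  then obtain d where d: "d \<in> S" "\<And>i. i \<in> I \<Longrightarrow> B d (\<phi> i) = B (\<phi> k) (\<phi> i)"
    "\<And>F. linear_functional_on S F \<Longrightarrow> (\<And>i. i \<in> I \<Longrightarrow> F (\<phi> i) = 0) \<Longrightarrow> F d = 0" by blast
  have "\<exists>u\<in>S. (\<forall>i\<in>I. B u (\<phi> i) = L (\<phi> i)) \<and>
    (\<forall>F. linear_functional_on S F \<longrightarrow> (\<forall>i\<in>I. F (\<phi> i) = 0) \<longrightarrow> F u = 0)"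
    using insert.prems by (intro insert.IH) auto
  then obtain u0 where u0: "u0 \<in> S" "\<And>i. i \<in> I \<Longrightarrow> B u0 (\<phi> i) = L (\<phi> i)"
    "\<And>F. linear_functional_on S F \<Longrightarrow> (\<And>i. i \<in> I \<Longrightarrow> F (\<phi> i) = 0) \<Longrightarrow> F u0 = 0" by blast
  \<comment> \<open>The component orthogonal to the earlier elements; adding a multiple of it
    preserves the equations already solved.\<close>
  define \<psi> where "\<psi> = (\<lambda>x. \<phi> k x + (- 1) * d x)"
  have \<psi>: "\<psi> \<in> S" unfolding \<psi>_def by (rule comb[OF k d(1)])
  have F\<psi>: "F \<psi> = F (\<phi> k) - F d" if "linear_functional_on S F" for F
    using linear_functional_onD[OF that k d(1), of "-1"] by (simp add: \<psi>_def)
  have \<psi>I: "B \<psi> (\<phi> i) = 0" if i: "i \<in> I" for i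
  proof -
    have iS: "\<phi> i \<in> S" using insert.prems(1) i by simp
    have "B \<psi> (\<phi> i) = B (\<phi> i) (\<phi> k) - B (\<phi> i) d" using F\<psi>[OF lin[OF iS]] sym[OF \<psi> iS] by simp
    then show ?thesis using d(2)[OF i] sym[OF iS k] sym[OF iS d(1)] by simp
  qed
  have \<psi>d: "B \<psi> d = 0" using d(3)[OF lin[OF \<psi>]] \<psi>I by blast
  have \<psi>u: "B \<psi> u0 = 0" using u0(3)[OF lin[OF \<psi>]] \<psi>I by blast
  have \<psi>\<psi>: "B \<psi> \<psi> = B \<psi> (\<phi> k)" using F\<psi>[OF lin[OF \<psi>]] \<psi>d by simp
  define t where "t = (L (\<phi> k) - B u0 (\<phi> k)) / B \<psi> (\<phi> k)"
  let ?u = "\<lambda>x. u0 x + t * \<psi> x"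
  have u: "?u \<in> S" using u0(1) \<psi> by (rule comb)
  have Bu: "B ?u v = B u0 v + t * B \<psi> v" if v: "v \<in> S" for v
    using linear_functional_onD[OF lin[OF v] u0(1) \<psi>, of t] sym[OF u v] sym[OF u0(1) v] sym[OF \<psi> v] by simp
  have "B ?u (\<phi> k) = L (\<phi> k)"
  proof (cases "B \<psi> (\<phi> k) = 0")
    case False
    have "B ?u (\<phi> k) = B u0 (\<phi> k) + t * B \<psi> (\<phi> k)" by (rule Bu[OF k])
    also have "\<dots> = L (\<phi> k)" using False by (simp add: t_def)
    finally show ?thesis .
  next
    case True
    \<comment> \<open>Here \<psi> has zero energy, so \<open>L\<close> cannot distinguish the new
      element from its projection d. As d lies in the span, \<open>B u0\<close> and \<open>L\<close>
      agree on it, and u0 already satisfies the new equation.\<close>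
    have Lk: "L (\<phi> k) = L d"
      using insert.prems(3)[OF \<psi>] \<psi>\<psi> True F\<psi>[OF insert.prems(2)] by simp
    have "linear_functional_on S (\<lambda>v. B u0 v - L v)"
      using lin[OF u0(1)] insert.prems(2) unfolding linear_functional_on_def by (simp add: algebra_simps)
    from d(3)[OF this] have "B u0 d = L d" using u0(2) by simp
    moreover have "B u0 \<psi> = B u0 (\<phi> k) - B u0 d" by (rule F\<psi>[OF lin[OF u0(1)]])
    ultimately show ?thesis using \<psi>u sym[OF \<psi> u0(1)] True Lk by (simp add: Bu[OF k])
  qed
  moreover have "B ?u (\<phi> i) = L (\<phi> i)" if "i \<in> I" for i
    using Bu[of "\<phi> i"] u0(2)[OF that] \<psi>I[OF that] insert.prems(1)[of i] that by simp
  moreover have "F ?u = 0" if F: "linear_functional_on S F" "\<forall>i\<in>insert k I. F (\<phi> i) = 0" for F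
    using linear_functional_onD[OF F(1) u0(1) \<psi>, of t] F\<psi>[OF F(1)] u0(3)[OF F(1)] d(3)[OF F(1)] F(2) by simp
  ultimately show ?case using u by (intro bexI[of _ ?u]) auto
qed

end

section \<open>A finite family that spans the discrete space up to null sets\<close>

lemma finite_degrees: "finite {(i, j). i + j \<le> (m::nat)}"
  by (rule finite_subset[of _ "{..m} \<times> {..m}"]) auto

lemma poly2_lincomb:
  assumes "p \<in> poly2 m" "q \<in> poly2 m"
  shows "(\<lambda>y. p y + c * q y) \<in> poly2 m"
proof -
  obtain a b where ab: "p = (\<lambda>y. \<Sum>(i, j)\<in>{(i, j). i + j \<le> m}. a i j * (y $ 1) ^ i * (y $ 2) ^ j)"
    "q = (\<lambda>y. \<Sum>(i, j)\<in>{(i, j). i + j \<le> m}. b i j * (y $ 1) ^ i * (y $ 2) ^ j)"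
    using assms by (auto simp: poly2_def)
  have "(\<lambda>y. p y + c * q y) = (\<lambda>y. \<Sum>(i, j)\<in>{(i, j). i + j \<le> m}. (a i j + c * b i j) * (y $ 1) ^ i * (y $ 2) ^ j)"
    by (simp add: ab sum_distrib_left sum.distrib[symmetric] case_prod_beta algebra_simps)
  then show ?thesis unfolding poly2_def by (intro CollectI exI[of _ "\<lambda>i j. a i j + c * b i j"])
qed

lemma poly2_zero: "(\<lambda>y. 0) \<in> poly2 m"
  unfolding poly2_def by (intro CollectI exI[of _ "\<lambda>i j. 0"]) simp

lemma poly2_monomial:
  assumes "i + j \<le> m"
  shows "(\<lambda>y. (y $ 1) ^ i * (y $ 2) ^ j) \<in> poly2 m"
proof -
  have "(\<Sum>p\<in>{(i, j). i + j \<le> m}. (if p = (i, j) then (y $ 1) ^ fst p * (y $ 2) ^ snd p else 0)) = (y $ 1) ^ i * (y $ 2) ^ j"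
    for y :: point
    using assms by (subst sum.delta[OF finite_degrees]) auto
  moreover have "(\<Sum>p\<in>{(i, j). i + j \<le> m}. (if p = (i, j) then (y $ 1) ^ fst p * (y $ 2) ^ snd p else 0))
    = (\<Sum>(i', j')\<in>{(i, j). i + j \<le> m}. (if (i', j') = (i, j) then 1 else 0) * (y $ 1) ^ i' * (y $ 2) ^ j')" for y :: point
    by (rule sum.cong) (auto split: if_splits)
  ultimately show ?thesis unfolding poly2_def
    by (intro CollectI exI[of _ "\<lambda>i' j'. if (i', j') = (i, j) then 1 else 0"]) (simp add: fun_eq_iff)
qed

lemma L2_extend_zero:
  fixes v :: "'a::euclidean_space \<Rightarrow> real"
  assumes "L2 S v" "S \<in> sets lebesgue" "U \<in> sets lebesgue" "\<And>x. x \<notin> S \<Longrightarrow> v x = 0"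
  shows "L2 U v"
proof -
  have "L2 (U - S) v" by (rule L2_cong_AE[OF L2_zero]) (use assms in \<open>auto intro!: AE_I2\<close>)
  from L2_Un[OF this assms(1)] have "L2 ((U - S) \<union> S) v" using assms by blast
  then show ?thesis by (rule L2_subset) (use assms in auto)
qed

context dg_mesh
begin

lemma Om_sets: "Om G \<in> sets lebesgue"
  using open_Om by auto

lemma Sh_subspace: "function_subspace (Sh G m M)"
proof
  show "(\<lambda>x. 0) \<in> Sh G m M" unfolding Sh_def Sloc_chart
    using poly2_zero by (auto intro!: bexI[of _ "\<lambda>y. 0"])
  fix u v c assume u: "u \<in> Sh G m M" and v: "v \<in> Sh G m M"
  have "(\<lambda>x. u x + c * v x) \<in> Sloc m M T" if T: "T \<in> tris M" for T
  proof -
    obtain p q where "p \<in> poly2 m" "AE x in lebesgue_on (elem M T). u x = p (chart T x)"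
      "q \<in> poly2 m" "AE x in lebesgue_on (elem M T). v x = q (chart T x)"
      using u v T unfolding Sh_def Sloc_chart by blast
    then show ?thesis unfolding Sloc_chart
      by (intro bexI[of _ "\<lambda>y. p y + c * q y"] poly2_lincomb) auto
  qed
  then show "(\<lambda>x. u x + c * v x) \<in> Sh G m M" using u v L2_lincomb unfolding Sh_def by blast
qed

lemma Sh_L2: "v \<in> Sh G m M \<Longrightarrow> L2 (Om G) v"
  by (simp add: Sh_def)

lemma Sh_smooth: "v \<in> Sh G m M \<Longrightarrow> smooth v"
  by (rule Sloc_smooth[where k=m]) (simp add: Sh_def)

lemma Sh_lincomb: "u \<in> Sh G m M \<Longrightarrow> v \<in> Sh G m M \<Longrightarrow> lincomb (\<lambda>x. u x + c * v x) u c v"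
  using Sh_smooth by (simp add: lincomb_def)

lemma Sh_lincomb_AE:
  assumes "u \<in> Sh G m M" "\<And>T. T \<in> tris M \<Longrightarrow> AE x in lebesgue_on (elem M T). v x = u x"
  shows "lincomb v u 0 u"
  using assms Sh_smooth by (simp add: lincomb_def)

lemma a_h_functional:
  assumes "v \<in> Sh G m M"
  shows "linear_functional_on (Sh G m M) (a_h G M m \<sigma> \<beta> v)"
  unfolding linear_functional_on_def
proof (intro ballI allI)
  fix u w c assume "u \<in> Sh G m M" "w \<in> Sh G m M"
  from a_h_lin[OF Sh_lincomb[OF this], of c v]
  show "a_h G M m \<sigma> \<beta> v (\<lambda>x. u x + c * w x) = a_h G M m \<sigma> \<beta> v u + c * a_h G M m \<sigma> \<beta> v w"
    by (simp only: a_h_commute[of v])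
qed

text \<open>Mapped monomials on one element, extended by zero. They serve as a spanning family for
  \<open>galerkin_solvable\<close>, which allows linear dependence.\<close>

definition shape :: "point set \<times> nat \<times> nat \<Rightarrow> point \<Rightarrow> real" where
  "shape = (\<lambda>(T, i, j) x. if x \<in> elem M T then (chart T x $ 1) ^ i * (chart T x $ 2) ^ j else 0)"

lemma shape_Sh:
  assumes T: "T \<in> tris M" and ij: "i + j \<le> m"
  shows "shape (T, i, j) \<in> Sh G m M"
proof -
  let ?K = "elem M T"
  have c: "continuous_on (closure ?K) (\<lambda>x. (chart T x $ 1) ^ i * (chart T x $ 2) ^ j)"
    using continuous_chart[OF T] by (intro continuous_intros)
  have "compact (closure ?K)" using bounded_elem[OF T] by (simp add: compact_closure)
  then obtain b where b: "\<And>x. x \<in> closure ?K \<Longrightarrow> \<bar>(chart T x $ 1) ^ i * (chart T x $ 2) ^ j\<bar> \<le> b"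
    using compact_imp_bounded[OF compact_continuous_image[OF c]] by (auto simp: bounded_iff)
  have "L2 ?K (\<lambda>x. (chart T x $ 1) ^ i * (chart T x $ 2) ^ j)"
  proof (rule L2_bounded_continuous[OF continuous_on_subset[OF c closure_subset] elem_lmeasurable[OF T]])
    show "\<bar>(chart T x $ 1) ^ i * (chart T x $ 2) ^ j\<bar> \<le> b" if "x \<in> ?K" for x
      using b that closure_subset by blast
  qed
  then have "L2 ?K (shape (T, i, j))"
    by (rule L2_cong_AE) (auto intro!: AE_I2 elem_sets simp: shape_def)
  then have "L2 (Om G) (shape (T, i, j))"
    by (rule L2_extend_zero[OF _ elem_sets Om_sets]) (simp add: shape_def)
  moreover have "shape (T, i, j) \<in> Sloc m M T'" if T': "T' \<in> tris M" for T'
  proof (cases "T' = T")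
    case True
    then show ?thesis unfolding Sloc_chart
      by (intro bexI[OF _ poly2_monomial[OF ij]] AE_I2) (simp add: shape_def)
  next
    case False
    then have "elem M T' \<inter> elem M T = {}" using elems_disjoint T T' by blast
    then show ?thesis unfolding Sloc_chart
      by (intro bexI[OF _ poly2_zero] AE_I2) (auto simp: shape_def)
  qed
  ultimately show ?thesis by (simp add: Sh_def)
qed

definition shapes :: "(point set \<times> nat \<times> nat) set" where
  "shapes = tris M \<times> {(i, j). i + j \<le> m}"

lemma finite_shapes: "finite shapes"
  unfolding shapes_def using finite_tris finite_degrees by (rule finite_cartesian_product)

lemma Sh_expansion:
  assumes v: "v \<in> Sh G m M"
  shows "\<exists>c. \<forall>T\<in>tris M. AE x in lebesgue_on (elem M T). v x = (\<Sum>s\<in>shapes. c s * shape s x)"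
proof -
  have "\<forall>T\<in>tris M. \<exists>a. AE x in lebesgue_on (elem M T).
      v x = (\<Sum>(i, j)\<in>{(i, j). i + j \<le> m}. a i j * (chart T x $ 1) ^ i * (chart T x $ 2) ^ j)"
    using v unfolding Sh_def Sloc_chart poly2_def by auto
  then obtain a where a: "\<And>T. T \<in> tris M \<Longrightarrow> AE x in lebesgue_on (elem M T).
      v x = (\<Sum>(i, j)\<in>{(i, j). i + j \<le> m}. a T i j * (chart T x $ 1) ^ i * (chart T x $ 2) ^ j)"
    using bchoice[of "tris M"] by meson
  let ?c = "\<lambda>(T, i, j). a T i j"
  have "AE x in lebesgue_on (elem M T). v x = (\<Sum>s\<in>shapes. ?c s * shape s x)" if T: "T \<in> tris M" for T
    using a[OF T]
  proof (rule lebesgue_on_mono)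
    fix x assume x: "x \<in> elem M T"
      and vx: "v x = (\<Sum>(i, j)\<in>{(i, j). i + j \<le> m}. a T i j * (chart T x $ 1) ^ i * (chart T x $ 2) ^ j)"
    have z: "shape (T', p) x = 0" if "T' \<in> tris M - {T}" for T' p
      using elems_disjoint T that x by (cases p) (auto simp: shape_def)
    have "(\<Sum>s\<in>shapes. ?c s * shape s x) = (\<Sum>T'\<in>tris M. \<Sum>p\<in>{(i, j). i + j \<le> m}. ?c (T', p) * shape (T', p) x)"
      unfolding shapes_def by (simp add: sum.cartesian_product case_prod_beta)
    also have "\<dots> = (\<Sum>p\<in>{(i, j). i + j \<le> m}. ?c (T, p) * shape (T, p) x)"
      using T z by (subst sum.remove[OF finite_tris T]) simp
    also have "\<dots> = v x" unfolding vx using x by (intro sum.cong) (auto simp: shape_def)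
    finally show "v x = (\<Sum>s\<in>shapes. ?c s * shape s x)" by simp
  qed
  then show ?thesis by blast
qed

lemma hnorm_eq_0_imp_AE_zero:
  assumes v: "v \<in> Sh G m M" and z: "hnorm G M m \<sigma> \<beta> v = 0"
  shows "AE x in lebesgue_on (Om G). v x = 0"
proof -
  have s: "energy_sq M \<beta> v + jump_sq G M m \<sigma> \<beta> v = 0" using hnorm_sq[of v] z by simp
  then have e: "grad_form v v = 0" and j: "jump_sq G M m \<sigma> \<beta> v = 0"
    using energy_sq_nonneg[of v] jump_sq_nonneg[of v] energy_sq_eq[of v] by linarith+
  let ?f = "\<lambda>T x. (\<beta> x *\<^sub>R wgrad (elem M T) v x) \<bullet> wgrad (elem M T) v x"
  have pos: "AE x in lebesgue_on (elem M T). 0 \<le> ?f T x" if "T \<in> tris M" for T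
    using beta_bounds[OF that] by eventually_elim (use blo in auto)
  have "\<exists>k. rep T v (\<lambda>x. k) (\<lambda>x. 0)" if T: "T \<in> tris M" for T
  proof -
    have "\<forall>T\<in>tris M. (LINT x|lebesgue_on (elem M T). ?f T x) = 0"
      using e unfolding grad_form_def
      by (rule sum_nonneg_eq_0_iff[OF finite_tris, THEN iffD1, rotated]) (rule integral_nonneg_AE[OF pos])
    then have "(LINT x|lebesgue_on (elem M T). ?f T x) = 0" using T by blast
    then have "AE x in lebesgue_on (elem M T). ?f T x = 0"
      using integral_nonneg_eq_0_iff_AE[OF energy_integrable[OF T L2_wgrad L2_wgrad] pos[OF T]] by simp
    then have "AE x in lebesgue_on (elem M T). wgrad (elem M T) v x = 0"
      using beta_bounds[OF T] by eventually_elim (use blo in auto)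
    moreover obtain q where "q \<in> poly2 m" "AE x in lebesgue_on (elem M T). v x = q (chart T x)"
      using v T unfolding Sh_def Sloc_chart by blast
    ultimately show ?thesis
      using Sloc_gradient_zero_imp_constant[OF T poly2_real_polynomial_function] by blast
  qed
  then have "\<forall>T\<in>tris M. \<exists>k. rep T v (\<lambda>x. k) (\<lambda>x. 0)" by blast
  then obtain k where "\<And>T. T \<in> tris M \<Longrightarrow> rep T v (\<lambda>x. k T) (\<lambda>x. 0)"
    using bchoice[of "tris M"] by meson
  then show ?thesis using j by (rule elementwise_constant_jump_zero)
qed

text \<open>Testing with the finitely many mapped monomials suffices, because every test function is
  almost everywhere a combination of them and both forms ignore null sets. Coercivity at the
  difference of two solutions gives uniqueness.\<close>

lemma discrete_problem_unique_solution:
  assumes coer: "\<And>v. v \<in> Sh G m M \<Longrightarrow> 1/2 * (hnorm G M m \<sigma> \<beta> v)\<^sup>2 \<le> a_h G M m \<sigma> \<beta> v v"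
    and f: "L2 (Om G) f" and g: "L2_curve (cb G) g"
  shows "\<exists>u\<in>Sh G m M. (\<forall>v\<in>Sh G m M. a_h G M m \<sigma> \<beta> u v = L_h G M m \<sigma> \<beta> f g v) \<and>
     (\<forall>u'\<in>Sh G m M. (\<forall>v\<in>Sh G m M. a_h G M m \<sigma> \<beta> u' v = L_h G M m \<sigma> \<beta> f g v) \<longrightarrow>
        (AE x in lebesgue_on (Om G). u' x = u x))"
proof -
  interpret function_subspace "Sh G m M" by (rule Sh_subspace)
  let ?a = "a_h G M m \<sigma> \<beta>" and ?L = "L_h G M m \<sigma> \<beta> f g"
  have def: "AE x in lebesgue_on (Om G). v x = 0" if v: "v \<in> Sh G m M" and a0: "?a v v = 0" for v
  proof -
    have "(hnorm G M m \<sigma> \<beta> v)\<^sup>2 \<le> 0" using coer[OF v] a0 by simp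
    then show ?thesis using hnorm_eq_0_imp_AE_zero[OF v] by simp
  qed
  have elem_AE: "AE x in lebesgue_on (elem M T). P x" if T: "T \<in> tris M" and P: "AE x in lebesgue_on (Om G). P x" for T P
  proof -
    have "AE x in lebesgue_on (elem M T). x \<in> Om G"
      using AE_elem_subdomains[OF T] by eventually_elim (use Om_eq in blast)
    then show ?thesis
      using P unfolding AE_lebesgue_on_iff[OF elem_sets] AE_lebesgue_on_iff[OF Om_sets]
      by eventually_elim blast
  qed
  have L: "linear_functional_on (Sh G m M) ?L"
    unfolding linear_functional_on_def
  proof (intro ballI allI)
    fix u v c assume uv: "u \<in> Sh G m M" "v \<in> Sh G m M"
    show "?L (\<lambda>x. u x + c * v x) = ?L u + c * ?L v"
      by (rule L_h_lin[OF f g Sh_lincomb[OF uv]]) (use uv comb Sh_L2 in auto)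
  qed
  \<comment> \<open>Linearity with coefficient 0: almost everywhere, v is v' plus 0 times
    v'.\<close>
  have AE_eq: "?a z v = ?a z v'" "?L v = ?L v'"
    if v: "v \<in> Sh G m M" "v' \<in> Sh G m M" "\<And>T. T \<in> tris M \<Longrightarrow> AE x in lebesgue_on (elem M T). v x = v' x" for z v v'
  proof -
    have l: "lincomb v v' 0 v'" using v(2,3) by (rule Sh_lincomb_AE)
    show "?L v = ?L v'" using L_h_lin[OF f g l] Sh_L2 v by simp
    show "?a z v = ?a z v'" using a_h_lin[OF l, of z] by (simp add: a_h_commute[of z])
  qed
  \<comment> \<open>Compatibility of the load with directions of zero energy: these vanish almost
    everywhere, so the load treats them as the zero function.\<close>
  have null: "?L v = 0" if v: "v \<in> Sh G m M" "?a v v = 0" for v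
  proof -
    have "?L v = ?L (\<lambda>x. 0)" by (rule AE_eq(2)[OF v(1) zero elem_AE[OF _ def[OF v]]])
    then show ?thesis using functional_zero[OF L] by simp
  qed
  have pos: "0 \<le> ?a v v" if "v \<in> Sh G m M" for v
    using coer[OF that] zero_le_power2[of "hnorm G M m \<sigma> \<beta> v"] by linarith
  have shapes_Sh: "shape s \<in> Sh G m M" if "s \<in> shapes" for s
    using that shape_Sh by (auto simp: shapes_def)
  obtain u where u: "u \<in> Sh G m M" "\<And>s. s \<in> shapes \<Longrightarrow> ?a u (shape s) = ?L (shape s)"
    using galerkin_solvable[of ?a shapes shape ?L, OF a_h_commute a_h_functional pos finite_shapes shapes_Sh L null]
    by blast
  have sol: "?a u v = ?L v" if v: "v \<in> Sh G m M" for v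
  proof -
    obtain c where c: "\<And>T. T \<in> tris M \<Longrightarrow> AE x in lebesgue_on (elem M T). v x = (\<Sum>s\<in>shapes. c s * shape s x)"
      using Sh_expansion[OF v] by blast
    let ?v = "\<lambda>x. \<Sum>s\<in>shapes. c s * shape s x"
    note sum_L = functional_sum[OF L finite_shapes, where \<phi>=shape and c=c, OF shapes_Sh]
    note sum_a = functional_sum[OF a_h_functional[OF u(1)] finite_shapes, where \<phi>=shape and c=c, OF shapes_Sh]
    have v': "?v \<in> Sh G m M" using sum_L by blast
    have "?a u v = ?a u ?v" by (rule AE_eq(1)[OF v v' c])
    also have "\<dots> = ?L ?v" using sum_a sum_L u(2) by simp
    also have "\<dots> = ?L v" by (rule AE_eq(2)[OF v v' c, symmetric])
    finally show ?thesis .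
  qed
  have uniq: "AE x in lebesgue_on (Om G). u' x = u x"
    if u': "u' \<in> Sh G m M" and s': "\<forall>v\<in>Sh G m M. ?a u' v = ?L v" for u'
  proof -
    let ?d = "\<lambda>x. u' x + (- 1) * u x"
    have d: "?d \<in> Sh G m M" by (rule comb[OF u' u(1)])
    have "?a ?d ?d = ?a u' ?d + (- 1) * ?a u ?d" by (rule a_h_lin[OF Sh_lincomb[OF u' u(1)]])
    also have "\<dots> = 0" using bspec[OF s' d] sol[OF d] by simp
    finally have "AE x in lebesgue_on (Om G). ?d x = 0" by (rule def[OF d])
    then show ?thesis by eventually_elim simp
  qed
  show ?thesis using u(1) sol uniq by (intro bexI[of _ u]) auto
qed

end

section \<open>Assembly for families of meshes\<close>

theorem lemma4p4:
  fixes m :: nat and s \<sigma>0 \<epsilon>0 \<epsilon> Csh h0 blo bhi :: real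
    and G :: geometry and f g :: "point \<Rightarrow> real"
  assumes "m \<ge> 1" and "s > 3/2" and "\<sigma>0 > 0" and "h0 > 0"
    and "geometry_ok G \<epsilon>0" and "0 < \<epsilon>" and "\<epsilon> \<le> \<epsilon>0"
    and "0 < blo" and "blo \<le> bhi"
    and "L2 (Om G) f" and "L2_curve (cb G) g"
  shows
    "(\<exists>C>0. \<forall>\<beta> H \<T>. coefficient_ok G blo bhi \<beta> \<and> mesh_family G \<epsilon> Csh h0 H \<T> \<longrightarrow>
        (\<forall>h\<in>H. \<forall>w\<in>Hs_broken G s (\<T> h). \<forall>v\<in>Hs_broken G s (\<T> h).
           \<bar>a_h G (\<T> h) m \<sigma>0 \<beta> w v\<bar>
             \<le> C * hnorm3 G (\<T> h) m \<sigma>0 \<beta> w * hnorm3 G (\<T> h) m \<sigma>0 \<beta> v))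
     \<and>
     (closed_curve 3 (cb G) \<and> closed_curve 3 (ci G) \<longrightarrow>
       (\<exists>C>0. \<forall>\<beta> H \<T> Cit. coefficient_ok G blo bhi \<beta> \<and> mesh_family G \<epsilon> Csh h0 H \<T> \<and> Cit > 0 \<and>
          (\<forall>h\<in>H. \<forall>v\<in>Sh G m (\<T> h).
             flux_sq G (\<T> h) m \<sigma>0 \<beta> v \<le> Cit / \<sigma>0 * energy_sq (\<T> h) \<beta> v) \<longrightarrow>
          (\<forall>h\<in>H. \<forall>w\<in>Hs_broken G s (\<T> h). \<forall>v\<in>Sh G m (\<T> h).
             \<bar>a_h G (\<T> h) m \<sigma>0 \<beta> w v\<bar>
               \<le> C * sqrt (1 + Cit / \<sigma>0) * hnorm3 G (\<T> h) m \<sigma>0 \<beta> w * hnorm G (\<T> h) m \<sigma>0 \<beta> v)))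
     \<and>
     (closed_curve 3 (cb G) \<and> closed_curve 3 (ci G) \<longrightarrow>
       (\<forall>\<beta> H \<T> Cit. coefficient_ok G blo bhi \<beta> \<and> mesh_family G \<epsilon> Csh h0 H \<T> \<and> Cit > 0 \<and>
          (\<forall>h\<in>H. \<forall>v\<in>Sh G m (\<T> h).
             flux_sq G (\<T> h) m \<sigma>0 \<beta> v \<le> Cit / \<sigma>0 * energy_sq (\<T> h) \<beta> v) \<and>
          \<sigma>0 \<ge> 4 * Cit \<longrightarrow>
          (\<forall>h\<in>H.
             (\<forall>v\<in>Sh G m (\<T> h). a_h G (\<T> h) m \<sigma>0 \<beta> v v \<ge> 1/2 * (hnorm G (\<T> h) m \<sigma>0 \<beta> v)\<^sup>2) \<and>
             (\<exists>u\<in>Sh G m (\<T> h).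
                (\<forall>v\<in>Sh G m (\<T> h). a_h G (\<T> h) m \<sigma>0 \<beta> u v = L_h G (\<T> h) m \<sigma>0 \<beta> f g v) \<and>
                (\<forall>u'\<in>Sh G m (\<T> h).
                   (\<forall>v\<in>Sh G m (\<T> h). a_h G (\<T> h) m \<sigma>0 \<beta> u' v = L_h G (\<T> h) m \<sigma>0 \<beta> f g v) \<longrightarrow>
                   (AE x in lebesgue_on (Om G). u' x = u x))))))"
proof -
  have dg: "dg_mesh G \<epsilon>0 \<epsilon> Csh (\<T> h) \<beta> blo bhi m \<sigma>0"
    if "coefficient_ok G blo bhi \<beta>" "mesh_family G \<epsilon> Csh h0 H \<T>" "h \<in> H" for \<beta> H \<T> h
    using that assms unfolding dg_mesh_def mesh_family_def by blast
  show ?thesis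
  proof (intro conjI impI)
    show "\<exists>C>0. \<forall>\<beta> H \<T>. coefficient_ok G blo bhi \<beta> \<and> mesh_family G \<epsilon> Csh h0 H \<T> \<longrightarrow>
        (\<forall>h\<in>H. \<forall>w\<in>Hs_broken G s (\<T> h). \<forall>v\<in>Hs_broken G s (\<T> h).
           \<bar>a_h G (\<T> h) m \<sigma>0 \<beta> w v\<bar>
             \<le> C * hnorm3 G (\<T> h) m \<sigma>0 \<beta> w * hnorm3 G (\<T> h) m \<sigma>0 \<beta> v)"
    \<comment> \<open>The witness is a numeral and thus common to all coefficients, families and
      mesh sizes.\<close>
    proof (intro exI[of _ "4::real"] conjI allI impI ballI)
      fix \<beta> H \<T> h w v
      assume "coefficient_ok G blo bhi \<beta> \<and> mesh_family G \<epsilon> Csh h0 H \<T>" "h \<in> H"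
      then interpret dg_mesh G \<epsilon>0 \<epsilon> Csh "\<T> h" \<beta> blo bhi m \<sigma>0 using dg by blast
      show "\<bar>a_h G (\<T> h) m \<sigma>0 \<beta> w v\<bar>
             \<le> 4 * hnorm3 G (\<T> h) m \<sigma>0 \<beta> w * hnorm3 G (\<T> h) m \<sigma>0 \<beta> v"
        by (rule continuity)
    qed simp
    show "\<exists>C>0. \<forall>\<beta> H \<T> Cit. coefficient_ok G blo bhi \<beta> \<and> mesh_family G \<epsilon> Csh h0 H \<T> \<and> Cit > 0 \<and>
          (\<forall>h\<in>H. \<forall>v\<in>Sh G m (\<T> h).
             flux_sq G (\<T> h) m \<sigma>0 \<beta> v \<le> Cit / \<sigma>0 * energy_sq (\<T> h) \<beta> v) \<longrightarrow>
          (\<forall>h\<in>H. \<forall>w\<in>Hs_broken G s (\<T> h). \<forall>v\<in>Sh G m (\<T> h).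
             \<bar>a_h G (\<T> h) m \<sigma>0 \<beta> w v\<bar>
               \<le> C * sqrt (1 + Cit / \<sigma>0) * hnorm3 G (\<T> h) m \<sigma>0 \<beta> w * hnorm G (\<T> h) m \<sigma>0 \<beta> v)"
    \<comment> \<open>The constant is fixed before \<open>Cit\<close>; all dependence on
      \<open>Cit\<close> sits in the square root.\<close>
    proof (intro exI[of _ "4::real"] conjI allI impI ballI)
      fix \<beta> H \<T> Cit h w v
      assume a: "coefficient_ok G blo bhi \<beta> \<and> mesh_family G \<epsilon> Csh h0 H \<T> \<and> Cit > 0 \<and>
          (\<forall>h\<in>H. \<forall>v\<in>Sh G m (\<T> h).
             flux_sq G (\<T> h) m \<sigma>0 \<beta> v \<le> Cit / \<sigma>0 * energy_sq (\<T> h) \<beta> v)"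
        and h: "h \<in> H" and v: "v \<in> Sh G m (\<T> h)"
      then interpret dg_mesh G \<epsilon>0 \<epsilon> Csh "\<T> h" \<beta> blo bhi m \<sigma>0 using dg by blast
      have "0 \<le> hnorm3 G (\<T> h) m \<sigma>0 \<beta> w"
        unfolding hnorm3_eq using energy_sq_nonneg jump_sq_nonneg flux_sq_nonneg by simp
      moreover have "hnorm3 G (\<T> h) m \<sigma>0 \<beta> v \<le> sqrt (1 + Cit / \<sigma>0) * hnorm G (\<T> h) m \<sigma>0 \<beta> v"
        using a h v by (intro hnorm3_le) auto
      ultimately have "4 * hnorm3 G (\<T> h) m \<sigma>0 \<beta> w * hnorm3 G (\<T> h) m \<sigma>0 \<beta> v
          \<le> 4 * hnorm3 G (\<T> h) m \<sigma>0 \<beta> w * (sqrt (1 + Cit / \<sigma>0) * hnorm G (\<T> h) m \<sigma>0 \<beta> v)"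
        by (intro mult_left_mono) auto
      with continuity[of w v] show "\<bar>a_h G (\<T> h) m \<sigma>0 \<beta> w v\<bar>
               \<le> 4 * sqrt (1 + Cit / \<sigma>0) * hnorm3 G (\<T> h) m \<sigma>0 \<beta> w * hnorm G (\<T> h) m \<sigma>0 \<beta> v"
        by (simp add: mult_ac)
    qed simp
    show "\<forall>\<beta> H \<T> Cit. coefficient_ok G blo bhi \<beta> \<and> mesh_family G \<epsilon> Csh h0 H \<T> \<and> Cit > 0 \<and>
          (\<forall>h\<in>H. \<forall>v\<in>Sh G m (\<T> h).
             flux_sq G (\<T> h) m \<sigma>0 \<beta> v \<le> Cit / \<sigma>0 * energy_sq (\<T> h) \<beta> v) \<and>
          \<sigma>0 \<ge> 4 * Cit \<longrightarrow>
          (\<forall>h\<in>H.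
             (\<forall>v\<in>Sh G m (\<T> h). a_h G (\<T> h) m \<sigma>0 \<beta> v v \<ge> 1/2 * (hnorm G (\<T> h) m \<sigma>0 \<beta> v)\<^sup>2) \<and>
             (\<exists>u\<in>Sh G m (\<T> h).
                (\<forall>v\<in>Sh G m (\<T> h). a_h G (\<T> h) m \<sigma>0 \<beta> u v = L_h G (\<T> h) m \<sigma>0 \<beta> f g v) \<and>
                (\<forall>u'\<in>Sh G m (\<T> h).
                   (\<forall>v\<in>Sh G m (\<T> h). a_h G (\<T> h) m \<sigma>0 \<beta> u' v = L_h G (\<T> h) m \<sigma>0 \<beta> f g v) \<longrightarrow>
                   (AE x in lebesgue_on (Om G). u' x = u x))))"
    proof (intro allI impI ballI)
      fix \<beta> H \<T> Cit h
      assume a: "coefficient_ok G blo bhi \<beta> \<and> mesh_family G \<epsilon> Csh h0 H \<T> \<and> Cit > 0 \<and>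
          (\<forall>h\<in>H. \<forall>v\<in>Sh G m (\<T> h).
             flux_sq G (\<T> h) m \<sigma>0 \<beta> v \<le> Cit / \<sigma>0 * energy_sq (\<T> h) \<beta> v) \<and>
          \<sigma>0 \<ge> 4 * Cit" and h: "h \<in> H"
      then interpret dg_mesh G \<epsilon>0 \<epsilon> Csh "\<T> h" \<beta> blo bhi m \<sigma>0 using dg by blast
      have coer: "1/2 * (hnorm G (\<T> h) m \<sigma>0 \<beta> v)\<^sup>2 \<le> a_h G (\<T> h) m \<sigma>0 \<beta> v v" if "v \<in> Sh G m (\<T> h)" for v
        using a h that by (intro coercivity[of Cit]) auto
      from discrete_problem_unique_solution[OF coer assms(10,11)] coer
      show "(\<forall>v\<in>Sh G m (\<T> h). a_h G (\<T> h) m \<sigma>0 \<beta> v v \<ge> 1/2 * (hnorm G (\<T> h) m \<sigma>0 \<beta> v)\<^sup>2) \<and>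
             (\<exists>u\<in>Sh G m (\<T> h).
                (\<forall>v\<in>Sh G m (\<T> h). a_h G (\<T> h) m \<sigma>0 \<beta> u v = L_h G (\<T> h) m \<sigma>0 \<beta> f g v) \<and>
                (\<forall>u'\<in>Sh G m (\<T> h).
                   (\<forall>v\<in>Sh G m (\<T> h). a_h G (\<T> h) m \<sigma>0 \<beta> u' v = L_h G (\<T> h) m \<sigma>0 \<beta> f g v) \<longrightarrow>
                   (AE x in lebesgue_on (Om G). u' x = u x)))" by blast
    qed
  qed
qed

end
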